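(* Let $\zeta=\{z_n\}_{n\in N}$, $\delta,\lambda,r,M_\zeta,B_\zeta$ be as in the context and let $X$ be a complex Banach space. Set $A:=\mathbb D_{r/(3M_\zeta)}\setminus\bar{\mathbb D}_{r/(6M_\zeta)}$, $A_\zeta:=B_\zeta^{-1}(A)\subset\mathbb D$, $S_{\zeta1}:=B_\zeta^{-1}(\mathbb D\setminus\bar{\mathbb D}_{r/(6M_\zeta)})$, $S_{\zeta2}:=B_\zeta^{-1}(\mathbb D_{r/(3M_\zeta)})$. Then there exist bounded linear operators $T_i:H^\infty(A_\zeta,X)\to H^\infty(S_{\zeta i},X)$, $i=1,2$, with $\|T_1\|\le6M_\zeta$ and $\|T_2\|\le4M_\zeta$, such that $$(T_1f)|_{A_\zeta}+(T_2f)|_{A_\zeta}=f\quad\text{for all }f\in H^\infty(A_\zeta,X).$$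
   Context: $\mathbb D$ open unit disk, $\mathbb D_t=\{|z|<t\}$, $\bar{\mathbb D}_t$ its closure, $\rho(z,w)=|z-w|/|1-\bar wz|$. $\zeta=\{z_n\}_{n\in N}\subset\mathbb D$ is an interpolating sequence for $H^\infty$ (every bounded data $\{a_n\}$ equals $\{g(z_n)\}$ for some bounded holomorphic $g$ on $\mathbb D$) with $\delta(\zeta):=\inf_k\prod_{j\ne k}\rho(z_j,z_k)\ge\delta>0$, and $M_\zeta$ is its constant of interpolation (least $M$ such that solutions $g$ with $\sup|g|\le M\sup|a_n|$ always exist). $\lambda\in(0,1)$ satisfies $\frac{2\lambda}{1+\lambda^2}<\delta$ and $r=\frac{\delta-\lambda}{1-\lambda\delta}\lambda$. $B_\zeta$ is the Blaschke product with simple zeros at the points of $\zeta$. For an open set $U$, $H^\infty(U,X)$ is the Banach space of bounded $X$-valued holomorphic functions on $U$ with sup norm. *)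

theory Defs
  imports "HOL-Analysis.Analysis"
begin

class complex_normed_vector = real_normed_vector +
  fixes scaleC :: "complex \<Rightarrow> 'a \<Rightarrow> 'a"
  assumes scaleC_add_right: "scaleC a (x + y) = scaleC a x + scaleC a y"
    and scaleC_add_left: "scaleC (a + b) x = scaleC a x + scaleC b x"
    and scaleC_scaleC: "scaleC a (scaleC b x) = scaleC (a * b) x"
    and scaleC_one: "scaleC 1 x = x"
    and scaleC_of_real: "scaleC (complex_of_real r) x = r *\<^sub>R x"
    and norm_scaleC: "norm (scaleC a x) = cmod a * norm x"

definition rho :: "complex \<Rightarrow> complex \<Rightarrow> real" where
  "rho z w = cmod (z - w) / cmod (1 - cnj w * z)"

definition udisk :: "real \<Rightarrow> complex set" where
  "udisk t = ball 0 t"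

definition cudisk :: "real \<Rightarrow> complex set" where
  "cudisk t = cball 0 t"

definition bounded_holo_disk :: "(complex \<Rightarrow> complex) \<Rightarrow> bool" where
  "bounded_holo_disk g \<longleftrightarrow> g holomorphic_on ball 0 1 \<and> bounded (g ` ball 0 1)"

definition interpolating :: "(nat \<Rightarrow> complex) \<Rightarrow> bool" where
  "interpolating z \<longleftrightarrow> (\<forall>n. z n \<in> ball 0 1) \<and> inj z \<and>
     (\<forall>a :: nat \<Rightarrow> complex. bounded (range a) \<longrightarrow>
        (\<exists>g. bounded_holo_disk g \<and> (\<forall>n. g (z n) = a n)))"

text \<open>Separation constant: \<open>inf_k prod_{j\<noteq>k} rho(z_j,z_k)\<close>; since the factors lie in [0,1],
  the infinite product equals the infimum of its partial products.\<close>
definition sep_const :: "(nat \<Rightarrow> complex) \<Rightarrow> real" where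
  "sep_const z = (INF k. INF n. \<Prod>j\<in>{..<n} - {k}. rho (z j) (z k))"

definition interp_const :: "(nat \<Rightarrow> complex) \<Rightarrow> real" where
  "interp_const z = Inf {M. \<forall>a :: nat \<Rightarrow> complex. bounded (range a) \<longrightarrow>
      (\<exists>g. bounded_holo_disk g \<and> (\<forall>n. g (z n) = a n) \<and>
           (\<forall>w\<in>ball 0 1. cmod (g w) \<le> M * (SUP n. cmod (a n))))}"

definition blaschke_factor :: "complex \<Rightarrow> complex \<Rightarrow> complex" where
  "blaschke_factor a w = (if a = 0 then w
     else (complex_of_real (cmod a) / a) * (a - w) / (1 - cnj a * w))"

definition blaschke :: "(nat \<Rightarrow> complex) \<Rightarrow> complex \<Rightarrow> complex" where
  "blaschke z w = lim (\<lambda>n. \<Prod>k<n. blaschke_factor (z k) w)"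

definition vholo_on :: "(complex \<Rightarrow> 'x::complex_normed_vector) \<Rightarrow> complex set \<Rightarrow> bool" where
  "vholo_on f U \<longleftrightarrow> (\<forall>w\<in>U. \<exists>D. (f has_derivative (\<lambda>h. scaleC h D)) (at w))"

definition Hinf :: "complex set \<Rightarrow> (complex \<Rightarrow> 'x::complex_normed_vector) set" where
  "Hinf U = {f. vholo_on f U \<and> bounded (f ` U)}"

definition supnorm :: "complex set \<Rightarrow> (complex \<Rightarrow> 'x::real_normed_vector) \<Rightarrow> real" where
  "supnorm U f = (SUP w\<in>U. norm (f w))"

definition bounded_op :: "complex set \<Rightarrow> complex set \<Rightarrow> real \<Rightarrow>
    ((complex \<Rightarrow> 'x::complex_normed_vector) \<Rightarrow> (complex \<Rightarrow> 'x)) \<Rightarrow> bool" where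
  "bounded_op U V C T \<longleftrightarrow>
     (\<forall>f\<in>Hinf U. T f \<in> Hinf V) \<and>
     (\<forall>f\<in>Hinf U. \<forall>g\<in>Hinf U. \<forall>w\<in>V. T (\<lambda>x. f x + g x) w = T f w + T g w) \<and>
     (\<forall>f\<in>Hinf U. \<forall>c. \<forall>w\<in>V. T (\<lambda>x. scaleC c (f x)) w = scaleC c (T f w)) \<and>
     (\<forall>f\<in>Hinf U. supnorm V (T f) \<le> C * supnorm U f)"

end

theory Submission
  imports Defs "HOL-Complex_Analysis.Complex_Analysis" "HOL-Real_Asymp.Real_Asymp"
    "HOL-Library.Diagonal_Subsequence" "HOL-Computational_Algebra.Fundamental_Theorem_Algebra"
begin

text \<open>
  On \<open>|B| < r\<close> the Blaschke product has holomorphic inverse branches \<open>h\<^sub>k\<close> with \<open>h\<^sub>k(0) = z\<^sub>k\<close>, and these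
  exhaust the preimage: the minimum principle for the finite partial products keeps \<open>|B| \<ge> r\<close> away from
  the pseudohyperbolic \<open>\<lambda>\<close>-discs about the \<open>z\<^sub>k\<close>. P. Beurling's functions \<open>\<phi>\<^sub>n\<close>, with \<open>\<phi>\<^sub>n(z\<^sub>k) = \<delta>\<^sub>n\<^sub>k\<close> and
  \<open>\<Sum>|\<phi>\<^sub>n| \<le> M\<close>, turn interpolation at the \<open>z\<^sub>k\<close> into a linear operation. By Schwarz--Pick the rows of
  \<open>\<phi>\<^sub>n(h\<^sub>k(w)) - \<delta>\<^sub>n\<^sub>k\<close> have \<open>\<ell>\<^sup>1\<close>-norm at most \<open>1/2\<close> for \<open>|w| < r/(3M)\<close>, so a Neumann series gives a function
  \<open>F(x,w)\<close>, holomorphic in both variables and bounded by \<open>2M \<parallel>f\<parallel>\<close>, with \<open>F(h\<^sub>k(w),w) = f(h\<^sub>k(w))\<close>. Split \<open>F\<close>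
  with respect to \<open>w\<close> into the regular and the principal part of its Laurent series, which at most multiplies
  the bound by \<open>2\<close> and \<open>3\<close> respectively, and put \<open>w = B(x)\<close>.
\<close>

section \<open>Norming functionals\<close>

text \<open>The target space is an arbitrary Banach space. Scalar complex analysis (maximum modulus,
  Cauchy, Montel) reaches it through complex functionals of norm at most 1, hence the Hahn-Banach
  part at the start. The obstacle is linearity: choosing an interpolating function for each bounded
  datum is neither linear nor meaningful for vector-valued data. A fixed family
  \<open>\<phi>\<close> with summable moduli is both, and its bound carries over to any Banach space
  unchanged. Such a family is explicit for finitely many nodes: \<open>\<phi>\<close> is a quotient
  \<open>c * q j / Q\<close>, where the polynomial \<open>q j\<close> vanishes at the other nodes
  and the zero-free \<open>Q\<close> has boundary modulus equal to a positive combination of the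
  moduli of the \<open>q j\<close>. The bound on the sum of moduli then becomes a sub-eigenvector
  inequality for the weights, which iteration solves; a normal-family limit yields the infinite
  sequence with the exact constant. The radius \<open>r / (3 * M)\<close> is the one at which
  Schwarz-Pick makes the perturbation of the identity have norm 1/2, so its inverse has norm at most
  2.\<close>

definition sublinear :: "('a::real_vector \<Rightarrow> real) \<Rightarrow> bool" where
  "sublinear p \<longleftrightarrow> (\<forall>x y. p (x + y) \<le> p x + p y) \<and> (\<forall>t>0. \<forall>x. p (t *\<^sub>R x) = t * p x)"

lemma sublinear_zero: "sublinear p \<Longrightarrow> p 0 = 0"
  unfolding sublinear_def by (metis mult_cancel_right1 scaleR_zero_right zero_less_numeral numeral_eq_one_iff semiring_norm(85))

text \<open>Supplies the lower bound, independent of \<open>t\<close>, that makes the infimum in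
  \<open>reduct\<close> finite.\<close>

lemma sublinear_bounded_below:
  assumes p: "sublinear p" and t: "0 \<le> t"
  shows "- p (- x) \<le> p (x + t *\<^sub>R y) - t * p y"
proof -
  have "t * p y = p (t *\<^sub>R y)"
    using p t sublinear_zero[OF p] by (cases "t = 0") (auto simp: sublinear_def)
  also have "\<dots> = p ((x + t *\<^sub>R y) + (- x))" by simp
  also have "\<dots> \<le> p (x + t *\<^sub>R y) + p (- x)"
    using p unfolding sublinear_def by blast
  finally show ?thesis by simp
qed

text \<open>For sublinear \<open>p\<close> this is the largest sublinear functional below
  \<open>p\<close> whose value at \<open>- y\<close> is at most \<open>- p y\<close>.\<close>

definition reduct :: "('a::real_vector \<Rightarrow> real) \<Rightarrow> 'a \<Rightarrow> 'a \<Rightarrow> real" where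
  "reduct p y x = (INF t\<in>{0..}. p (x + t *\<^sub>R y) - t * p y)"

lemma reduct_le:
  assumes p: "sublinear p" and t: "0 \<le> t"
  shows "reduct p y x \<le> p (x + t *\<^sub>R y) - t * p y"
  unfolding reduct_def
  by (rule cINF_lower) (use sublinear_bounded_below[OF p] t in \<open>auto intro!: bdd_belowI2[where m="- p (- x)"]\<close>)

lemma reduct_greatest:
  assumes "\<And>t. 0 \<le> t \<Longrightarrow> c \<le> p (x + t *\<^sub>R y) - t * p y"
  shows "c \<le> reduct p y x"
  unfolding reduct_def by (rule cINF_greatest) (use assms in auto)

text \<open>Parameters \<open>s\<close> for one summand and \<open>t\<close> for the other combine
  to the admissible parameter \<open>s + t\<close> for the sum; scaling the vector by
  \<open>t\<close> scales the parameter by \<open>t\<close>.\<close>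

lemma sublinear_reduct:
  assumes p: "sublinear p"
  shows "sublinear (reduct p y)"
  unfolding sublinear_def
proof safe
  have sub: "p (a + b) \<le> p a + p b" for a b using p by (auto simp: sublinear_def)
  fix x x'
  have "reduct p y (x + x') - (p (x + s *\<^sub>R y) - s * p y) \<le> p (x' + t *\<^sub>R y) - t * p y"
    if "0 \<le> s" "0 \<le> t" for s t
    using reduct_le[OF p, of "s + t" y "x + x'"] sub[of "x + s *\<^sub>R y" "x' + t *\<^sub>R y"] that
    by (simp add: algebra_simps)
  then have "reduct p y (x + x') - (p (x + s *\<^sub>R y) - s * p y) \<le> reduct p y x'" if "0 \<le> s" for s
    using that by (intro reduct_greatest) auto
  then have "reduct p y (x + x') - reduct p y x' \<le> p (x + s *\<^sub>R y) - s * p y" if "0 \<le> s" for s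
    using that by (force simp: algebra_simps)
  then have "reduct p y (x + x') - reduct p y x' \<le> reduct p y x"
    by (intro reduct_greatest) auto
  then show "reduct p y (x + x') \<le> reduct p y x + reduct p y x'" by simp
next
  have hom: "t > 0 \<Longrightarrow> p (t *\<^sub>R a) = t * p a" for a t using p by (auto simp: sublinear_def)
  \<comment> \<open>This inequality for all \<open>t > 0\<close> is enough: used with
    \<open>inverse t\<close> and \<open>t *\<^sub>R x\<close> it gives the reverse one.\<close>
  have le: "reduct p y (t *\<^sub>R x) \<le> t * reduct p y x" if t: "t > 0" for t x
  proof -
    have "inverse t * reduct p y (t *\<^sub>R x) \<le> p (x + s *\<^sub>R y) - s * p y" if s: "0 \<le> s" for s
    proof -
      have "reduct p y (t *\<^sub>R x) \<le> p (t *\<^sub>R (x + s *\<^sub>R y)) - (t * s) * p y"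
        using reduct_le[OF p, of "t * s" y "t *\<^sub>R x"] s t by (simp add: algebra_simps)
      also have "\<dots> = t * (p (x + s *\<^sub>R y) - s * p y)"
        by (subst hom[OF t]) (simp add: algebra_simps)
      finally show ?thesis using t by (simp add: field_simps)
    qed
    then have "inverse t * reduct p y (t *\<^sub>R x) \<le> reduct p y x" by (intro reduct_greatest) auto
    then show ?thesis using t by (simp add: field_simps)
  qed
  fix t :: real and x
  assume t: "0 < t"
  have "t * reduct p y x \<le> reduct p y (t *\<^sub>R x)"
    using le[of "inverse t" "t *\<^sub>R x"] t by (simp add: field_simps)
  with le[OF t, of x] show "reduct p y (t *\<^sub>R x) = t * reduct p y x" by simp
qed

text \<open>A minimal sublinear functional \<open>m\<close> is linear, since \<open>reduct m y \<le> m\<close> forces \<open>m x + m y \<le> m (x + y)\<close>.\<close>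
lemma sublinear_minorant_linear:
  fixes p0 :: "'a::real_vector \<Rightarrow> real"
  assumes p0: "sublinear p0"
  obtains u where "linear u" and "\<And>x. u x \<le> p0 x"
proof -
  define S where "S = {p. sublinear p \<and> p \<le> p0}"
  define r :: "('a \<Rightarrow> real) \<Rightarrow> ('a \<Rightarrow> real) \<Rightarrow> bool" where "r = (\<lambda>p q. q \<le> p)"
  have "\<exists>m\<in>S. \<forall>a\<in>S. r m a \<longrightarrow> a = m"
  proof (rule predicate_Zorn)
    show "partial_order_on S (relation_of r S)"
      unfolding r_def by (rule partial_order_on_relation_ofI) auto
    fix C assume C: "C \<in> Chains (relation_of r S)"
    show "\<exists>u\<in>S. \<forall>a\<in>C. r a u"
    proof (cases "C = {}")
      case True
      then show ?thesis using p0 by (auto simp: S_def)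
    next
      case False
      have CS: "C \<subseteq> S" using C by (auto simp: Chains_def relation_of_def)
      have tot: "p \<le> q \<or> q \<le> p" if "p \<in> C" "q \<in> C" for p q
        using C that by (auto simp: Chains_def relation_of_def r_def)
      \<comment> \<open>A lower bound common to the chain keeps its pointwise infimum
        finite.\<close>
      have bd: "- p0 (- x) \<le> p x" if "p \<in> C" for p x
      proof -
        have p: "sublinear p" "p \<le> p0" using CS that by (auto simp: S_def)
        have "0 \<le> p x + p (- x)"
          using p(1) sublinear_zero[OF p(1)] unfolding sublinear_def by (metis add.right_inverse)
        then show ?thesis using le_funD[OF p(2), of "- x"] by linarith
      qed
      define u where "u = (\<lambda>x. INF p\<in>C. p x)"
      have ule: "u x \<le> p x" if "p \<in> C" for p x
        unfolding u_def by (rule cINF_lower) (use bd that in \<open>auto intro!: bdd_belowI2[where m="- p0 (- x)"]\<close>)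
      have ugr: "c \<le> u x" if "\<And>p. p \<in> C \<Longrightarrow> c \<le> p x" for c x
        unfolding u_def by (rule cINF_greatest) (use that False in auto)
      have "sublinear u"
        unfolding sublinear_def
      proof safe
        fix x y
        have "u (x + y) - q y \<le> p x" if pq: "p \<in> C" "q \<in> C" for p q
        proof -
          \<comment> \<open>Subadditivity of the infimum needs a single functional below both
            \<open>p\<close> and \<open>q\<close>; the smaller of the two serves.\<close>
          obtain m where m: "m \<in> C" "m \<le> p" "m \<le> q" using tot[OF pq] pq by blast
          have "u (x + y) \<le> m (x + y)" using ule m(1) by blast
          also have "\<dots> \<le> m x + m y" using m(1) CS by (auto simp: S_def sublinear_def)
          also have "\<dots> \<le> p x + q y" using m by (intro add_mono) (auto simp: le_fun_def)
          finally show ?thesis by simp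
        qed
        then have "u (x + y) - q y \<le> u x" if "q \<in> C" for q using that by (intro ugr) auto
        then have "u (x + y) - u x \<le> q y" if "q \<in> C" for q using that by (force simp: algebra_simps)
        then have "u (x + y) - u x \<le> u y" by (intro ugr) auto
        then show "u (x + y) \<le> u x + u y" by simp
      next
        fix t :: real and x assume t: "0 < t"
        have hom: "p (t *\<^sub>R x) = t * p x" if "p \<in> C" for p
          using CS that t by (auto simp: S_def sublinear_def)
        have "t * u x \<le> u (t *\<^sub>R x)"
          by (rule ugr) (subst hom, assumption, use ule t in \<open>simp add: mult_left_mono\<close>)
        moreover have "inverse t * u (t *\<^sub>R x) \<le> u x"
        proof (rule ugr)
          fix p assume "p \<in> C"
          then have "u (t *\<^sub>R x) \<le> t * p x" using ule hom by metis
          then show "inverse t * u (t *\<^sub>R x) \<le> p x" using t by (simp add: field_simps)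
        qed
        ultimately show "u (t *\<^sub>R x) = t * u x" using t by (simp add: field_simps)
      qed
      moreover have "u \<le> p0"
      proof -
        obtain p where "p \<in> C" using False by blast
        then have "u x \<le> p x" "p x \<le> p0 x" for x using ule CS by (auto simp: S_def le_fun_def)
        then show ?thesis by (metis le_funI order_trans)
      qed
      ultimately show ?thesis using ule by (auto simp: S_def r_def le_fun_def)
    qed
  qed
  then obtain m where m: "sublinear m" "m \<le> p0" and min: "\<And>a. sublinear a \<Longrightarrow> a \<le> m \<Longrightarrow> a = m"
    by (auto simp: S_def r_def intro: order_trans)
  have sub: "m (a + b) \<le> m a + m b" for a b using m(1) by (auto simp: sublinear_def)
  have add: "m (x + y) = m x + m y" for x y
  proof -
    have "reduct m y \<le> m" using reduct_le[OF m(1), of 0] by (auto simp: le_fun_def)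
    then have "reduct m y = m" using min sublinear_reduct[OF m(1)] by blast
    then show ?thesis using reduct_le[OF m(1), of 1 y x] sub[of x y] by auto
  qed
  have neg: "m (- x) = - m x" for x
    using add[of x "- x"] sublinear_zero[OF m(1)] by simp
  have "linear m"
  proof (rule linearI)
    fix c :: real and x
    consider "c > 0" | "c = 0" | "c < 0" by linarith
    then show "m (c *\<^sub>R x) = c *\<^sub>R m x"
    proof cases
      case 3
      then have "m ((- c) *\<^sub>R x) = (- c) * m x" using m(1) unfolding sublinear_def by (metis neg_0_less_iff_less)
      then show ?thesis using neg[of "c *\<^sub>R x"] by simp
    qed (use m(1) sublinear_zero[OF m(1)] in \<open>auto simp: sublinear_def\<close>)
  qed (rule add)
  then show thesis using m(2) that by (auto simp: le_fun_def)
qed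

definition cdual :: "('x::complex_normed_vector \<Rightarrow> complex) \<Rightarrow> bool" where
  "cdual l \<longleftrightarrow> (\<forall>x y. l (x + y) = l x + l y) \<and> (\<forall>c x. l (scaleC c x) = c * l x) \<and> (\<forall>x. cmod (l x) \<le> norm x)"

lemma scaleC_real: "r *\<^sub>R x = scaleC (complex_of_real r) x"
  by (simp add: scaleC_of_real)

lemma cdual_bounded_linear: "cdual l \<Longrightarrow> bounded_linear l"
  by (rule bounded_linear_intro[where K=1]) (auto simp: cdual_def scaleC_real scaleR_conv_of_real)

lemma cdual_diff: "cdual l \<Longrightarrow> l (x - y) = l x - l y"
  by (rule linear_diff[OF bounded_linear.linear[OF cdual_bounded_linear]])

lemma bounded_bilinear_scaleC: "bounded_bilinear (scaleC :: complex \<Rightarrow> 'x \<Rightarrow> 'x::complex_normed_vector)"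
  by standard (auto simp: scaleC_add_left scaleC_add_right scaleC_real scaleC_scaleC scaleR_conv_of_real norm_scaleC
      mult.commute intro!: exI[of _ 1])

text \<open>A linear minorant \<open>u\<close> of \<open>reduct norm v\<close> lies below the norm
  and satisfies \<open>u (- v) \<le> - norm v\<close>, so it attains the norm at \<open>v\<close>.
  The complex functional is then rebuilt from its real part \<open>u\<close>.\<close>

theorem cdual_norming:
  fixes v :: "'x::complex_normed_vector"
  obtains l where "cdual l" and "l v = complex_of_real (norm v)"
proof -
  have n: "sublinear (norm :: 'x \<Rightarrow> real)" by (auto simp: sublinear_def norm_triangle_ineq)
  obtain u where u: "linear u" and ule: "\<And>x. u x \<le> reduct norm v x"
    using sublinear_minorant_linear[OF sublinear_reduct[OF n]] by blast
  interpret u: linear u by fact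
  have un: "u x \<le> norm x" for x using ule[of x] reduct_le[OF n, of 0 v x] by simp
  have "u (- v) \<le> - norm v" using ule[of "- v"] reduct_le[OF n, of 1 v "- v"] by simp
  then have uv: "u v = norm v" using un[of v] u.neg[of v] by simp
  \<comment> \<open>A complex linear functional is determined by its real part: the imaginary part
    at \<open>x\<close> is minus the real part at \<open>scaleC \<i> x\<close>.\<close>
  define l where "l x = Complex (u x) (- u (scaleC \<i> x))" for x
  have re: "u (scaleC (complex_of_real a) x) = a * u x" for a x
    by (simp add: scaleC_of_real u.scale)
  have add: "l (x + y) = l x + l y" for x y
    by (simp add: l_def scaleC_add_right u.add complex_eq_iff)
  have sc: "l (scaleC c x) = c * l x" for c x
  proof -
    have c: "c = complex_of_real (Re c) + complex_of_real (Im c) * \<i>" by (simp add: complex_eq_iff)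
    have "u (scaleC c x) = Re c * u x + Im c * u (scaleC \<i> x)"
      by (subst c) (simp only: scaleC_add_left u.add re flip: scaleC_scaleC)
    moreover have "\<i> * c = complex_of_real (Re c) * \<i> + complex_of_real (- Im c)"
      by (simp add: complex_eq_iff)
    then have "u (scaleC (\<i> * c) x) = Re c * u (scaleC \<i> x) - Im c * u x"
      by (simp only: scaleC_add_left u.add re flip: scaleC_scaleC)
    ultimately show ?thesis
      unfolding l_def scaleC_scaleC by (simp add: complex_eq_iff algebra_simps)
  qed
  have bd: "cmod (l x) \<le> norm x" for x
  proof (cases "l x = 0")
    case False
    \<comment> \<open>Rotating \<open>x\<close> by the unimodular \<open>e\<close> makes the value
      of \<open>l\<close> real and nonnegative, so the bound on \<open>u\<close> bounds the modulus
      of \<open>l x\<close>.\<close>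
    define e where "e = cnj (l x) / cmod (l x)"
    have e: "cmod e = 1" "e * l x = cmod (l x)"
      using False complex_norm_square[of "l x"]
      by (simp_all add: e_def norm_divide power2_eq_square divide_eq_eq mult.commute)
    have "cmod (l x) = Re (l (scaleC e x))" using e sc by simp
    also have "\<dots> = u (scaleC e x)" by (simp add: l_def)
    also have "\<dots> \<le> norm x" using un[of "scaleC e x"] e by (simp add: norm_scaleC)
    finally show ?thesis .
  qed simp
  have "cdual l" using add sc bd by (simp add: cdual_def)
  moreover have "l v = norm v"
  proof -
    have "Re (l v) = norm v" by (simp add: l_def uv)
    moreover have "Im (l v) = 0"
      using bd[of v] \<open>Re (l v) = norm v\<close> abs_Re_le_cmod[of "l v"] cmod_power2[of "l v"]
      by (metis abs_norm_cancel add_cancel_left_right antisym power2_eq_iff_nonneg norm_ge_zero zero_eq_power2)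
    ultimately show ?thesis by (simp add: complex_eq_iff)
  qed
  ultimately show thesis using that by blast
qed

lemma cdual_norm_le:
  fixes v :: "'x::complex_normed_vector"
  assumes "\<And>l. cdual l \<Longrightarrow> cmod (l v) \<le> c"
  shows "norm v \<le> c"
  using assms cdual_norming[of v] by (metis norm_of_real abs_norm_cancel)

lemma cdual_eqI:
  fixes v w :: "'x::complex_normed_vector"
  assumes "\<And>l. cdual l \<Longrightarrow> l v = l w"
  shows "v = w"
proof -
  have "norm (v - w) \<le> 0"
    by (rule cdual_norm_le) (use assms in \<open>simp add: cdual_diff\<close>)
  then show ?thesis by simp
qed

section \<open>Vector-valued holomorphic functions\<close>

lemma cdual_le: "cdual l \<Longrightarrow> cmod (l x) \<le> norm x"
  by (simp add: cdual_def)

text \<open>Montel's theorem extracts a subsequence with a holomorphic limit, and this limit must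
  coincide with \<open>g\<close>. Pointwise convergence therefore suffices throughout, as long as a
  uniform bound is at hand.\<close>

lemma holomorphic_pointwise_limit:
  fixes f :: "nat \<Rightarrow> complex \<Rightarrow> complex"
  assumes S: "open S" and hol: "\<And>n. f n holomorphic_on S"
    and bd: "\<And>n x. x \<in> S \<Longrightarrow> cmod (f n x) \<le> C"
    and lim: "\<And>x. x \<in> S \<Longrightarrow> (\<lambda>n. f n x) \<longlonglongrightarrow> g x"
  shows "g holomorphic_on S"
proof -
  obtain g' r where g': "g' holomorphic_on S" "strict_mono (r :: nat \<Rightarrow> nat)"
    "\<And>x. x \<in> S \<Longrightarrow> (\<lambda>n. f (r n) x) \<longlonglongrightarrow> g' x"
  proof (rule Montel[OF S, of "range f" f])
    show "\<exists>B. \<forall>h\<in>range f. \<forall>z\<in>K. norm (h z) \<le> B" if "K \<subseteq> S" for K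
      using bd that by blast
  qed (use hol in auto)
  have "g x = g' x" if "x \<in> S" for x
    using LIMSEQ_unique[OF LIMSEQ_subseq_LIMSEQ[OF lim[OF that] g'(2)]] g'(3)[OF that]
    by (simp add: o_def)
  then show ?thesis using g'(1) holomorphic_transform by fastforce
qed

text \<open>The constant depends on \<open>v\<close> only through the bound \<open>C\<close>, so it
  is the same for all functionals applied to one vector-valued function. The slope extends
  holomorphically across \<open>w\<close>, and its derivative is controlled by maximum modulus
  followed by Cauchy's inequality.\<close>

lemma slope_lipschitz:
  fixes v :: "complex \<Rightarrow> complex"
  assumes R: "0 < R" and hol: "v holomorphic_on ball w (3*R)"
    and bd: "\<And>x. x \<in> ball w (3*R) \<Longrightarrow> cmod (v x) \<le> C"
    and h: "cmod h < R" "h \<noteq> 0" "cmod k < R" "k \<noteq> 0"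
  shows "cmod ((v (w+h) - v w) / h - (v (w+k) - v w) / k) \<le> C / R\<^sup>2 * cmod (h - k)"
proof -
  define q where "q z = (if z = w then deriv v w else (v z - v w) / (z - w))" for z
  have q: "q holomorphic_on ball w (3*R)" unfolding q_def by (rule pole_lemma_open[OF hol]) simp
  then have cq: "continuous_on (ball w (3*R)) q" by (rule holomorphic_on_imp_continuous_on)
  have sub: "cball w (2*R) \<subseteq> ball w (3*R)" using R by auto
  \<comment> \<open>On the circle of radius \<open>2*R\<close> the numerator is at most
    \<open>C + C\<close>. Discs of radius \<open>R\<close> about points of \<open>ball w R\<close>
    stay inside this circle, which leaves room for Cauchy's inequality.\<close>
  have qle: "cmod (q z) \<le> C / R" if "z \<in> cball w (2*R)" for z
  proof (rule maximum_modulus_frontier[of q "cball w (2*R)"])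
    show "q holomorphic_on interior (cball w (2*R))"
      by (rule holomorphic_on_subset[OF q]) (use R in auto)
    show "continuous_on (closure (cball w (2*R))) q" using cq sub by (simp add: continuous_on_subset)
    fix z assume "z \<in> frontier (cball w (2*R))"
    then have z: "cmod (z - w) = 2*R" by (simp add: dist_norm norm_minus_commute)
    then have "cmod (v z - v w) \<le> C + C"
      using bd[of z] bd[of w] R norm_triangle_ineq4[of "v z" "v w"] by (auto simp: dist_norm norm_minus_commute)
    then have "cmod (v z - v w) / (2*R) \<le> (C + C) / (2*R)" using R by (intro divide_right_mono) auto
    then show "cmod (q z) \<le> C / R" using z R by (auto simp: q_def norm_divide)
  qed (use that in auto)
  have "cmod (deriv q z) \<le> C / R\<^sup>2" if z: "z \<in> ball w R" for z
  proof -
    have s: "cball z R \<subseteq> cball w (2*R)"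
    proof
      fix y assume "y \<in> cball z R"
      then show "y \<in> cball w (2*R)" using z dist_triangle[of w y z] by auto
    qed
    have "cmod ((deriv ^^ 1) q z) \<le> fact 1 * (C / R) / R ^ 1"
    proof (rule Cauchy_inequality[OF _ _ R])
      have s': "cball z R \<subseteq> ball w (3*R)" using s sub by blast
      show "continuous_on (cball z R) q" using cq s' continuous_on_subset by blast
      show "q holomorphic_on ball z R"
        by (rule holomorphic_on_subset[OF q]) (use s' ball_subset_cball in blast)
      show "cmod (q x) \<le> C / R" if "cmod (z - x) = R" for x
        using that s by (intro qle) (auto simp: dist_norm)
    qed
    then show ?thesis by (simp add: power2_eq_square)
  qed
  note dq = this
  have "cmod (q (w + h) - q (w + k)) \<le> C / R\<^sup>2 * cmod ((w + h) - (w + k))"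
  proof (rule field_differentiable_bound[of "ball w R" q "deriv q"])
    show "(q has_field_derivative deriv q z) (at z within ball w R)" if "z \<in> ball w R" for z
      by (rule has_field_derivative_at_within[OF holomorphic_derivI[OF q]]) (use that R in auto)
  qed (use h dq in \<open>auto simp: dist_norm\<close>)
  then show ?thesis using h by (simp add: q_def)
qed

text \<open>Weak holomorphy implies holomorphy in norm: by \<open>slope_lipschitz\<close>, uniformly
  in the functional, the difference quotients are Lipschitz in norm, and completeness provides the
  derivative \<open>D\<close>. The bound on \<open>u\<close> stands in for the uniform boundedness
  principle.\<close>

lemma vholo_onI_weak_bounded:
  fixes u :: "complex \<Rightarrow> 'x::{complex_normed_vector,banach}"
  assumes U: "open U" and bd: "\<And>x. x \<in> U \<Longrightarrow> norm (u x) \<le> C"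
    and hol: "\<And>l. cdual l \<Longrightarrow> (\<lambda>x. l (u x)) holomorphic_on U"
  shows "vholo_on u U"
  unfolding vholo_on_def
proof
  fix w assume w: "w \<in> U"
  then obtain e where e: "e > 0" "ball w e \<subseteq> U" using U openE by blast
  define R where "R = e / 3"
  have R: "0 < R" "ball w (3*R) \<subseteq> U" using e by (auto simp: R_def)
  define L where "L = C / R\<^sup>2"
  have C: "0 \<le> C" using bd[OF w] norm_ge_zero order_trans by blast
  have L: "0 \<le> L" using C by (simp add: L_def)
  define Q where "Q h = scaleC (1 / h) (u (w + h) - u w)" for h
  have lip: "norm (Q h - Q k) \<le> L * cmod (h - k)"
    if "cmod h < R" "h \<noteq> 0" "cmod k < R" "k \<noteq> 0" for h k
  proof (rule cdual_norm_le)
    fix l :: "'x \<Rightarrow> complex" assume l: "cdual l"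
    note ld = cdual_diff[OF l]
    have ls: "l (scaleC c x) = c * l x" for c x using l by (simp add: cdual_def)
    have "cmod ((l (u (w+h)) - l (u w)) / h - (l (u (w+k)) - l (u w)) / k) \<le> C / R\<^sup>2 * cmod (h - k)"
    proof (rule slope_lipschitz[OF R(1) _ _ that])
      show "(\<lambda>x. l (u x)) holomorphic_on ball w (3*R)" using hol[OF l] R by (blast intro: holomorphic_on_subset)
      show "cmod (l (u x)) \<le> C" if "x \<in> ball w (3*R)" for x
        using order_trans[OF cdual_le[OF l] bd] R that by blast
    qed
    then show "cmod (l (Q h - Q k)) \<le> L * cmod (h - k)"
      by (simp add: Q_def ld ls L_def diff_divide_distrib)
  qed
  \<comment> \<open>The shift by 2 makes the modulus strictly smaller than \<open>R\<close> already
    at \<open>n = 0\<close>; a shift by 1 would give exactly \<open>R\<close> there.\<close>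
  define s where "s n = complex_of_real (R / (real n + 2))" for n
  have s: "cmod (s n) < R" "s n \<noteq> 0" for n
    using R unfolding s_def norm_of_real of_real_eq_0_iff
    by (auto simp: field_simps intro: add_pos_nonneg)
  have s0: "s \<longlonglongrightarrow> 0"
  proof -
    have "(\<lambda>n. R / (real n + 2)) \<longlonglongrightarrow> 0" by real_asymp
    then show ?thesis unfolding s_def using tendsto_of_real[of _ 0] by (simp only: of_real_0)
  qed
  have "Cauchy (\<lambda>n. Q (s n))"
  proof (rule metric_CauchyI)
    fix d :: real assume d: "0 < d"
    have "Cauchy s" using s0 LIMSEQ_imp_Cauchy by blast
    \<comment> \<open>\<open>L + 1\<close> instead of \<open>L\<close>, because \<open>L\<close> may
      be 0.\<close>
    moreover have "0 < d / (L + 1)" using d L by simp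
    ultimately obtain M where M: "\<And>m n. m \<ge> M \<Longrightarrow> n \<ge> M \<Longrightarrow> dist (s m) (s n) < d / (L + 1)"
      unfolding Cauchy_def by blast
    have "dist (Q (s m)) (Q (s n)) < d" if "m \<ge> M" "n \<ge> M" for m n
    proof -
      have "dist (Q (s m)) (Q (s n)) \<le> L * dist (s m) (s n)" using lip s by (simp add: dist_norm)
      also have "\<dots> \<le> L * (d / (L + 1))" using M[OF that] L by (intro mult_left_mono) auto
      also have "\<dots> < d" using L d by (simp add: field_simps)
      finally show ?thesis .
    qed
    then show "\<exists>M. \<forall>m\<ge>M. \<forall>n\<ge>M. dist (Q (s m)) (Q (s n)) < d" by blast
  qed
  then obtain D where D: "(\<lambda>n. Q (s n)) \<longlonglongrightarrow> D" using Cauchy_convergent convergent_def by blast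
  have QD: "norm (Q h - D) \<le> L * cmod h" if h: "cmod h < R" "h \<noteq> 0" for h
  proof (rule LIMSEQ_le)
    show "(\<lambda>n. norm (Q h - Q (s n))) \<longlonglongrightarrow> norm (Q h - D)" by (intro tendsto_intros D)
    show "(\<lambda>n. L * cmod (h - s n)) \<longlonglongrightarrow> L * cmod h"
      using tendsto_mult[OF tendsto_const tendsto_norm[OF tendsto_diff[OF tendsto_const s0]], of L h] by simp
  qed (use lip[OF h s] in auto)
  have bl: "bounded_linear (\<lambda>h. scaleC h D)"
    by (rule bounded_bilinear.bounded_linear_left[OF bounded_bilinear_scaleC])
  have "(u has_derivative (\<lambda>h. scaleC h D)) (at w)"
    unfolding has_derivative_at
  proof (intro conjI bl)
    have *: "norm (norm (u (w + h) - u w - scaleC h D) / norm h) \<le> L * cmod h" if h: "cmod h < R" "h \<noteq> 0" for h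
    proof -
      have "scaleC h (Q h) = u (w + h) - u w" using h by (simp add: Q_def scaleC_scaleC scaleC_one)
      then have "u (w + h) - u w - scaleC h D = scaleC h (Q h - D)"
        by (simp add: bounded_bilinear.diff_right[OF bounded_bilinear_scaleC])
      then show ?thesis using QD[OF h] h by (simp add: norm_scaleC)
    qed
    show "(\<lambda>h. norm (u (w + h) - u w - scaleC h D) / norm h) \<midarrow>0\<rightarrow> 0"
    proof (rule Lim_null_comparison)
      show "\<forall>\<^sub>F h in at 0. norm (norm (u (w + h) - u w - scaleC h D) / norm h) \<le> L * cmod h"
        unfolding eventually_at using * R(1) by (auto simp: dist_norm)
      show "((\<lambda>h. L * cmod h) \<longlongrightarrow> 0) (at 0)" by (intro tendsto_eq_intros) auto
    qed
  qed
  then show "\<exists>D. (u has_derivative (\<lambda>h. scaleC h D)) (at w)" by blast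
qed

lemma vholo_on_cdual:
  assumes "vholo_on u U" "cdual l"
  shows "(\<lambda>x. l (u x)) holomorphic_on U"
  unfolding holomorphic_on_def field_differentiable_def
proof
  fix w assume "w \<in> U"
  then obtain D where D: "(u has_derivative (\<lambda>h. scaleC h D)) (at w)"
    using assms(1) by (auto simp: vholo_on_def)
  have "((\<lambda>x. l (u x)) has_derivative (\<lambda>h. l (scaleC h D))) (at w)"
    by (rule bounded_linear.has_derivative[OF cdual_bounded_linear[OF assms(2)] D])
  moreover have "(\<lambda>h. l (scaleC h D)) = (*) (l D)"
    using assms(2) by (auto simp: cdual_def mult.commute)
  ultimately show "\<exists>f'. ((\<lambda>x. l (u x)) has_field_derivative f') (at w within U)"
    unfolding has_field_derivative_def by (auto intro!: exI[of _ "l D"] has_derivative_at_withinI)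
qed

text \<open>Under each functional this is \<open>holomorphic_pointwise_limit\<close>, and the bound
  survives the limit. It yields holomorphy of integrals, of series and of limits of
  iterations.\<close>

lemma vholo_on_pointwise_limit:
  fixes f :: "nat \<Rightarrow> complex \<Rightarrow> 'x::{complex_normed_vector,banach}"
  assumes S: "open S" and hol: "\<And>n. vholo_on (f n) S"
    and bd: "\<And>n x. x \<in> S \<Longrightarrow> norm (f n x) \<le> C"
    and lim: "\<And>x. x \<in> S \<Longrightarrow> (\<lambda>n. f n x) \<longlonglongrightarrow> g x"
  shows "vholo_on g S"
proof (rule vholo_onI_weak_bounded[OF S])
  show "norm (g x) \<le> C" if "x \<in> S" for x
    by (rule LIMSEQ_le_const2[OF tendsto_norm[OF lim[OF that]]]) (use bd that in auto)
  fix l :: "'x \<Rightarrow> complex" assume l: "cdual l"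
  show "(\<lambda>x. l (g x)) holomorphic_on S"
  proof (rule holomorphic_pointwise_limit[OF S])
    show "(\<lambda>x. l (f n x)) holomorphic_on S" for n by (rule vholo_on_cdual[OF hol l])
    show "cmod (l (f n x)) \<le> C" if "x \<in> S" for n x
      by (rule order_trans[OF cdual_le[OF l] bd[OF that]])
    show "(\<lambda>n. l (f n x)) \<longlonglongrightarrow> l (g x)" if "x \<in> S" for x
      using bounded_linear.tendsto[OF cdual_bounded_linear[OF l] lim[OF that]] .
  qed
qed

lemma vholo_on_subset: "vholo_on u U \<Longrightarrow> V \<subseteq> U \<Longrightarrow> vholo_on u V"
  by (auto simp: vholo_on_def)

lemma vholo_on_continuous: "vholo_on u U \<Longrightarrow> continuous_on U u"
  unfolding vholo_on_def by (auto intro!: continuous_at_imp_continuous_on dest!: bspec has_derivative_continuous)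

lemma vholo_on_add: "vholo_on u U \<Longrightarrow> vholo_on v U \<Longrightarrow> vholo_on (\<lambda>x. u x + v x) U"
  unfolding vholo_on_def
proof
  fix w assume "\<forall>w\<in>U. \<exists>D. (u has_derivative (\<lambda>h. scaleC h D)) (at w)"
    "\<forall>w\<in>U. \<exists>D. (v has_derivative (\<lambda>h. scaleC h D)) (at w)" "w \<in> U"
  then obtain D E where "(u has_derivative (\<lambda>h. scaleC h D)) (at w)" "(v has_derivative (\<lambda>h. scaleC h E)) (at w)"
    by blast
  from has_derivative_add[OF this]
  show "\<exists>D. ((\<lambda>x. u x + v x) has_derivative (\<lambda>h. scaleC h D)) (at w)"
    by (auto simp flip: scaleC_add_right)
qed

lemma vholo_on_scaleC:
  assumes U: "open U" and c: "c holomorphic_on U" and u: "vholo_on u U"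
  shows "vholo_on (\<lambda>x. scaleC (c x) (u x)) U"
  unfolding vholo_on_def
proof
  fix w assume w: "w \<in> U"
  then obtain D where D: "(u has_derivative (\<lambda>h. scaleC h D)) (at w)" using u by (auto simp: vholo_on_def)
  have c': "(c has_derivative (*) (deriv c w)) (at w)"
    using holomorphic_derivI[OF c U w] by (simp add: has_field_derivative_def)
  show "\<exists>D. ((\<lambda>x. scaleC (c x) (u x)) has_derivative (\<lambda>h. scaleC h D)) (at w)"
    using bounded_bilinear.FDERIV[OF bounded_bilinear_scaleC c' D]
    by (intro exI[of _ "scaleC (c w) D + scaleC (deriv c w) (u w)"])
       (simp add: scaleC_scaleC scaleC_add_right mult.commute)
qed

lemma vholo_on_const: "vholo_on (\<lambda>x. c) U"
  unfolding vholo_on_def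
proof
  fix w :: complex
  have "scaleC h (0::'a) = 0" for h using norm_scaleC[of h "0::'a"] by simp
  then show "\<exists>D. ((\<lambda>x. c) has_derivative (\<lambda>h. scaleC h D)) (at w)"
    by (intro exI[of _ 0]) simp
qed

lemma vholo_on_sum:
  assumes "\<And>i. i \<in> I \<Longrightarrow> vholo_on (u i) U"
  shows "vholo_on (\<lambda>x. \<Sum>i\<in>I. u i x) U"
  using assms by (induction I rule: infinite_finite_induct) (auto intro: vholo_on_const vholo_on_add)

lemma vholo_on_compose:
  assumes U: "open U" and h: "h holomorphic_on U" and V: "h ` U \<subseteq> V" and u: "vholo_on u V"
  shows "vholo_on (\<lambda>x. u (h x)) U"
  unfolding vholo_on_def
proof
  fix w assume w: "w \<in> U"
  then obtain D where D: "(u has_derivative (\<lambda>h. scaleC h D)) (at (h w))"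
    using u V by (auto simp: vholo_on_def)
  have h': "(h has_derivative (*) (deriv h w)) (at w)"
    using holomorphic_derivI[OF h U w] by (simp add: has_field_derivative_def)
  show "\<exists>D. ((\<lambda>x. u (h x)) has_derivative (\<lambda>h. scaleC h D)) (at w)"
    using diff_chain_at[OF h' D]
    by (intro exI[of _ "scaleC (deriv h w) D"]) (simp add: o_def scaleC_scaleC mult.commute)
qed

lemma vholo_on_local:
  assumes "\<And>x. x \<in> U \<Longrightarrow> \<exists>V. x \<in> V \<and> vholo_on u V"
  shows "vholo_on u U"
  using assms unfolding vholo_on_def by blast

lemma vholo_on_transform:
  assumes U: "open U" and u: "vholo_on u U" and eq: "\<And>x. x \<in> U \<Longrightarrow> v x = u x"
  shows "vholo_on v U"
  unfolding vholo_on_def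
proof
  fix w assume w: "w \<in> U"
  then obtain D where "(u has_derivative (\<lambda>h. scaleC h D)) (at w)" using u by (auto simp: vholo_on_def)
  then have "(v has_derivative (\<lambda>h. scaleC h D)) (at w)"
    by (rule has_derivative_transform_within_open[OF _ U w]) (simp add: eq)
  then show "\<exists>D. (v has_derivative (\<lambda>h. scaleC h D)) (at w)" by blast
qed

section \<open>Vector-valued integrals as limits of Riemann sums, and Cauchy integrals over
  circles\<close>

lemma integral_riemann_sum_error:
  fixes f :: "real \<Rightarrow> 'x::banach"
  assumes f: "continuous_on {0..1} f" and N: "0 < N"
    and osc: "\<And>s t. s \<in> {0..1} \<Longrightarrow> t \<in> {0..1} \<Longrightarrow> \<bar>s - t\<bar> \<le> 1 / real N \<Longrightarrow> norm (f s - f t) \<le> e"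
    and m: "m \<le> N"
  shows "norm (integral {0..real m / real N} f - (\<Sum>k<m. (1 / real N) *\<^sub>R f (real k / real N))) \<le> e * (real m / real N)"
  using m
proof (induction m)
  case (Suc m)
  define a b where "a = real m / real N" and "b = real (Suc m) / real N"
  have ab: "0 \<le> a" "a \<le> b" "b \<le> 1" "b - a = 1 / real N"
    using Suc.prems N by (simp_all add: a_def b_def divide_simps)
  have int: "f integrable_on {c..d}" if "0 \<le> c" "d \<le> 1" for c d
    using that by (intro integrable_continuous_real continuous_on_subset[OF f]) auto
  have e: "norm (integral {a..b} f - (1 / real N) *\<^sub>R f a) \<le> e * (1 / real N)"
  proof -
    have "integral {a..b} f - (1 / real N) *\<^sub>R f a = integral {a..b} (\<lambda>t. f t - f a)"
      using ab int[of a b] by (subst integral_diff) auto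
    also have "norm \<dots> \<le> e * (b - a)"
      using ab osc by (intro integral_bound continuous_intros continuous_on_subset[OF f]) auto
    finally show ?thesis using ab by simp
  qed
  have "integral {0..b} f = integral {0..a} f + integral {a..b} f"
    using ab int[of 0 b] by (subst Henstock_Kurzweil_Integration.integral_combine) auto
  then have "integral {0..b} f - (\<Sum>k<Suc m. (1 / real N) *\<^sub>R f (real k / real N)) =
      (integral {0..a} f - (\<Sum>k<m. (1 / real N) *\<^sub>R f (real k / real N))) + (integral {a..b} f - (1 / real N) *\<^sub>R f a)"
    by (simp add: a_def)
  also have "norm \<dots> \<le> e * a + e * (1 / real N)"
    using Suc e by (intro norm_triangle_mono) (auto simp: a_def)
  also have "\<dots> = e * b" by (simp add: a_def b_def add_divide_distrib ring_distribs)
  finally show ?case by (simp add: b_def)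
qed simp

abbreviation riemann_sum :: "nat \<Rightarrow> (real \<Rightarrow> 'x::real_vector) \<Rightarrow> 'x" where
  "riemann_sum N f \<equiv> \<Sum>k<Suc N. (1 / real (Suc N)) *\<^sub>R f (real k / real (Suc N))"

lemma riemann_sums_tendsto_integral:
  fixes f :: "real \<Rightarrow> 'x::banach"
  assumes f: "continuous_on {0..1} f"
  shows "(\<lambda>N. \<Sum>k<Suc N. (1 / real (Suc N)) *\<^sub>R f (real k / real (Suc N))) \<longlonglongrightarrow> integral {0..1} f"
proof (rule metric_LIMSEQ_I)
  fix e :: real assume e: "0 < e"
  have "uniformly_continuous_on {0..1} f" using f by (intro compact_uniformly_continuous) auto
  then obtain d where d: "d > 0"
    "\<And>s t. s \<in> {0..1} \<Longrightarrow> t \<in> {0..1} \<Longrightarrow> \<bar>s - t\<bar> < d \<Longrightarrow> norm (f s - f t) < e / 2"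
    using e unfolding uniformly_continuous_on_def dist_norm real_norm_def by (metis half_gt_zero abs_minus_commute norm_minus_commute)
  obtain N0 :: nat where N0: "1 / d < real N0" using reals_Archimedean2 by blast
  have "dist (\<Sum>k<Suc N. (1 / real (Suc N)) *\<^sub>R f (real k / real (Suc N))) (integral {0..1} f) < e" if N: "N \<ge> N0" for N
  proof -
    have "1 / d < real (Suc N)" using N0 N by simp
    then have s: "1 / real (Suc N) < d" using d(1) by (simp add: field_simps)
    have "norm (integral {0..real (Suc N) / real (Suc N)} f - (\<Sum>k<Suc N. (1 / real (Suc N)) *\<^sub>R f (real k / real (Suc N))))
      \<le> e / 2 * (real (Suc N) / real (Suc N))"
      using d(2) s by (intro integral_riemann_sum_error[OF f]) (auto intro: less_imp_le order_le_less_trans)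
    then show ?thesis using e by (simp add: dist_norm norm_minus_commute)
  qed
  then show "\<exists>N0. \<forall>N\<ge>N0. dist (\<Sum>k<Suc N. (1 / real (Suc N)) *\<^sub>R f (real k / real (Suc N))) (integral {0..1} f) < e"
    by blast
qed

text \<open>Riemann sums are finite combinations with total weight 1, hence holomorphic and still
  bounded by \<open>C\<close>; they converge pointwise. This replaces differentiation under the
  integral sign.\<close>

lemma vholo_on_integral:
  fixes G :: "complex \<Rightarrow> real \<Rightarrow> 'x::{complex_normed_vector,banach}"
  assumes U: "open U" and hol: "\<And>t. t \<in> {0..1} \<Longrightarrow> vholo_on (\<lambda>z. G z t) U"
    and cont: "\<And>z. z \<in> U \<Longrightarrow> continuous_on {0..1} (G z)"
    and bd: "\<And>z t. z \<in> U \<Longrightarrow> t \<in> {0..1} \<Longrightarrow> norm (G z t) \<le> C"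
  shows "vholo_on (\<lambda>z. integral {0..1} (G z)) U"
proof (rule vholo_on_pointwise_limit[OF U])
  have k: "real k / real (Suc N) \<in> {0..1}" if "k \<in> {..<Suc N}" for k N using that by (auto simp: field_simps)
  show "(\<lambda>N. \<Sum>k<Suc N. (1 / real (Suc N)) *\<^sub>R G z (real k / real (Suc N))) \<longlonglongrightarrow> integral {0..1} (G z)" if "z \<in> U" for z
    by (rule riemann_sums_tendsto_integral[OF cont[OF that]])
  show "vholo_on (\<lambda>z. \<Sum>k<Suc N. (1 / real (Suc N)) *\<^sub>R G z (real k / real (Suc N))) U" for N
    unfolding scaleC_real by (rule vholo_on_sum, rule vholo_on_scaleC[OF U]) (use hol k in auto)
  show "norm (\<Sum>k<Suc N. (1 / real (Suc N)) *\<^sub>R G z (real k / real (Suc N))) \<le> C" if z: "z \<in> U" for N z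
  proof -
    have "norm (\<Sum>k<Suc N. (1 / real (Suc N)) *\<^sub>R G z (real k / real (Suc N))) \<le> (\<Sum>k<Suc N. (1 / real (Suc N)) * C)"
      by (rule sum_norm_le) (use bd[OF z k] in \<open>auto simp: divide_right_mono\<close>)
    then show ?thesis by simp
  qed
qed

text \<open>With s = \<open>circlepath 0 \<rho> t\<close> one has ds = 2 pi i s dt, so the Cauchy
  integral with its factor 1/(2 pi i) becomes the integral of s/(s - w) u(s) over the unit
  interval.\<close>

abbreviation Cauchy_kernel :: "real \<Rightarrow> (complex \<Rightarrow> 'x::complex_normed_vector) \<Rightarrow> complex \<Rightarrow> real \<Rightarrow> 'x" where
  "Cauchy_kernel \<rho> u w t \<equiv> scaleC (circlepath 0 \<rho> t / (circlepath 0 \<rho> t - w)) (u (circlepath 0 \<rho> t))"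

definition Cint :: "real \<Rightarrow> (complex \<Rightarrow> 'x::complex_normed_vector) \<Rightarrow> complex \<Rightarrow> 'x" where
  "Cint \<rho> u w = integral {0..1} (\<lambda>t. Cauchy_kernel \<rho> u w t)"

lemma norm_circlepath: "0 \<le> \<rho> \<Longrightarrow> cmod (circlepath 0 \<rho> t) = \<rho>"
  by (simp add: circlepath norm_mult)

lemma circlepath_sphere: "0 \<le> \<rho> \<Longrightarrow> circlepath 0 \<rho> t \<in> sphere 0 \<rho>"
  by (simp add: norm_circlepath)

lemma deriv_circlepath: "vector_derivative (circlepath 0 \<rho>) (at t) = 2 * pi * \<i> * circlepath 0 \<rho> t"
  unfolding vector_derivative_circlepath by (simp add: circlepath)

lemma continuous_circlepath: "continuous_on S (circlepath z r)"
  unfolding circlepath by (intro continuous_intros)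

lemma continuous_Cint_integrand:
  assumes "0 \<le> \<rho>" "cmod w \<noteq> \<rho>" "continuous_on (sphere 0 \<rho>) u"
  shows "continuous_on {0..1} (\<lambda>t. Cauchy_kernel \<rho> u w t)"
proof (rule bounded_bilinear.continuous_on[OF bounded_bilinear_scaleC])
  show "continuous_on {0..1} (\<lambda>t. circlepath 0 \<rho> t / (circlepath 0 \<rho> t - w))"
    using assms norm_circlepath[of \<rho>] by (intro continuous_intros continuous_circlepath) auto
  show "continuous_on {0..1} (\<lambda>t. u (circlepath 0 \<rho> t))"
    by (rule continuous_on_compose2[OF assms(3) continuous_circlepath]) (use circlepath_sphere[OF assms(1)] in auto)
qed

lemma norm_Cint_integrand_le:
  assumes "0 \<le> \<rho>" "0 < d" "d \<le> \<bar>\<rho> - cmod w\<bar>" "norm (u (circlepath 0 \<rho> t)) \<le> C"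
  shows "norm (Cauchy_kernel \<rho> u w t) \<le> \<rho> * C / d"
proof -
  have "d \<le> cmod (circlepath 0 \<rho> t - w)"
    using norm_triangle_ineq3[of "circlepath 0 \<rho> t" w] assms norm_circlepath[of \<rho> t] by linarith
  then have "\<rho> / cmod (circlepath 0 \<rho> t - w) \<le> \<rho> / d" using assms by (intro divide_left_mono mult_pos_pos) linarith+
  then have "\<rho> / cmod (circlepath 0 \<rho> t - w) * norm (u (circlepath 0 \<rho> t)) \<le> \<rho> / d * C"
    using assms by (intro mult_mono) auto
  then show ?thesis using assms by (simp add: norm_scaleC norm_divide norm_circlepath)
qed

lemma norm_Cint_le:
  fixes u :: "complex \<Rightarrow> 'x::{complex_normed_vector,banach}"
  assumes "0 \<le> \<rho>" "cmod w \<noteq> \<rho>" "continuous_on (sphere 0 \<rho>) u"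
    and "\<And>x. cmod x = \<rho> \<Longrightarrow> norm (u x) \<le> C"
  shows "norm (Cint \<rho> u w) \<le> \<rho> * C / \<bar>\<rho> - cmod w\<bar>"
proof -
  have "norm (Cint \<rho> u w) \<le> \<rho> * C / \<bar>\<rho> - cmod w\<bar> * (1 - 0)"
    unfolding Cint_def
    by (rule integral_bound[OF _ continuous_Cint_integrand])
       (use assms norm_circlepath in \<open>auto intro!: norm_Cint_integrand_le\<close>)
  then show ?thesis by simp
qed

lemma vholo_on_Cint:
  fixes F :: "complex \<Rightarrow> complex \<Rightarrow> 'x::{complex_normed_vector,banach}"
  assumes V: "open V" and \<rho>: "0 \<le> \<rho>" and b: "b holomorphic_on V"
    and d: "0 < d" "\<And>z. z \<in> V \<Longrightarrow> d \<le> \<bar>\<rho> - cmod (b z)\<bar>"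
    and hol: "\<And>s. cmod s = \<rho> \<Longrightarrow> vholo_on (\<lambda>z. F z s) V"
    and cont: "\<And>z. z \<in> V \<Longrightarrow> continuous_on (sphere 0 \<rho>) (F z)"
    and bd: "\<And>z s. z \<in> V \<Longrightarrow> cmod s = \<rho> \<Longrightarrow> norm (F z s) \<le> C"
  shows "vholo_on (\<lambda>z. Cint \<rho> (F z) (b z)) V"
  unfolding Cint_def
proof (rule vholo_on_integral[OF V])
  note n = norm_circlepath[OF \<rho>]
  have ne: "cmod (b z) \<noteq> \<rho>" if "z \<in> V" for z using d(1) d(2)[OF that] by auto
  show "vholo_on (\<lambda>z. Cauchy_kernel \<rho> (F z) (b z) t) V" for t
    by (rule vholo_on_scaleC[OF V _ hol[OF n]])
       (use ne n[of t] in \<open>force intro!: holomorphic_intros b\<close>)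
  show "continuous_on {0..1} (\<lambda>t. Cauchy_kernel \<rho> (F z) (b z) t)"
    if "z \<in> V" for z
    by (rule continuous_Cint_integrand[OF \<rho> ne[OF that] cont[OF that]])
  show "norm (Cauchy_kernel \<rho> (F z) (b z) t) \<le> \<rho> * C / d"
    if "z \<in> V" for z t
    by (rule norm_Cint_integrand_le[OF \<rho> d(1) d(2)[OF that]]) (rule bd[OF that n])
qed

text \<open>Bridge to scalar contour integrals, where Cauchy's theorem and formula are
  available.\<close>

lemma cdual_Cint:
  fixes u :: "complex \<Rightarrow> 'x::{complex_normed_vector,banach}"
  assumes l: "cdual l" and w: "0 \<le> \<rho>" "cmod w \<noteq> \<rho>" and u: "continuous_on (sphere 0 \<rho>) u"
  shows "l (Cint \<rho> u w) = contour_integral (circlepath 0 \<rho>) (\<lambda>s. l (u s) / (s - w)) / (2 * pi * \<i>)"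
proof -
  let ?c = "circlepath 0 \<rho>"
  have "l (Cint \<rho> u w) = integral {0..1} (l \<circ> (\<lambda>t. scaleC (?c t / (?c t - w)) (u (?c t))))"
    unfolding Cint_def
    by (rule integral_linear[symmetric, OF integrable_continuous_real[OF continuous_Cint_integrand[OF w u]] cdual_bounded_linear[OF l]])
  also have "\<dots> = integral {0..1} (\<lambda>t. (l (u (?c t)) / (?c t - w) * vector_derivative ?c (at t)) / (2 * pi * \<i>))"
    using l by (intro integral_cong) (simp add: cdual_def deriv_circlepath)
  also have "\<dots> = contour_integral ?c (\<lambda>s. l (u s) / (s - w)) / (2 * pi * \<i>)"
    by (simp only: integral_divide contour_integral_integral)
  finally show ?thesis .
qed

text \<open>Both circles run with the same argument, so the linear homotopy at time \<open>u\<close>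
  has modulus \<open>(1 - u) * \<rho> + u * \<sigma>\<close> and never leaves the ring.\<close>

lemma contour_integral_circlepath_annulus:
  assumes k: "k holomorphic_on {x. \<alpha> < cmod x \<and> cmod x < \<beta>}"
    and ab: "0 \<le> \<alpha>" "\<alpha> < \<rho>" "\<rho> < \<beta>" "\<alpha> < \<sigma>" "\<sigma> < \<beta>"
  shows "contour_integral (circlepath 0 \<rho>) k = contour_integral (circlepath 0 \<sigma>) k"
proof (rule Cauchy_theorem_homotopic_loops[OF _ _ k])
  show "open {x::complex. \<alpha> < cmod x \<and> cmod x < \<beta>}"
    by (intro open_Collect_conj open_Collect_less continuous_intros)
  show "homotopic_loops {x. \<alpha> < cmod x \<and> cmod x < \<beta>} (circlepath 0 \<rho>) (circlepath 0 \<sigma>)"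
  proof (rule homotopic_loops_linear)
    fix t :: real
    show "closed_segment (circlepath 0 \<rho> t) (circlepath 0 \<sigma> t) \<subseteq> {x. \<alpha> < cmod x \<and> cmod x < \<beta>}"
    proof
      fix x assume "x \<in> closed_segment (circlepath 0 \<rho> t) (circlepath 0 \<sigma> t)"
      then obtain u where u: "0 \<le> u" "u \<le> 1" "x = (1 - u) *\<^sub>R circlepath 0 \<rho> t + u *\<^sub>R circlepath 0 \<sigma> t"
        by (auto simp: in_segment)
      define m where "m = (1 - u) * \<rho> + u * \<sigma>"
      have "x = of_real m * exp (2 * of_real pi * \<i> * of_real t)"
        using u by (simp add: m_def circlepath scaleR_conv_of_real algebra_simps)
      moreover have "0 \<le> m" using u ab by (simp add: m_def)
      ultimately have x: "cmod x = (1 - u) * \<rho> + u * \<sigma>" by (simp add: norm_mult flip: m_def)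
      have 1: "\<alpha> < min \<rho> \<sigma>" "max \<rho> \<sigma> < \<beta>" using ab by auto
      have "(1 - u) * min \<rho> \<sigma> + u * min \<rho> \<sigma> \<le> (1 - u) * \<rho> + u * \<sigma>"
        using u by (intro add_mono mult_left_mono) auto
      moreover have "(1 - u) * \<rho> + u * \<sigma> \<le> (1 - u) * max \<rho> \<sigma> + u * max \<rho> \<sigma>"
        using u by (intro add_mono mult_left_mono) auto
      moreover have "(1 - u) * y + u * y = y" for y :: real by (simp add: algebra_simps)
      ultimately have "min \<rho> \<sigma> \<le> cmod x" "cmod x \<le> max \<rho> \<sigma>" unfolding x by metis+
      then show "x \<in> {x. \<alpha> < cmod x \<and> cmod x < \<beta>}" using 1 by (simp add: min_def max_def split: if_splits)
    qed
  qed auto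
qed auto

section \<open>Laurent splitting on an annulus\<close>

text \<open>The ratio 2 of the radii is that of \<open>r / (3 * M)\<close> to
  \<open>r / (6 * M)\<close>; the splitting constants 2 and 3 belong to this ratio.\<close>

definition annulus :: "real \<Rightarrow> complex set" where
  "annulus R = {x. R < cmod x \<and> cmod x < 2 * R}"

lemma open_annulus: "open (annulus R)"
  unfolding annulus_def by (intro open_Collect_conj open_Collect_less continuous_intros)

lemma sphere_subset_annulus: "R < \<rho> \<Longrightarrow> \<rho> < 2 * R \<Longrightarrow> sphere 0 \<rho> \<subseteq> annulus R"
  by (auto simp: annulus_def)

lemma continuous_on_sphere:
  "vholo_on u (annulus R) \<Longrightarrow> R < t \<Longrightarrow> t < 2 * R \<Longrightarrow> continuous_on (sphere 0 t) u"
  by (rule continuous_on_subset[OF vholo_on_continuous sphere_subset_annulus])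

text \<open>The last assumption keeps the pole \<open>w\<close> out of the ring swept when one
  circle is deformed into the other.\<close>

lemma Cint_radius:
  fixes u :: "complex \<Rightarrow> 'x::{complex_normed_vector,banach}"
  assumes u: "vholo_on u (annulus R)" and \<alpha>: "0 < R" "R \<le> \<alpha>" and \<beta>: "\<beta> \<le> 2 * R"
    and \<rho>: "\<alpha> < \<rho>" "\<rho> < \<beta>" and \<sigma>: "\<alpha> < \<sigma>" "\<sigma> < \<beta>" and w: "cmod w \<le> \<alpha> \<or> \<beta> \<le> cmod w"
  shows "Cint \<rho> u w = Cint \<sigma> u w"
proof (rule cdual_eqI)
  fix l :: "'x \<Rightarrow> complex" assume l: "cdual l"
  have "(\<lambda>s. l (u s) / (s - w)) holomorphic_on {x. \<alpha> < cmod x \<and> cmod x < \<beta>}"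
    by (intro holomorphic_intros holomorphic_on_subset[OF vholo_on_cdual[OF u l]]) (use \<alpha> \<beta> w in \<open>auto simp: annulus_def\<close>)
  then have "contour_integral (circlepath 0 \<rho>) (\<lambda>s. l (u s) / (s - w)) = contour_integral (circlepath 0 \<sigma>) (\<lambda>s. l (u s) / (s - w))"
    by (rule contour_integral_circlepath_annulus) (use \<alpha> \<rho> \<sigma> in auto)
  then show "l (Cint \<rho> u w) = l (Cint \<sigma> u w)"
    using \<alpha> \<beta> \<rho> \<sigma> w by (auto simp: cdual_Cint[OF l] continuous_on_sphere[OF u])
qed

lemma Cint_radius_inner:
  fixes u :: "complex \<Rightarrow> 'x::{complex_normed_vector,banach}"
  assumes "0 < R" "vholo_on u (annulus R)" "R < \<rho>" "\<rho> < 2*R" "cmod w < \<rho>" "R < \<sigma>" "\<sigma> < 2*R" "cmod w < \<sigma>"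
  shows "Cint \<rho> u w = Cint \<sigma> u w"
  by (rule Cint_radius[of u R "max R (cmod w)" "2 * R"]) (use assms in auto)

lemma Cint_radius_outer:
  fixes u :: "complex \<Rightarrow> 'x::{complex_normed_vector,banach}"
  assumes "0 < R" "vholo_on u (annulus R)" "R < \<rho>" "\<rho> < 2*R" "\<rho> < cmod w" "R < \<sigma>" "\<sigma> < 2*R" "\<sigma> < cmod w"
  shows "Cint \<rho> u w = Cint \<sigma> u w"
  by (rule Cint_radius[of u R R "min (2 * R) (cmod w)"]) (use assms in auto)

text \<open>Cauchy's formula for a ring. The difference quotient at \<open>w\<close> is holomorphic
  across \<open>w\<close>, so its integrals over the two circles agree; the subtracted kernel
  contributes nothing on the inner circle and the value at \<open>w\<close> on the outer
  one.\<close>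

lemma Cint_split:
  fixes u :: "complex \<Rightarrow> 'x::{complex_normed_vector,banach}"
  assumes R: "0 < R" and u: "vholo_on u (annulus R)"
    and \<rho>: "R < \<rho>" "\<rho> < cmod w" and \<sigma>: "cmod w < \<sigma>" "\<sigma> < 2*R"
  shows "u w = Cint \<sigma> u w - Cint \<rho> u w"
proof (rule cdual_eqI)
  fix l :: "'x \<Rightarrow> complex" assume l: "cdual l"
  note c = continuous_on_sphere[OF u]
  define v where "v x = l (u x)" for x
  have v: "v holomorphic_on annulus R" unfolding v_def by (rule vholo_on_cdual[OF u l])
  let ?I = "\<lambda>t. contour_integral (circlepath 0 t) (\<lambda>s. v s / (s - w))"
  define k where "k z = (if z = w then deriv v w else (v z - v w) / (z - w))" for z
  have k: "k holomorphic_on {x. R < cmod x \<and> cmod x < 2*R}"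
    using pole_lemma_open[OF v open_annulus] unfolding k_def annulus_def .
  have eq: "contour_integral (circlepath 0 \<rho>) k = contour_integral (circlepath 0 \<sigma>) k"
    using R \<rho> \<sigma> by (intro contour_integral_circlepath_annulus[OF k]) auto
  have *: "contour_integral (circlepath 0 t) k =
      ?I t - contour_integral (circlepath 0 t) (\<lambda>s. v w / (s - w))"
    if t: "R < t" "t < 2*R" "t \<noteq> cmod w" for t
  proof -
    have vc: "continuous_on (sphere 0 t) v"
      using holomorphic_on_imp_continuous_on[OF v] sphere_subset_annulus t by (blast intro: continuous_on_subset)
    have "contour_integral (circlepath 0 t) k = contour_integral (circlepath 0 t) (\<lambda>s. v s / (s - w) - v w / (s - w))"
      using t R by (intro contour_integral_cong) (auto simp: k_def diff_divide_distrib)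
    also have "\<dots> = ?I t - contour_integral (circlepath 0 t) (\<lambda>s. v w / (s - w))"
      using t R by (intro contour_integral_diff contour_integrable_continuous_circlepath continuous_intros) (auto intro!: vc continuous_intros)
    finally show ?thesis .
  qed
  have i1: "contour_integral (circlepath 0 \<rho>) (\<lambda>s. v w / (s - w)) = 0"
  proof (rule contour_integral_unique, rule Cauchy_theorem_disc_simple[of _ 0 "cmod w"])
    show "(\<lambda>s. v w / (s - w)) holomorphic_on ball 0 (cmod w)" by (intro holomorphic_intros) auto
  qed (use R \<rho> in auto)
  have i2: "contour_integral (circlepath 0 \<sigma>) (\<lambda>s. v w / (s - w)) = 2 * of_real pi * \<i> * v w"
    by (rule contour_integral_unique, rule Cauchy_integral_circlepath_simple) (use \<sigma> in auto)
  have "?I \<rho> = ?I \<sigma> - 2 * pi * \<i> * v w"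
    using eq *[of \<rho>] *[of \<sigma>] i1 i2 R \<rho> \<sigma> by simp
  then have "v w = ?I \<sigma> / (2 * pi * \<i>) - ?I \<rho> / (2 * pi * \<i>)"
    by (simp add: field_simps)
  also have "\<dots> = l (Cint \<sigma> u w - Cint \<rho> u w)"
    using R \<rho> \<sigma> by (simp add: cdual_Cint[OF l] cdual_diff[OF l] c v_def)
  finally show "l (u w) = l (Cint \<sigma> u w - Cint \<rho> u w)" by (simp add: v_def)
qed

text \<open>Radius of a circle in the annulus that encloses \<open>w\<close>; the \<open>max\<close>
  covers points in the hole. All such circles give the same integral, so the dependence on
  \<open>w\<close> is harmless and the regular part is defined on the whole disc.
  \<open>inner_radius\<close> is the counterpart for circles not reaching \<open>w\<close>, with
  \<open>min\<close> for points beyond the annulus.\<close>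

definition outer_radius :: "real \<Rightarrow> complex \<Rightarrow> real" where
  "outer_radius R w = (max R (cmod w) + 2 * R) / 2"

definition inner_radius :: "real \<Rightarrow> complex \<Rightarrow> real" where
  "inner_radius R w = (R + min (cmod w) (2 * R)) / 2"

definition regular_part :: "real \<Rightarrow> (complex \<Rightarrow> 'x::complex_normed_vector) \<Rightarrow> complex \<Rightarrow> 'x" where
  "regular_part R u w = Cint (outer_radius R w) u w"

text \<open>The minus sign is that of the inner circle in Cauchy's formula, so that the two parts
  add up to \<open>u\<close>.\<close>

definition principal_part :: "real \<Rightarrow> (complex \<Rightarrow> 'x::complex_normed_vector) \<Rightarrow> complex \<Rightarrow> 'x" where
  "principal_part R u w = - Cint (inner_radius R w) u w"

lemma outer_radius: "0 < R \<Longrightarrow> cmod w < 2 * R \<Longrightarrow> R < outer_radius R w \<and> outer_radius R w < 2 * R \<and> cmod w < outer_radius R w"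
  by (auto simp: outer_radius_def max_def)

lemma inner_radius: "0 < R \<Longrightarrow> R < cmod w \<Longrightarrow> R < inner_radius R w \<and> inner_radius R w < 2 * R \<and> inner_radius R w < cmod w"
  by (auto simp: inner_radius_def min_def)

text \<open>Prepares the substitution of \<open>b z\<close> for the second variable. Separate
  holomorphy with a joint bound is enough: on a fixed circle, \<open>z\<close> enters the Cauchy
  integral only through the density and through \<open>b z\<close>.\<close>

locale annulus_family =
  fixes F :: "complex \<Rightarrow> complex \<Rightarrow> 'x::{complex_normed_vector,banach}" and R C :: real
    and U :: "complex set" and b :: "complex \<Rightarrow> complex"
  assumes U: "open U" and R: "0 < R" and b: "b holomorphic_on U"
    and hol2: "\<And>z. z \<in> U \<Longrightarrow> vholo_on (F z) (annulus R)"
    and hol1: "\<And>w. w \<in> annulus R \<Longrightarrow> vholo_on (\<lambda>z. F z w) U"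
    and bd: "\<And>z w. z \<in> U \<Longrightarrow> w \<in> annulus R \<Longrightarrow> norm (F z w) \<le> C"
begin

lemmas cont = continuous_on_sphere[OF hol2]

lemma open_sub: "open {z \<in> U. cmod (b z) < t}" "open {z \<in> U. t < cmod (b z)}"
proof -
  have c: "continuous_on U (\<lambda>z. cmod (b z))" using holomorphic_on_imp_continuous_on[OF b] by (intro continuous_intros)
  show "open {z \<in> U. cmod (b z) < t}"
    using continuous_open_preimage[OF c U open_lessThan[of t]] by (simp add: vimage_def Int_def conj_commute)
  show "open {z \<in> U. t < cmod (b z)}"
    using continuous_open_preimage[OF c U open_greaterThan[of t]] by (simp add: vimage_def Int_def conj_commute)
qed

lemma vholo_Cint:
  assumes V: "open V" "V \<subseteq> U" and t: "R < t" "t < 2 * R" and d: "0 < d" "\<And>z. z \<in> V \<Longrightarrow> d \<le> \<bar>t - cmod (b z)\<bar>"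
  shows "vholo_on (\<lambda>z. Cint t (F z) (b z)) V"
proof (rule vholo_on_Cint[OF V(1) _ _ d])
  show "vholo_on (\<lambda>z. F z s) V" if "cmod s = t" for s
    by (rule vholo_on_subset[OF hol1 V(2)]) (use that t in \<open>simp add: annulus_def\<close>)
  show "b holomorphic_on V" by (rule holomorphic_on_subset[OF b V(2)])
  show "norm (F z s) \<le> C" if "z \<in> V" "cmod s = t" for z s
    by (rule bd) (use that t V in \<open>auto simp: annulus_def\<close>)
qed (use R t cont V(2) in auto)

lemma vholo_regular: "vholo_on (\<lambda>z. regular_part R (F z) (b z)) {z \<in> U. cmod (b z) < 2 * R}"
proof (rule vholo_on_local)
  fix x assume x: "x \<in> {z \<in> U. cmod (b z) < 2 * R}"
  define t where "t = outer_radius R (b x)"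
  have t: "R < t" "t < 2*R" "cmod (b x) < t" using outer_radius R x by (auto simp: t_def)
  \<comment> \<open>Near \<open>x\<close> the radius is frozen at \<open>t\<close>; the gap
    \<open>t - t'\<close> keeps the Cauchy kernel bounded on \<open>?V\<close>.\<close>
  define t' where "t' = (cmod (b x) + t) / 2"
  have t': "cmod (b x) < t'" "t' < t" using t by (auto simp: t'_def)
  let ?V = "{z \<in> U. cmod (b z) < t'}"
  have "vholo_on (\<lambda>z. Cint t (F z) (b z)) ?V"
    by (rule vholo_Cint[where d = "t - t'"]) (use open_sub t t' in auto)
  moreover have "regular_part R (F z) (b z) = Cint t (F z) (b z)" if "z \<in> ?V" for z
    unfolding regular_part_def
    by (rule Cint_radius_inner[OF R hol2]) (use that t t' outer_radius[OF R, of "b z"] in auto)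
  ultimately have "vholo_on (\<lambda>z. regular_part R (F z) (b z)) ?V"
    by (rule vholo_on_transform[rotated]) (use open_sub in auto)
  then show "\<exists>V. x \<in> V \<and> vholo_on (\<lambda>z. regular_part R (F z) (b z)) V"
    using x t' by (intro exI[of _ ?V]) auto
qed

lemma vholo_principal: "vholo_on (\<lambda>z. principal_part R (F z) (b z)) {z \<in> U. R < cmod (b z)}"
proof (rule vholo_on_local)
  fix x assume x: "x \<in> {z \<in> U. R < cmod (b z)}"
  define t where "t = inner_radius R (b x)"
  have t: "R < t" "t < 2*R" "t < cmod (b x)" using inner_radius R x by (auto simp: t_def)
  define t' where "t' = (cmod (b x) + t) / 2"
  have t': "t' < cmod (b x)" "t < t'" using t by (auto simp: t'_def)
  let ?V = "{z \<in> U. t' < cmod (b z)}"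
  have "vholo_on (\<lambda>z. Cint t (F z) (b z)) ?V"
    by (rule vholo_Cint[where d = "t' - t"]) (use open_sub t t' in auto)
  then have "vholo_on (\<lambda>z. scaleC (-1) (Cint t (F z) (b z))) ?V"
    by (rule vholo_on_scaleC[rotated 2]) (use open_sub in auto)
  moreover have "principal_part R (F z) (b z) = scaleC (-1) (Cint t (F z) (b z))" if "z \<in> ?V" for z
  proof -
    have "Cint (inner_radius R (b z)) (F z) (b z) = Cint t (F z) (b z)"
      by (rule Cint_radius_outer[OF R hol2]) (use that t t' inner_radius[OF R, of "b z"] in auto)
    then show ?thesis unfolding principal_part_def using scaleC_of_real[of "-1" "Cint t (F z) (b z)"] by simp
  qed
  ultimately have "vholo_on (\<lambda>z. principal_part R (F z) (b z)) ?V"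
    by (rule vholo_on_transform[rotated]) (use open_sub in auto)
  then show "\<exists>V. x \<in> V \<and> vholo_on (\<lambda>z. principal_part R (F z) (b z)) V"
    using x t' by (intro exI[of _ ?V]) auto
qed

end

locale annulus_function =
  fixes u :: "complex \<Rightarrow> 'x::{complex_normed_vector,banach}" and R C :: real
  assumes R: "0 < R" and hol: "vholo_on u (annulus R)"
    and bd: "\<And>w. w \<in> annulus R \<Longrightarrow> norm (u w) \<le> C"
begin

lemma split: "w \<in> annulus R \<Longrightarrow> u w = regular_part R u w + principal_part R u w"
  unfolding regular_part_def principal_part_def
  using Cint_split[OF R hol] outer_radius[OF R, of w] inner_radius[OF R, of w] by (auto simp: annulus_def)

lemma C: "0 \<le> C"
proof -
  have "complex_of_real (3/2 * R) \<in> annulus R" using R by (simp add: annulus_def norm_mult)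
  then show ?thesis using bd norm_ge_zero order_trans by blast
qed

lemmas cont = continuous_on_sphere[OF hol]

lemma bd_sphere: "R < t \<Longrightarrow> t < 2 * R \<Longrightarrow> cmod x = t \<Longrightarrow> norm (u x) \<le> C"
  by (rule bd) (simp add: annulus_def)

text \<open>The trivial estimate on circles shrinking to the inner boundary. It is good away from
  that boundary and blows up at it, which \<open>principal_le\<close> repairs.\<close>

lemma principal_bound:
  assumes w: "R < cmod w"
  shows "norm (principal_part R u w) \<le> R * C / (cmod w - R)"
proof (rule tendsto_lowerbound)
  show "((\<lambda>t. t * C / (cmod w - t)) \<longlongrightarrow> R * C / (cmod w - R)) (at_right R)"
    using w by (intro tendsto_intros) auto
  have "norm (principal_part R u w) \<le> t * C / (cmod w - t)" if t: "R < t" "t < min (cmod w) (2 * R)" for t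
  proof -
    have "principal_part R u w = - Cint t u w"
      unfolding principal_part_def using Cint_radius_outer[OF R hol, of "inner_radius R w" w t] t w inner_radius[OF R w] by simp
    moreover have "norm (Cint t u w) \<le> t * C / \<bar>t - cmod w\<bar>"
      by (rule norm_Cint_le) (use R t cont bd_sphere in auto)
    ultimately show ?thesis using t by simp
  qed
  then show "\<forall>\<^sub>F t in at_right R. norm (principal_part R u w) \<le> t * C / (cmod w - t)"
    unfolding eventually_at_right_field using R w by (intro exI[of _ "min (cmod w) (2 * R)"]) auto
qed simp

lemma regular_bound:
  assumes w: "cmod w < 2 * R"
  shows "norm (regular_part R u w) \<le> (2 * R) * C / (2 * R - cmod w)"
proof (rule tendsto_lowerbound)
  show "((\<lambda>t. t * C / (t - cmod w)) \<longlongrightarrow> (2 * R) * C / (2 * R - cmod w)) (at_left (2 * R))"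
    using w by (intro tendsto_intros) auto
  have "norm (regular_part R u w) \<le> t * C / (t - cmod w)" if t: "t < 2 * R" "max (cmod w) R < t" for t
  proof -
    have "regular_part R u w = Cint t u w"
      unfolding regular_part_def using Cint_radius_inner[OF R hol, of "outer_radius R w" w t] t w outer_radius[OF R w] by simp
    moreover have "norm (Cint t u w) \<le> t * C / \<bar>t - cmod w\<bar>"
      by (rule norm_Cint_le) (use R t cont bd_sphere in auto)
    ultimately show ?thesis using t by simp
  qed
  then show "\<forall>\<^sub>F t in at_left (2 * R). norm (regular_part R u w) \<le> t * C / (t - cmod w)"
    unfolding eventually_at_left_field using R w by (intro exI[of _ "max (cmod w) R"]) auto
qed simp

interpretation id: annulus_family "\<lambda>_. u" R C UNIV "\<lambda>w. w"
  using R hol bd by unfold_locales (auto simp: vholo_on_const)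

lemma vholo_regular: "vholo_on (regular_part R u) {w. cmod w < 2 * R}"
  using id.vholo_regular by simp

lemma vholo_principal: "vholo_on (principal_part R u) {w. R < cmod w}"
  using id.vholo_principal by simp

text \<open>The trivial estimate degenerates at the outer circle, but there the regular part is
  \<open>u\<close> minus the principal part, and the latter is bounded by
  \<open>R * C / (2 * R - R)\<close>, that is \<open>C\<close>. Maximum modulus on discs growing to
  radius \<open>2 * R\<close> carries \<open>C + C\<close> inwards.\<close>

theorem regular_le:
  assumes w: "cmod w < 2 * R"
  shows "norm (regular_part R u w) \<le> 2 * C"
proof (rule cdual_norm_le)
  fix l :: "'x \<Rightarrow> complex" assume l: "cdual l"
  let ?v = "\<lambda>x. l (regular_part R u x)"
  have hl: "?v holomorphic_on {w. cmod w < 2 * R}"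
    by (rule vholo_on_cdual[OF vholo_regular l])
  have ll: "cmod (l x) \<le> norm x" for x using l by (rule cdual_le)
  have "cmod (?v w) \<le> C + R * C / (t - R)" if t: "t < 2 * R" "max (cmod w) R < t" for t
  proof (rule maximum_modulus_frontier[of ?v "cball 0 t"])
    show "?v holomorphic_on interior (cball 0 t)"
      by (rule holomorphic_on_subset[OF hl]) (use t in auto)
    show "continuous_on (closure (cball 0 t)) ?v"
      by (rule continuous_on_subset[OF holomorphic_on_imp_continuous_on[OF hl]]) (use t in auto)
    fix x :: complex assume "x \<in> frontier (cball 0 t)"
    then have x: "cmod x = t" by simp
    then have xa: "x \<in> annulus R" using t by (simp add: annulus_def)
    have "regular_part R u x = u x - principal_part R u x" using split[OF xa] by simp
    also have "norm \<dots> \<le> C + R * C / (t - R)"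
      using bd[OF xa] principal_bound[of x] x t by (intro order_trans[OF norm_triangle_ineq4 add_mono]) auto
    finally show "cmod (?v x) \<le> C + R * C / (t - R)" using ll order_trans by blast
  qed (use t in auto)
  then have ev: "\<forall>\<^sub>F t in at_left (2 * R). cmod (?v w) \<le> C + R * C / (t - R)"
    unfolding eventually_at_left_field using R w by (intro exI[of _ "max (cmod w) R"]) auto
  have "((\<lambda>t. C + R * C / (t - R)) \<longlongrightarrow> C + R * C / (2 * R - R)) (at_left (2 * R))"
    using R by (intro tendsto_intros) auto
  from tendsto_lowerbound[OF this ev] show "cmod (?v w) \<le> 2 * C" using R by simp
qed

text \<open>From modulus \<open>4/3 * R\<close> on, \<open>principal_bound\<close> gives at most
  \<open>3 * C\<close>. Closer in, maximum modulus is used on a shell: its outer rim is covered by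
  that bound, and on the inner rim the principal part is \<open>u\<close> minus the regular part,
  bounded in the limit by \<open>C + 2 * C\<close>. The rim at \<open>4/3 * R\<close> makes the two
  bounds meet.\<close>

theorem principal_le:
  assumes w: "R < cmod w"
  shows "norm (principal_part R u w) \<le> 3 * C"
proof (cases "cmod w < 4/3 * R")
  case False
  then have "R * C / (cmod w - R) \<le> R * C / (R / 3)" using R C by (intro divide_left_mono) auto
  then show ?thesis using principal_bound[OF w] R by simp
next
  case w': True
  show ?thesis
  proof (rule cdual_norm_le)
    fix l :: "'x \<Rightarrow> complex" assume l: "cdual l"
    let ?v = "\<lambda>x. l (principal_part R u x)"
    have hl: "?v holomorphic_on {w. R < cmod w}"
      by (rule vholo_on_cdual[OF vholo_principal l])
    have ll: "cmod (l x) \<le> norm x" for x using l by (rule cdual_le)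
    have "cmod (?v w) \<le> C + 2 * R * C / (2 * R - t)" if t: "R < t" "t < cmod w" for t
    proof (rule maximum_modulus_frontier[of ?v "cball 0 (4/3*R) - ball 0 t"])
      let ?S = "cball 0 (4/3*R) - ball (0::complex) t"
      have cl: "closed ?S" by (intro closed_Diff) auto
      show "?v holomorphic_on interior ?S"
        by (rule holomorphic_on_subset[OF hl]) (use t interior_subset in fastforce)
      show "continuous_on (closure ?S) ?v"
        by (rule continuous_on_subset[OF holomorphic_on_imp_continuous_on[OF hl]]) (use t cl in auto)
      show "bounded ?S" by (intro bounded_diff) auto
      show "w \<in> ?S" using t w' by auto
      fix x :: complex assume "x \<in> frontier ?S"
      moreover have "ball 0 (4/3*R) - cball 0 t \<subseteq> interior ?S"
        by (rule interior_maximal) (auto simp: open_Diff)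
      moreover have "x \<in> ?S" using \<open>x \<in> frontier ?S\<close> cl frontier_subset_closed by blast
      ultimately have x: "cmod x = t \<or> cmod x = 4/3 * R" by (force simp: frontier_def)
      then have xa: "x \<in> annulus R" using t R w' by (auto simp: annulus_def)
      have "2 * R * C / (2 * R - R) \<le> 2 * R * C / (2 * R - t)"
        using t w' R C by (intro divide_left_mono) auto
      then have 3: "3 * C \<le> C + 2 * R * C / (2 * R - t)" using R by simp
      from x have "norm (principal_part R u x) \<le> C + 2 * R * C / (2 * R - t)"
      proof
        assume x: "cmod x = 4/3 * R"
        have "norm (principal_part R u x) \<le> R * C / (4/3 * R - R)"
          using principal_bound[of x, unfolded x] R by linarith
        also have "\<dots> = 3 * C" using R by (simp add: field_simps)
        finally show ?thesis using 3 by simp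
      next
        assume x: "cmod x = t"
        have "principal_part R u x = u x - regular_part R u x" using split[OF xa] by simp
        also have "norm \<dots> \<le> C + 2 * R * C / (2 * R - t)"
          using bd[OF xa] regular_bound[of x] x t w' R by (intro order_trans[OF norm_triangle_ineq4 add_mono]) auto
        finally show ?thesis .
      qed
      then show "cmod (?v x) \<le> C + 2 * R * C / (2 * R - t)" using ll order_trans by blast
    qed
    then have ev: "\<forall>\<^sub>F t in at_right R. cmod (?v w) \<le> C + 2 * R * C / (2 * R - t)"
      unfolding eventually_at_right_field using w by blast
    have "((\<lambda>t. C + 2 * R * C / (2 * R - t)) \<longlongrightarrow> C + 2 * R * C / (2 * R - R)) (at_right R)"
      using R by (intro tendsto_intros) auto
    from tendsto_lowerbound[OF this ev] show "cmod (?v w) \<le> 3 * C" using R by simp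
  qed
qed

end

section \<open>The Schwarz--Pick lemma and local inverses\<close>

text \<open>The identity that makes \<open>rho\<close> smaller than 1 inside the disc and equal to 1
  on the circle.\<close>

lemma cmod_diff_sq: "(cmod (1 - cnj w * z))\<^sup>2 - (cmod (z - w))\<^sup>2 = (1 - (cmod z)\<^sup>2) * (1 - (cmod w)\<^sup>2)"
  unfolding cmod_power2 by (simp add: algebra_simps power2_eq_square)

lemma one_minus_cnj_mult_nz:
  assumes "cmod w < 1" "cmod z \<le> 1"
  shows "1 - cnj w * z \<noteq> 0"
proof
  assume "1 - cnj w * z = 0"
  then have "cmod w * cmod z = 1" by (metis complex_mod_cnj norm_mult norm_one right_minus_eq)
  moreover have "cmod w * cmod z \<le> cmod w * 1" using assms by (intro mult_left_mono) auto
  ultimately show False using assms by simp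
qed

lemma one_minus_rho_sq:
  assumes "cmod w < 1" "cmod z \<le> 1"
  shows "1 - (rho z w)\<^sup>2 = (1 - (cmod z)\<^sup>2) * (1 - (cmod w)\<^sup>2) / (cmod (1 - cnj w * z))\<^sup>2"
  using one_minus_cnj_mult_nz[OF assms] cmod_diff_sq[of w z]
  by (simp add: rho_def power_divide field_simps)

lemma rho_nonneg: "0 \<le> rho z w" by (simp add: rho_def)

lemma rho_commute: "rho z w = rho w z"
proof -
  have "cmod (1 - cnj w * z) = cmod (cnj (1 - cnj w * z))" by (simp only: complex_mod_cnj)
  then show ?thesis unfolding rho_def by (simp add: norm_minus_commute mult.commute)
qed

lemma rho_less_1:
  assumes "cmod w < 1" "cmod z < 1"
  shows "rho z w < 1"
proof -
  have "0 < (1 - (cmod z)\<^sup>2) * (1 - (cmod w)\<^sup>2) / (cmod (1 - cnj w * z))\<^sup>2"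
    using assms one_minus_cnj_mult_nz[of w z] by (intro divide_pos_pos mult_pos_pos) (auto simp: abs_square_less_1)
  then have "(rho z w)\<^sup>2 < 1" using one_minus_rho_sq[of w z] assms by simp
  then show ?thesis using rho_nonneg[of z w] by (simp add: abs_square_less_1)
qed

text \<open>Conjugating \<open>g\<close> with disc automorphisms that move \<open>a\<close> and
  \<open>g a\<close> to 0 reduces the claim to Schwarz's lemma.\<close>

lemma schwarz_pick_strict:
  assumes g: "g holomorphic_on ball 0 1" and lt: "\<And>x. cmod x < 1 \<Longrightarrow> cmod (g x) < 1"
    and z: "cmod z < 1" and a: "cmod a < 1"
  shows "cmod (g z - g a) \<le> rho z a * cmod (1 - cnj (g a) * g z)"
proof -
  let ?m = "Moebius_function 0"
  define f where "f x = ?m (g a) (g (?m (- a) x))" for x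
  have hm: "?m w holomorphic_on ball 0 1" if "cmod w < 1" for w using Moebius_function_holomorphic that by blast
  have nm: "cmod (?m w x) < 1" if "cmod w < 1" "cmod x < 1" for w x using Moebius_function_norm_lt_1 that by blast
  have "cmod (f (?m a z)) \<le> cmod (?m a z)"
  proof (rule Schwarz_Lemma(1))
    have 1: "(g \<circ> ?m (- a)) holomorphic_on ball 0 1"
      by (rule holomorphic_on_compose_gen[OF hm g]) (use a nm in auto)
    have "(?m (g a) \<circ> (g \<circ> ?m (- a))) holomorphic_on ball 0 1"
      by (rule holomorphic_on_compose_gen[OF 1 hm]) (use a nm lt in auto)
    then show "f holomorphic_on ball 0 1" by (simp add: f_def[abs_def] o_def)
    show "f 0 = 0" using a by (simp add: f_def Moebius_function_of_zero Moebius_function_eq_zero)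
    show "cmod (f x) < 1" if "cmod x < 1" for x using that a lt nm by (simp add: f_def)
    show "cmod (?m a z) < 1" using nm a z by simp
  qed
  moreover have "f (?m a z) = ?m (g a) (g z)"
    using Moebius_function_compose[of "- a" a z] a z by (simp add: f_def)
  ultimately have "cmod (g z - g a) / cmod (1 - cnj (g a) * g z) \<le> rho z a"
    by (simp add: Moebius_function_simple norm_divide rho_def)
  then show ?thesis
    using one_minus_cnj_mult_nz[of "g a" "g z"] lt[OF a] lt[OF z] by (simp add: divide_le_eq)
qed

text \<open>The strict version for \<open>t * g\<close>, with \<open>t\<close> tending to 1. Written
  as a product, the estimate survives the limit even for unimodular constants, where the factor
  \<open>1 - cnj (g a) * g z\<close> vanishes.\<close>

lemma schwarz_pick:
  assumes g: "g holomorphic_on ball 0 1" and le: "\<And>x. cmod x < 1 \<Longrightarrow> cmod (g x) \<le> 1"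
    and z: "cmod z < 1" and a: "cmod a < 1"
  shows "cmod (g z - g a) \<le> rho z a * cmod (1 - cnj (g a) * g z)"
proof -
  have *: "cmod (of_real t * g z - of_real t * g a) \<le> rho z a * cmod (1 - cnj (of_real t * g a) * (of_real t * g z))"
    if t: "0 < t" "t < 1" for t
  proof (rule schwarz_pick_strict[of "\<lambda>x. of_real t * g x", OF _ _ z a])
    show "cmod (of_real t * g x) < 1" if "cmod x < 1" for x
    proof -
      have "t * cmod (g x) \<le> t * 1" by (rule mult_left_mono[OF le[OF that]]) (use t in auto)
      moreover have "cmod (of_real t * g x) = t * cmod (g x)" using t by (simp add: norm_mult)
      ultimately show ?thesis using t by linarith
    qed
  qed (intro holomorphic_intros g)
  have ev: "\<forall>\<^sub>F t in at_left 1. cmod (of_real t * g z - of_real t * g a) \<le> rho z a * cmod (1 - cnj (of_real t * g a) * (of_real t * g z))"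
    unfolding eventually_at_left_field using * by (intro exI[of _ 0]) auto
  have 1: "((\<lambda>t. cmod (of_real t * g z - of_real t * g a)) \<longlongrightarrow> cmod (of_real 1 * g z - of_real 1 * g a)) (at_left (1::real))"
    by (intro tendsto_intros)
  have 2: "((\<lambda>t. rho z a * cmod (1 - cnj (of_real t * g a) * (of_real t * g z))) \<longlongrightarrow> rho z a * cmod (1 - cnj (of_real 1 * g a) * (of_real 1 * g z))) (at_left (1::real))"
    by (intro tendsto_intros)
  show ?thesis using tendsto_le[OF _ 2 1 ev] by simp
qed

text \<open>A function bounded by 1 that is large at \<open>a\<close> cannot be small at
  pseudohyperbolic distance at most \<open>\<mu>\<close> from \<open>a\<close>. It serves for the
  Blaschke product with one factor removed, \<open>a\<close> being the zero of that factor.\<close>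

lemma holomorphic_lower_bound:
  assumes g: "g holomorphic_on ball 0 1" and le: "\<And>x. cmod x < 1 \<Longrightarrow> cmod (g x) \<le> 1"
    and z: "cmod z < 1" and a: "cmod a < 1" and ga: "\<delta> \<le> cmod (g a)"
    and \<mu>: "rho z a \<le> \<mu>" "\<mu> < 1" and d: "0 \<le> \<delta>" "\<delta> \<le> 1"
  shows "(\<delta> - \<mu>) / (1 - \<mu> * \<delta>) \<le> cmod (g z)"
proof -
  have \<mu>0: "0 \<le> \<mu>" using rho_nonneg \<mu> order_trans by blast
  define x y where "x = cmod (g z)" and "y = cmod (g a)"
  have xy: "0 \<le> x" "x \<le> 1" "\<delta> \<le> y" "y \<le> 1" using le z a ga by (auto simp: x_def y_def)
  have "cmod (g z - g a) \<le> \<mu> * cmod (1 - cnj (g a) * g z)"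
    using schwarz_pick[OF g le z a] mult_right_mono[OF \<mu>(1)] order_trans norm_ge_zero by blast
  then have sq: "(cmod (g z - g a))\<^sup>2 \<le> (\<mu> * cmod (1 - cnj (g a) * g z))\<^sup>2" by (intro power_mono) auto
  define c where "c = Re (cnj (g a) * g z)"
  have e1: "(cmod (g z - g a))\<^sup>2 = x\<^sup>2 + y\<^sup>2 - 2 * c"
    unfolding x_def y_def c_def cmod_power2 by (simp add: algebra_simps power2_eq_square)
  have e2: "(cmod (1 - cnj (g a) * g z))\<^sup>2 = 1 + x\<^sup>2 * y\<^sup>2 - 2 * c"
    unfolding x_def y_def c_def cmod_power2 by (simp add: algebra_simps power2_eq_square)
  have "x\<^sup>2 + y\<^sup>2 - 2 * c \<le> \<mu>\<^sup>2 * (1 + x\<^sup>2 * y\<^sup>2 - 2 * c)"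
    using sq unfolding power_mult_distrib e1 e2 .
  \<comment> \<open>Equal arguments of \<open>g z\<close> and \<open>g a\<close> are the worst case;
    replacing \<open>c\<close> by \<open>x * y\<close> leaves an inequality between perfect
    squares.\<close>
  moreover have "c \<le> x * y"
    using complex_Re_le_cmod[of "cnj (g a) * g z"] by (simp add: c_def x_def y_def norm_mult mult.commute)
  then have "(1 - \<mu>\<^sup>2) * c \<le> (1 - \<mu>\<^sup>2) * (x * y)"
    using \<mu>0 \<mu> by (intro mult_left_mono) (auto simp: power_le_one)
  ultimately have "(y - x)\<^sup>2 \<le> (\<mu> * (1 - x * y))\<^sup>2"
    by (simp add: power2_eq_square algebra_simps)
  moreover have "0 \<le> \<mu> * (1 - x * y)" using \<mu>0 xy mult_le_one[of x y] d by simp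
  ultimately have "y - x \<le> \<mu> * (1 - x * y)" using abs_le_square_iff[of "y - x" "\<mu> * (1 - x * y)"] by simp
  then have 1: "y - \<mu> \<le> x * (1 - \<mu> * y)" by (simp add: algebra_simps)
  have p: "0 < 1 - \<mu> * t" if "0 \<le> t" "t \<le> 1" for t
    using that \<mu> \<mu>0 mult_left_le[of t \<mu>] by linarith
  have py: "0 < 1 - \<mu> * y" "0 < 1 - \<mu> * \<delta>" using p[of y] p[of \<delta>] xy d by auto
  \<comment> \<open>This expresses that the lower bound increases with the modulus \<open>y\<close>
    of \<open>g a\<close>, so that \<open>\<delta>\<close> may replace \<open>y\<close>.\<close>
  have "0 \<le> (y - \<delta>) * (1 - \<mu>\<^sup>2)" using xy \<mu> \<mu>0 by (intro mult_nonneg_nonneg) (auto simp: power_le_one)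
  then have "(\<delta> - \<mu>) * (1 - \<mu> * y) \<le> (y - \<mu>) * (1 - \<mu> * \<delta>)" by (simp add: algebra_simps power2_eq_square)
  then have "(\<delta> - \<mu>) / (1 - \<mu> * \<delta>) \<le> (y - \<mu>) / (1 - \<mu> * y)" using py by (simp add: divide_simps mult.commute)
  also have "\<dots> \<le> x" using 1 py by (simp add: divide_le_eq)
  finally show ?thesis by (simp add: x_def)
qed

text \<open>A map of the disc into a smaller disc strictly contracts pseudohyperbolic distance.
  Schwarz-Pick for \<open>f / \<kappa>\<close> makes this quantitative.\<close>

lemma fixed_point_unique:
  assumes f: "f holomorphic_on ball 0 1" and \<kappa>: "0 < \<kappa>" "\<kappa> < 1" and le: "\<And>x. cmod x < 1 \<Longrightarrow> cmod (f x) \<le> \<kappa>"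
    and p: "cmod p < 1" "f p = p" and q: "cmod q < 1" "f q = q"
  shows "p = q"
proof (rule ccontr)
  assume pq: "p \<noteq> q"
  define g where "g x = f x / of_real \<kappa>" for x
  have "cmod (g p - g q) \<le> rho p q * cmod (1 - cnj (g q) * g p)"
  proof (rule schwarz_pick[OF _ _ p(1) q(1)])
    show "g holomorphic_on ball 0 1" unfolding g_def by (intro holomorphic_intros f) (use \<kappa> in auto)
    show "cmod (g x) \<le> 1" if "cmod x < 1" for x using le[OF that] \<kappa> by (simp add: g_def norm_divide)
  qed
  define s where "s = cnj q * p / (of_real \<kappa>)\<^sup>2"
  have gg: "cnj (g q) * g p = s" by (simp add: g_def p q s_def power2_eq_square)
  have k: "cnj q * p = of_real (\<kappa>\<^sup>2) * s" using \<kappa> by (simp add: s_def)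
  have nz: "cmod (1 - cnj q * p) > 0" using one_minus_cnj_mult_nz[of q p] p q by simp
  have "g p - g q = (p - q) / of_real \<kappa>" by (simp add: g_def p q diff_divide_distrib)
  then have "cmod (p - q) / \<kappa> \<le> cmod (p - q) / cmod (1 - cnj q * p) * cmod (1 - s)"
    using \<open>cmod (g p - g q) \<le> _\<close> \<kappa> by (simp add: gg norm_divide rho_def)
  then have "cmod (p - q) * cmod (1 - cnj q * p) \<le> cmod (p - q) * (\<kappa> * cmod (1 - s))"
    using \<kappa> nz by (simp add: field_simps)
  then have "cmod (1 - of_real (\<kappa>\<^sup>2) * s) \<le> \<kappa> * cmod (1 - s)" using pq k by simp
  then have "(cmod (1 - of_real (\<kappa>\<^sup>2) * s))\<^sup>2 \<le> (\<kappa> * cmod (1 - s))\<^sup>2" by (intro power_mono) auto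
  \<comment> \<open>Both factors of the product are positive, since \<open>\<kappa> < 1\<close> and
    \<open>s\<close> has modulus at most 1; this contradicts the preceding inequality.\<close>
  moreover have "(cmod (1 - of_real (\<kappa>\<^sup>2) * s))\<^sup>2 - (\<kappa> * cmod (1 - s))\<^sup>2 = (1 - \<kappa>\<^sup>2) * (1 - \<kappa>\<^sup>2 * (cmod s)\<^sup>2)"
    unfolding power_mult_distrib cmod_power2 by (simp add: algebra_simps power2_eq_square)
  moreover have "\<kappa>\<^sup>2 < 1" using \<kappa> by (simp add: power_less_one_iff)
  moreover have "cmod s \<le> 1"
  proof -
    have "cmod p \<le> \<kappa>" "cmod q \<le> \<kappa>" using le[OF p(1)] le[OF q(1)] p q by auto
    then have "cmod q * cmod p \<le> \<kappa> * \<kappa>" using \<kappa> by (intro mult_mono) auto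
    then show ?thesis using \<kappa> by (simp add: s_def norm_divide norm_mult power2_eq_square divide_le_eq norm_power)
  qed
  then have "(cmod s)\<^sup>2 \<le> 1" by (simp add: power_le_one)
  then have "\<kappa>\<^sup>2 * (cmod s)\<^sup>2 < 1" using \<open>\<kappa>\<^sup>2 < 1\<close> mult_left_le[of "(cmod s)\<^sup>2" "\<kappa>\<^sup>2"] by (smt (verit) zero_le_power2)
  ultimately show False using mult_pos_pos[of "1 - \<kappa>\<^sup>2" "1 - \<kappa>\<^sup>2 * (cmod s)\<^sup>2"] by linarith
qed

text \<open>Solving \<open>x * G x = w\<close> means finding a fixed point of
  \<open>w / G x\<close>, which maps the closed disc of radius \<open>\<mu>\<close> strictly into
  itself when \<open>w\<close> has modulus below \<open>m * \<mu>\<close>. Brouwer gives existence,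
  \<open>fixed_point_unique\<close> gives uniqueness, and an injective holomorphic map has a
  holomorphic inverse.\<close>

lemma local_inverse:
  assumes G: "G holomorphic_on ball 0 1" and \<mu>: "0 < \<mu>" "\<mu> < 1" and m: "0 < m"
    and low: "\<And>x. cmod x \<le> \<mu> \<Longrightarrow> m \<le> cmod (G x)"
  obtains k where "k holomorphic_on ball 0 (m * \<mu>)"
    and "\<And>w. cmod w < m * \<mu> \<Longrightarrow> cmod (k w) < \<mu> \<and> k w * G (k w) = w"
    and "\<And>x. cmod x < \<mu> \<Longrightarrow> cmod (x * G x) < m * \<mu> \<Longrightarrow> k (x * G x) = x"
proof -
  let ?r = "m * \<mu>"
  have nz: "G x \<noteq> 0" if "cmod x \<le> \<mu>" for x using low[OF that] m by auto
  have uniq: "p = q" if p: "cmod p < \<mu>" "p * G p = w" and q: "cmod q < \<mu>" "q * G q = w" and w: "cmod w < ?r" for p q w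
  proof (cases "w = 0")
    case True
    then show ?thesis using p q nz[of p] nz[of q] by auto
  next
    case False
    \<comment> \<open>Rescaling by \<open>\<mu>\<close> moves the map to the unit disc, where it is
      bounded by \<open>cmod w / ?r < 1\<close>. This bound must be positive, so
      \<open>w = 0\<close> is a separate case.\<close>
    define f where "f x = w / (of_real \<mu> * G (of_real \<mu> * x))" for x
    have l: "cmod (of_real \<mu> * x) < \<mu>" if "cmod x < 1" for x using that \<mu> by (simp add: norm_mult)
    have "p / of_real \<mu> = q / of_real \<mu>"
    proof (rule fixed_point_unique[of f "cmod w / ?r"])
      have "(G \<circ> (\<lambda>x. of_real \<mu> * x)) holomorphic_on ball 0 1"
        by (rule holomorphic_on_compose_gen[OF _ G]) (use \<mu> l in \<open>auto intro!: holomorphic_intros intro: order_less_trans[OF l]\<close>)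
      then show "f holomorphic_on ball 0 1"
        unfolding f_def o_def by (intro holomorphic_intros) (use nz \<mu> l in \<open>auto intro: less_imp_le\<close>)
      show "cmod (f x) \<le> cmod w / ?r" if "cmod x < 1" for x
      proof -
        have A: "?r \<le> \<mu> * cmod (G (of_real \<mu> * x))" using low[of "of_real \<mu> * x"] l[OF that] \<mu> by (simp add: mult.commute)
        have B: "0 < ?r" using m \<mu> by simp
        have "cmod (f x) = cmod w / (\<mu> * cmod (G (of_real \<mu> * x)))"
          using \<mu> by (simp add: f_def norm_divide norm_mult)
        also have "\<dots> \<le> cmod w / ?r"
          by (rule divide_left_mono[OF A _ mult_pos_pos[OF less_le_trans[OF B A] B]]) simp
        finally show ?thesis .
      qed
      have fp: "f (y / of_real \<mu>) = y / of_real \<mu>" if "cmod y < \<mu>" "y * G y = w" for y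
        using that nz[of y] \<mu> by (auto simp: f_def)
      show "f (p / of_real \<mu>) = p / of_real \<mu>" "f (q / of_real \<mu>) = q / of_real \<mu>" using fp p q by auto
      show "0 < cmod w / ?r" "cmod w / ?r < 1" using False w m \<mu> by (auto simp: divide_less_eq)
      show "cmod (p / of_real \<mu>) < 1" "cmod (q / of_real \<mu>) < 1" using p q \<mu> by (auto simp: norm_divide)
    qed
    then show ?thesis using \<mu> by simp
  qed
  have ex: "\<exists>p. cmod p < \<mu> \<and> p * G p = w" if w: "cmod w < ?r" for w
  proof -
    have lt: "cmod (w / G x) < \<mu>" if "cmod x \<le> \<mu>" for x
    proof -
      have "cmod w < \<mu> * cmod (G x)"
      proof (rule less_le_trans)
        show "\<mu> * m \<le> \<mu> * cmod (G x)" by (rule mult_left_mono[OF low[OF that]]) (use \<mu> in auto)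
      qed (use w in \<open>simp add: mult.commute\<close>)
      then show ?thesis using nz[OF that] by (simp add: norm_divide divide_less_eq)
    qed
    obtain p where p: "p \<in> cball 0 \<mu>" "w / G p = p"
    proof (rule brouwer[of "cball (0::complex) \<mu>" "\<lambda>x. w / G x"])
      show "continuous_on (cball 0 \<mu>) (\<lambda>x. w / G x)"
        using nz \<mu> by (intro continuous_intros continuous_on_subset[OF holomorphic_on_imp_continuous_on[OF G]]) auto
      show "(\<lambda>x. w / G x) \<in> cball 0 \<mu> \<rightarrow> cball 0 \<mu>" using less_imp_le[OF lt] by auto
    qed (use \<mu> in auto)
    then have "p * G p = w" using nz[of p] by (auto simp: divide_eq_eq)
    moreover have "cmod p < \<mu>" using lt[of p] p by auto
    ultimately show ?thesis by blast
  qed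
  define S where "S = {x \<in> ball 0 \<mu>. cmod (x * G x) < ?r}"
  define f where "f x = x * G x" for x
  have f: "f holomorphic_on ball 0 1" unfolding f_def by (intro holomorphic_intros G)
  have SB: "S \<subseteq> ball 0 1" using \<mu> by (auto simp: S_def)
  have "open S"
  proof -
    have "continuous_on (ball 0 \<mu>) (\<lambda>x. cmod (f x))"
      by (intro continuous_intros continuous_on_subset[OF holomorphic_on_imp_continuous_on[OF f]]) (use \<mu> in auto)
    from continuous_open_preimage[OF this _ open_lessThan[of ?r]] show ?thesis
      by (simp add: S_def f_def vimage_def Int_def)
  qed
  moreover have "inj_on f S" using uniq by (auto simp: inj_on_def S_def f_def)
  ultimately obtain k where k: "k holomorphic_on (f ` S)" "\<And>x. x \<in> S \<Longrightarrow> k (f x) = x"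
    using holomorphic_has_inverse[of f S] holomorphic_on_subset[OF f SB] by metis
  have "f ` S = ball 0 ?r"
  proof
    show "f ` S \<subseteq> ball 0 ?r" by (auto simp: f_def S_def)
    show "ball 0 ?r \<subseteq> f ` S"
    proof
      fix w :: complex assume "w \<in> ball 0 ?r"
      then obtain p where "cmod p < \<mu>" "p * G p = w" "cmod w < ?r" using ex[of w] by auto
      then show "w \<in> f ` S" by (intro image_eqI[of _ _ p]) (auto simp: f_def S_def)
    qed
  qed
  show thesis
  proof (rule that)
    show "k holomorphic_on ball 0 ?r" using k \<open>f ` S = ball 0 ?r\<close> by simp
    show "cmod (k w) < \<mu> \<and> k w * G (k w) = w" if w: "cmod w < ?r" for w
    proof -
      have "w \<in> f ` S" using \<open>f ` S = ball 0 ?r\<close> w by simp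
      then obtain x where x: "x \<in> S" "w = f x" by blast
      then show ?thesis using k(2)[OF x(1)] by (auto simp: S_def f_def)
    qed
    show "k (x * G x) = x" if "cmod x < \<mu>" "cmod (x * G x) < ?r" for x
      using k(2)[of x] that by (simp add: S_def f_def)
  qed
qed

section \<open>Blaschke products of separated sequences\<close>

definition mob :: "complex \<Rightarrow> complex \<Rightarrow> complex" where
  "mob a w = (a - w) / (1 - cnj a * w)"

text \<open>The value at 0 compensates \<open>mob 0 w = - w\<close>, because the Blaschke factor at
  0 is \<open>w\<close> itself.\<close>

definition phase :: "complex \<Rightarrow> complex" where
  "phase a = (if a = 0 then - 1 else complex_of_real (cmod a) / a)"

lemma norm_phase: "cmod (phase a) = 1"
  by (simp add: phase_def norm_divide)

lemma blaschke_factor_eq: "blaschke_factor a w = phase a * mob a w"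
  by (simp add: blaschke_factor_def phase_def mob_def)

lemma norm_mob: "cmod (mob a w) = rho w a"
  by (simp add: mob_def rho_def norm_divide norm_minus_commute)

lemma norm_blaschke_factor: "cmod (blaschke_factor a w) = rho w a"
  by (simp add: blaschke_factor_eq norm_mult norm_phase norm_mob)

lemma holomorphic_mob: "cmod a < 1 \<Longrightarrow> mob a holomorphic_on ball 0 1"
  unfolding mob_def using one_minus_cnj_mult_nz[of a] by (intro holomorphic_intros) auto

lemma continuous_mob: "cmod a < 1 \<Longrightarrow> continuous_on (cball 0 1) (mob a)"
  unfolding mob_def using one_minus_cnj_mult_nz[of a] by (intro continuous_intros) auto

lemma mob_mob:
  assumes "cmod a < 1" "cmod w < 1"
  shows "mob a (mob a w) = w"
proof -
  have 1: "1 - cnj a * w \<noteq> 0" "1 - cnj a * a \<noteq> 0"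
    using one_minus_cnj_mult_nz[of a w] one_minus_cnj_mult_nz[of a a] assms by auto
  have "a - mob a w = w * (1 - cnj a * a) / (1 - cnj a * w)"
    using 1 by (simp add: mob_def field_simps)
  moreover have "1 - cnj a * mob a w = (1 - cnj a * a) / (1 - cnj a * w)"
    using 1 by (simp add: mob_def field_simps)
  ultimately show ?thesis using 1 unfolding mob_def[of a "mob a w"] by simp
qed

lemma rho_eq_1:
  assumes "cmod a < 1" "cmod w = 1"
  shows "rho w a = 1"
proof -
  have "(rho w a)\<^sup>2 = 1" using one_minus_rho_sq[of a w] assms by simp
  then show ?thesis using rho_nonneg[of w a] by (simp add: power2_eq_1_iff)
qed

lemma holomorphic_blaschke_factor: "cmod a < 1 \<Longrightarrow> blaschke_factor a holomorphic_on ball 0 1"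
  unfolding blaschke_factor_eq[abs_def] by (intro holomorphic_intros holomorphic_mob)

lemma continuous_blaschke_factor: "cmod a < 1 \<Longrightarrow> continuous_on (cball 0 1) (blaschke_factor a)"
  unfolding blaschke_factor_eq[abs_def] by (intro continuous_intros continuous_mob)

text \<open>The difference contains the factor \<open>1 - cmod a\<close> exactly, and the remaining
  quotient is at most \<open>2 / (1 - cmod w)\<close>. Summability of \<open>1 - cmod (z n)\<close>
  thus makes the Blaschke product converge.\<close>

lemma blaschke_factor_near_1:
  assumes a: "cmod a < 1" and w: "cmod w < 1"
  shows "cmod (blaschke_factor a w - 1) \<le> 2 / (1 - cmod w) * (1 - cmod a)"
proof (cases "a = 0")
  case True
  have "cmod (w - 1) \<le> cmod w + 1" by (rule order_trans[OF norm_triangle_ineq4]) simp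
  also have "\<dots> \<le> 2" using w by simp
  also have "\<dots> \<le> 2 / (1 - cmod w)" using w by (simp add: field_simps)
  finally show ?thesis using True by (simp add: blaschke_factor_def)
next
  case False
  have nz: "1 - cnj a * w \<noteq> 0" using one_minus_cnj_mult_nz[of a w] assms by simp
  have "a * cnj a = of_real ((cmod a)\<^sup>2)" by (rule complex_norm_square[symmetric])
  then have eq: "1 - blaschke_factor a w = (1 - of_real (cmod a)) * (a + of_real (cmod a) * w) / (a * (1 - cnj a * w))"
    using False nz by (simp add: blaschke_factor_def divide_simps) (simp add: algebra_simps power2_eq_square)
  have "cmod (1 - of_real (cmod a)) = \<bar>1 - cmod a\<bar>" by (metis norm_of_real of_real_1 of_real_diff)
  then have n1: "cmod (1 - of_real (cmod a)) = 1 - cmod a" using a by simp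
  have "cmod (blaschke_factor a w - 1) = (1 - cmod a) * (cmod (a + of_real (cmod a) * w) / cmod a) / cmod (1 - cnj a * w)"
    unfolding norm_minus_commute[of "blaschke_factor a w" 1] eq norm_divide norm_mult n1 by simp
  also have "\<dots> \<le> (1 - cmod a) * 2 / (1 - cmod w)"
  proof (rule frac_le)
    have "cmod (a + of_real (cmod a) * w) \<le> cmod a + cmod a * cmod w"
      by (rule order_trans[OF norm_triangle_ineq]) (simp add: norm_mult)
    also have "\<dots> \<le> cmod a * 2" using mult_left_mono[of "cmod w" 1 "cmod a"] w by simp
    finally have "cmod (a + of_real (cmod a) * w) / cmod a \<le> 2" using False by (simp add: divide_le_eq mult.commute)
    then show "(1 - cmod a) * (cmod (a + of_real (cmod a) * w) / cmod a) \<le> (1 - cmod a) * 2"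
      by (rule mult_left_mono) (use a in simp)
    have "cmod a * cmod w \<le> 1 * cmod w" using a by (intro mult_right_mono) auto
    then show "1 - cmod w \<le> cmod (1 - cnj a * w)"
      using norm_triangle_ineq2[of 1 "cnj a * w"] by (simp add: norm_mult)
  qed (use a w in auto)
  finally show ?thesis by (simp add: mult.commute)
qed

locale separated =
  fixes z :: "nat \<Rightarrow> complex" and \<delta> :: real
  assumes z: "\<And>n. cmod (z n) < 1" and \<delta>: "0 < \<delta>"
    and sep: "\<And>k N. \<delta> \<le> (\<Prod>j\<in>{..<N} - {k}. rho (z j) (z k))"
begin

lemma \<delta>_le_1: "\<delta> \<le> 1" using sep[of 0 0] by simp

text \<open>The Blaschke condition, drawn from separation from \<open>z 0\<close>: each deficit
  \<open>1 - rho (z n) (z 0)\<close> dominates a multiple of \<open>1 - cmod (z n)\<close>, and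
  \<open>1 - t \<le> exp (- t)\<close> turns the lower bound on products into an upper bound on
  sums.\<close>

lemma summable_one_minus: "summable (\<lambda>n. 1 - cmod (z n))"
proof (rule summableI_nonneg_bounded)
  \<comment> \<open>Of the factor 8, 4 bounds the squared denominator of \<open>rho\<close>, and 2
    comes from \<open>1 - t\<^sup>2 \<le> 2 * (1 - t)\<close>.\<close>
  define c where "c = (1 - (cmod (z 0))\<^sup>2) / 8"
  have c: "0 < c" using z[of 0] by (simp add: c_def abs_square_less_1)
  have le: "c * (1 - cmod (z n)) \<le> 1 - rho (z n) (z 0)" for n
  proof -
    let ?a = "z 0" and ?w = "z n"
    have "cmod (1 - cnj ?a * ?w) \<le> 1 + cmod ?a * cmod ?w"
      by (rule order_trans[OF norm_triangle_ineq4]) (simp add: norm_mult)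
    also have "\<dots> \<le> 1 + 1 * 1" using z[of 0] z[of n] by (intro add_mono mult_mono) auto
    finally have "(cmod (1 - cnj ?a * ?w))\<^sup>2 \<le> 2\<^sup>2" by (intro power_mono) auto
    moreover have "0 < (cmod (1 - cnj ?a * ?w))\<^sup>2"
      using one_minus_cnj_mult_nz[OF z, of ?w 0] z[of n] by simp
    moreover have "0 \<le> (1 - (cmod ?w)\<^sup>2) * (1 - (cmod ?a)\<^sup>2)"
      using z[of 0] z[of n] by (intro mult_nonneg_nonneg) (auto simp: abs_square_le_1 less_imp_le)
    ultimately have "(1 - (cmod ?w)\<^sup>2) * (1 - (cmod ?a)\<^sup>2) / 4 \<le> 1 - (rho ?w ?a)\<^sup>2"
      using z[of n] unfolding one_minus_rho_sq[OF z less_imp_le[OF z]] by (intro divide_left_mono) auto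
    moreover have "1 - cmod ?w \<le> 1 - (cmod ?w)\<^sup>2"
      using z[of n] mult_left_le[of "cmod ?w" "cmod ?w"] by (simp add: power2_eq_square)
    then have "(1 - cmod ?w) * (1 - (cmod ?a)\<^sup>2) \<le> (1 - (cmod ?w)\<^sup>2) * (1 - (cmod ?a)\<^sup>2)"
      using z[of 0] by (intro mult_right_mono) (auto simp: abs_square_le_1 less_imp_le)
    moreover have "1 - (rho ?w ?a)\<^sup>2 \<le> 2 * (1 - rho ?w ?a)"
      using zero_le_power2[of "1 - rho ?w ?a"] by (simp add: power2_eq_square algebra_simps)
    ultimately show ?thesis by (simp add: c_def field_simps)
  qed
  fix N
  have "\<delta> \<le> (\<Prod>j\<in>{..<N} - {0}. rho (z j) (z 0))" by (rule sep)
  also have "\<dots> \<le> (\<Prod>j\<in>{..<N} - {0}. exp (- (c * (1 - cmod (z j)))))"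
  proof (rule prod_mono)
    fix j
    have "rho (z j) (z 0) \<le> 1 + (- (c * (1 - cmod (z j))))" using le[of j] by simp
    also have "\<dots> \<le> exp (- (c * (1 - cmod (z j))))" by (rule exp_ge_add_one_self)
    finally show "0 \<le> rho (z j) (z 0) \<and> rho (z j) (z 0) \<le> exp (- (c * (1 - cmod (z j))))"
      by (simp add: rho_nonneg)
  qed
  also have "\<dots> = exp (- (c * (\<Sum>j\<in>{..<N} - {0}. 1 - cmod (z j))))"
    by (simp add: exp_sum[symmetric] sum_negf sum_distrib_left)
  finally have "ln \<delta> \<le> - (c * (\<Sum>j\<in>{..<N} - {0}. 1 - cmod (z j)))"
    using \<delta> by (metis ln_le_cancel_iff exp_gt_zero ln_exp)
  then have "(\<Sum>j\<in>{..<N} - {0}. 1 - cmod (z j)) \<le> - ln \<delta> / c" using c by (simp add: field_simps)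
  \<comment> \<open>Index 0 does not occur in the separated product; its term is at most 1.\<close>
  moreover have "(\<Sum>j<N. 1 - cmod (z j)) \<le> (\<Sum>j\<in>insert 0 ({..<N} - {0}). 1 - cmod (z j))"
    by (rule sum_mono2) (use z in \<open>auto simp: less_imp_le\<close>)
  moreover have "(\<Sum>j\<in>insert 0 ({..<N} - {0}). 1 - cmod (z j)) \<le> 1 + (\<Sum>j\<in>{..<N} - {0}. 1 - cmod (z j))"
    by (subst sum.insert) auto
  ultimately show "(\<Sum>j<N. 1 - cmod (z j)) \<le> 1 + - ln \<delta> / c" by linarith
qed (use z in \<open>simp add: less_imp_le\<close>)

abbreviation partial :: "nat set \<Rightarrow> complex \<Rightarrow> complex" where
  "partial I w \<equiv> \<Prod>k\<in>I. blaschke_factor (z k) w"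

lemma convergent_blaschke:
  assumes w: "cmod w < 1"
  shows "convergent (\<lambda>N. partial ({..<N} - K) w)"
proof -
  define f where "f k = (if k \<in> K then 1 else blaschke_factor (z k) w)" for k
  have "summable (\<lambda>k. norm (f k - 1))"
  proof (rule summable_comparison_test')
    show "summable (\<lambda>k. 2 / (1 - cmod w) * (1 - cmod (z k)))" by (intro summable_mult summable_one_minus)
    show "norm (norm (f k - 1)) \<le> 2 / (1 - cmod w) * (1 - cmod (z k))" if "k \<ge> 0" for k
      using blaschke_factor_near_1[OF z w, of k] z[of k] w by (auto simp: f_def less_imp_le)
  qed
  then obtain l where "(\<lambda>N. \<Sum>k<N. norm (f k - 1)) \<longlonglongrightarrow> l"
    unfolding summable_def sums_def by blast
  then have "uniformly_convergent_on {w} (\<lambda>N x. \<Sum>k<N. norm (f k - 1))"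
    unfolding uniformly_convergent_on_def by (intro exI[of _ "\<lambda>_. l"]) (simp add: uniform_limit_singleton)
  then have "uniformly_convergent_on {w} (\<lambda>N x. \<Prod>k<N. f k)"
    by (rule uniformly_convergent_on_prod'[of "{w}" "\<lambda>k _. f k", rotated 2]) auto
  then have "convergent (\<lambda>N. \<Prod>k<N. f k)"
    by (rule uniformly_convergent_imp_convergent) simp
  moreover have "(\<Prod>k<N. f k) = (partial ({..<N} - K) w)" for N
    unfolding f_def by (simp add: prod.If_cases Diff_eq)
  ultimately show ?thesis by simp
qed

text \<open>\<open>K = {}\<close> gives the full product, \<open>K = {n}\<close> the cofactor of the
  zero \<open>z n\<close>.\<close>

definition omit :: "nat set \<Rightarrow> complex \<Rightarrow> complex" where
  "omit K w = lim (\<lambda>N. partial ({..<N} - K) w)"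

lemma omit_lim: "cmod w < 1 \<Longrightarrow> (\<lambda>N. partial ({..<N} - K) w) \<longlonglongrightarrow> omit K w"
  unfolding omit_def using convergent_blaschke convergent_LIMSEQ_iff by blast

lemma blaschke_eq_omit: "blaschke z = omit {}"
  by (simp add: fun_eq_iff blaschke_def omit_def)

lemma norm_finite_product_le:
  assumes "cmod w < 1"
  shows "cmod (partial I w) \<le> 1"
  unfolding prod_norm[symmetric] norm_blaschke_factor
  by (rule prod_le_1) (use rho_less_1[OF z assms] rho_nonneg in \<open>auto intro: less_imp_le\<close>)

lemma norm_omit_le: "cmod w < 1 \<Longrightarrow> cmod (omit K w) \<le> 1"
  by (rule LIMSEQ_le_const2[OF tendsto_norm[OF omit_lim]]) (auto intro: norm_finite_product_le)

lemma holomorphic_finite_product: "(\<lambda>w. partial I w) holomorphic_on ball 0 1"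
  by (intro holomorphic_intros holomorphic_blaschke_factor z)

lemma holomorphic_omit: "omit K holomorphic_on ball 0 1"
  by (rule holomorphic_pointwise_limit[where C = 1 and f = "\<lambda>N w. partial ({..<N} - K) w"])
     (auto intro: holomorphic_finite_product norm_finite_product_le omit_lim)

lemma blaschke_split:
  assumes w: "cmod w < 1"
  shows "blaschke z w = blaschke_factor (z n) w * omit {n} w"
proof (rule LIMSEQ_unique)
  show "(\<lambda>N. partial ({..<N} - {}) w) \<longlonglongrightarrow> blaschke z w"
    unfolding blaschke_eq_omit by (rule omit_lim[OF w])
  have "\<forall>\<^sub>F N in sequentially. (partial ({..<N} - {}) w) =
      blaschke_factor (z n) w * (partial ({..<N} - {n}) w)"
    using eventually_gt_at_top[of n] by eventually_elim (simp add: prod.remove)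
  moreover have "(\<lambda>N. blaschke_factor (z n) w * (partial ({..<N} - {n}) w)) \<longlonglongrightarrow> blaschke_factor (z n) w * omit {n} w"
    by (intro tendsto_intros omit_lim w)
  ultimately show "(\<lambda>N. partial ({..<N} - {}) w) \<longlonglongrightarrow> blaschke_factor (z n) w * omit {n} w"
    using tendsto_cong by fast
qed

lemma finite_product_ge: "\<delta> \<le> cmod (partial ({..<N} - {n}) (z n))"
  unfolding prod_norm[symmetric] norm_blaschke_factor rho_commute[of "z n"] by (rule sep)

lemma omit_ge: "\<delta> \<le> cmod (omit {n} (z n))"
  by (rule LIMSEQ_le_const[OF tendsto_norm[OF omit_lim[OF z]]]) (auto intro: finite_product_ge)

end

locale separated_radius = separated +
  fixes \<mu> r :: real
  assumes \<mu>: "0 < \<mu>" "\<mu> < \<delta>"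
    and r: "r = (\<delta> - \<mu>) / (1 - \<mu> * \<delta>) * \<mu>"
begin

lemma \<mu>1: "\<mu> < 1" using \<mu> \<delta>_le_1 by simp

lemma m_pos: "0 < (\<delta> - \<mu>) / (1 - \<mu> * \<delta>)"
proof -
  have "\<mu> * \<delta> \<le> \<mu> * 1" using \<mu> \<delta>_le_1 by (intro mult_left_mono) auto
  then have "\<mu> * \<delta> < 1" using \<mu>1 by linarith
  then show ?thesis using \<mu> by simp
qed

lemma m_le_1: "(\<delta> - \<mu>) / (1 - \<mu> * \<delta>) \<le> 1"
proof -
  have "\<mu> * \<delta> \<le> \<mu> * 1" using \<mu> \<delta>_le_1 by (intro mult_left_mono) auto
  moreover have "0 \<le> (1 - \<delta>) * (1 + \<mu>)" using \<mu> \<delta>_le_1 by (intro mult_nonneg_nonneg) auto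
  then have "\<delta> - \<mu> \<le> 1 - \<mu> * \<delta>" by (simp add: algebra_simps)
  ultimately show ?thesis using \<mu> \<mu>1 by (simp add: divide_le_eq)
qed

lemma r_pos: "0 < r" unfolding r by (rule mult_pos_pos[OF m_pos \<mu>(1)])
lemma r_less_1: "r < 1"
proof -
  have "r \<le> 1 * \<mu>" unfolding r by (rule mult_right_mono[OF m_le_1]) (use \<mu> in simp)
  then show ?thesis using \<mu>1 by simp
qed

text \<open>A finite product is continuous up to the unit circle and unimodular there. On the rest
  of the frontier of the region \<open>S\<close> one factor has modulus exactly
  \<open>\<mu>\<close>, and the cofactor is bounded below by \<open>holomorphic_lower_bound\<close>;
  the product of the two bounds is \<open>r\<close>.\<close>

lemma finite_blaschke_ge:
  assumes w: "cmod w < 1" and far: "\<And>k. k < N \<Longrightarrow> \<mu> \<le> rho w (z k)"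
  shows "r \<le> cmod (partial {..<N} w)"
proof -
  define P where "P x = (partial {..<N} x)" for x
  define S where "S = {x \<in> cball 0 1. \<forall>k<N. \<mu> \<le> cmod (blaschke_factor (z k) x)}"
  have P: "continuous_on (cball 0 1) P" unfolding P_def by (intro continuous_intros continuous_blaschke_factor z)
  have cb: "continuous_on (cball 0 1) (\<lambda>x. cmod (blaschke_factor (z k) x))" for k
    by (intro continuous_intros continuous_blaschke_factor z)
  have SI: "S = cball 0 1 \<inter> (\<Inter>k\<in>{..<N}. cball 0 1 \<inter> (\<lambda>x. cmod (blaschke_factor (z k) x)) -` {\<mu>..})"
    by (auto simp: S_def)
  have clS: "closed S" unfolding SI
    by (intro closed_Int closed_INT continuous_closed_preimage cb ballI) auto
  have Pnz: "P x \<noteq> 0" if "x \<in> S" for x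
    using that \<mu> by (force simp: P_def S_def)
  have "cmod (1 / P w) \<le> 1 / r"
  proof (rule maximum_modulus_frontier[of "\<lambda>x. 1 / P x" S])
    have "interior S \<subseteq> ball 0 1"
    proof -
      have "interior S \<subseteq> interior (cball 0 1)" by (rule interior_mono) (auto simp: S_def)
      then show ?thesis by simp
    qed
    then show "(\<lambda>x. 1 / P x) holomorphic_on interior S"
      using Pnz interior_subset[of S] unfolding P_def
      by (intro holomorphic_intros holomorphic_on_subset[OF holomorphic_finite_product]) auto
    show "continuous_on (closure S) (\<lambda>x. 1 / P x)"
      using clS Pnz by (intro continuous_intros continuous_on_subset[OF P]) (auto simp: S_def)
    show "bounded S" by (rule bounded_subset[of "cball 0 1"]) (auto simp: S_def)
    show "w \<in> S" using w far by (auto simp: S_def norm_blaschke_factor)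
    fix x assume xf: "x \<in> frontier S"
    then have xS: "x \<in> S" using clS frontier_subset_closed by blast
    have "r \<le> cmod (P x)"
    proof (cases "cmod x = 1")
      case True
      then have "cmod (P x) = 1"
        unfolding P_def prod_norm[symmetric] norm_blaschke_factor by (simp add: rho_eq_1 z)
      then show ?thesis using r_less_1 by simp
    next
      case False
      then have x1: "cmod x < 1" using xS by (auto simp: S_def)
      \<comment> \<open>Otherwise all defining inequalities would be strict at \<open>x\<close>,
        making it an interior point of \<open>S\<close>.\<close>
      have "\<exists>k<N. cmod (blaschke_factor (z k) x) \<le> \<mu>"
      proof (rule ccontr)
        assume "\<not> ?thesis"
        then have *: "\<forall>k<N. \<mu> < cmod (blaschke_factor (z k) x)" by auto
        let ?T = "ball 0 1 \<inter> (\<Inter>k\<in>{..<N}. {x \<in> ball 0 1. cmod (blaschke_factor (z k) x) \<in> {\<mu><..}})"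
        have "open {x \<in> ball 0 1. cmod (blaschke_factor (z k) x) \<in> {\<mu><..}}" for k
          using continuous_open_preimage[OF continuous_on_subset[OF cb ball_subset_cball] _ open_greaterThan[of \<mu>]]
          by (simp add: vimage_def Int_def)
        then have "open ?T" by (intro open_Int open_INT) auto
        moreover have "?T \<subseteq> S" by (auto simp: S_def less_imp_le)
        moreover have "x \<in> ?T" using * x1 by auto
        ultimately have "x \<in> interior S" using interior_maximal by blast
        then show False using xf by (simp add: frontier_def)
      qed
      then obtain k where k: "k < N" "cmod (blaschke_factor (z k) x) = \<mu>" using xS by (force simp: S_def)
      have "(\<delta> - \<mu>) / (1 - \<mu> * \<delta>) \<le> cmod (partial ({..<N} - {k}) x)"
        by (rule holomorphic_lower_bound[OF holomorphic_finite_product norm_finite_product_le x1 z finite_product_ge])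
           (use k \<mu>1 \<delta> \<delta>_le_1 in \<open>auto simp: norm_blaschke_factor\<close>)
      then have "r \<le> cmod (partial ({..<N} - {k}) x) * \<mu>"
        unfolding r by (rule mult_right_mono) (use \<mu> in simp)
      also have "\<dots> = cmod (P x)"
        using k by (simp add: P_def prod.remove[of "{..<N}" k] norm_mult mult.commute)
      finally show ?thesis .
    qed
    then show "cmod (1 / P x) \<le> 1 / r" using r_pos by (simp add: norm_divide frac_le)
  qed
  moreover have "P w \<noteq> 0" by (rule Pnz) (use w far in \<open>auto simp: S_def norm_blaschke_factor\<close>)
  ultimately show ?thesis using r_pos by (simp add: norm_divide P_def[symmetric] field_simps)
qed

lemma blaschke_small_near_zero:
  assumes w: "cmod w < 1" and B: "cmod (blaschke z w) < r"
  obtains n where "rho w (z n) < \<mu>"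
proof -
  have "\<exists>n. rho w (z n) < \<mu>"
  proof (rule ccontr)
    assume "\<not> ?thesis"
    then have "r \<le> cmod (partial ({..<N} - {}) w)" for N
      using finite_blaschke_ge[OF w, of N] by (simp add: not_less)
    then have "r \<le> cmod (omit {} w)"
      by (intro LIMSEQ_le_const[OF tendsto_norm[OF omit_lim[OF w]]]) auto
    then show False using B by (simp add: blaschke_eq_omit)
  qed
  then show thesis using that by blast
qed

text \<open>The coordinate \<open>\<nu>\<close> turns the factor of \<open>z n\<close> into the
  identity, so the Blaschke product becomes \<open>x * G x\<close> with \<open>G\<close> bounded
  below on the disc of radius \<open>\<mu>\<close>. The radius \<open>m * \<mu>\<close> of
  \<open>local_inverse\<close> is then \<open>r\<close>.\<close>

lemma inverse_branch:
  obtains h where "h holomorphic_on ball 0 r" and "h 0 = z n"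
    and "\<And>w. cmod w < r \<Longrightarrow> cmod (h w) < 1 \<and> blaschke z (h w) = w"
    and "\<And>x. cmod x < 1 \<Longrightarrow> rho x (z n) < \<mu> \<Longrightarrow> cmod (blaschke z x) < r \<Longrightarrow> h (blaschke z x) = x"
proof -
  define c where "c = phase (z n)"
  have c: "cmod c = 1" "c \<noteq> 0" using norm_phase[of "z n"] by (auto simp: c_def)
  define \<nu> where "\<nu> x = mob (z n) (x / c)" for x
  have rlt: "cmod (x / c) = cmod x" for x using c by (simp add: norm_divide)
  have \<nu>1: "cmod (\<nu> x) < 1" if "cmod x < 1" for x
    using rho_less_1[OF z, of "x / c" n] that rlt by (simp add: \<nu>_def norm_mob)
  have bf\<nu>: "blaschke_factor (z n) (\<nu> x) = x" if "cmod x < 1" for x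
    using mob_mob[OF z, of "x / c" n] that rlt c by (simp add: \<nu>_def blaschke_factor_eq c_def)
  have \<nu>bf: "\<nu> (blaschke_factor (z n) x) = x" if "cmod x < 1" for x
    using mob_mob[OF z that, of n] c by (simp add: \<nu>_def blaschke_factor_eq c_def)
  have \<nu>h: "\<nu> holomorphic_on ball 0 1"
  proof -
    have "(mob (z n) \<circ> (\<lambda>x. x / c)) holomorphic_on ball 0 1"
      by (rule holomorphic_on_compose_gen[OF _ holomorphic_mob[OF z]]) (use c rlt in \<open>auto intro!: holomorphic_intros\<close>)
    then show ?thesis by (simp add: \<nu>_def[abs_def] o_def)
  qed
  define G where "G x = omit {n} (\<nu> x)" for x
  have G: "G holomorphic_on ball 0 1"
  proof -
    have "(omit {n} \<circ> \<nu>) holomorphic_on ball 0 1"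
      by (rule holomorphic_on_compose_gen[OF \<nu>h holomorphic_omit]) (use \<nu>1 in auto)
    then show ?thesis by (simp add: G_def[abs_def] o_def)
  qed
  have rho\<nu>: "rho (\<nu> x) (z n) = cmod x" if "cmod x < 1" for x
    using bf\<nu>[OF that] norm_blaschke_factor by metis
  let ?m = "(\<delta> - \<mu>) / (1 - \<mu> * \<delta>)"
  have low: "?m \<le> cmod (G x)" if x: "cmod x \<le> \<mu>" for x
    unfolding G_def
    by (rule holomorphic_lower_bound[OF holomorphic_omit norm_omit_le \<nu>1 z omit_ge])
       (use x \<mu>1 \<delta> \<delta>_le_1 rho\<nu>[of x] in auto)
  have B\<nu>: "blaschke z (\<nu> x) = x * G x" if "cmod x < 1" for x
    using blaschke_split[OF \<nu>1[OF that], of n] bf\<nu>[OF that] by (simp add: G_def)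
  obtain k where k: "k holomorphic_on ball 0 (?m * \<mu>)"
    "\<And>w. cmod w < ?m * \<mu> \<Longrightarrow> cmod (k w) < \<mu> \<and> k w * G (k w) = w"
    "\<And>x. cmod x < \<mu> \<Longrightarrow> cmod (x * G x) < ?m * \<mu> \<Longrightarrow> k (x * G x) = x"
    using local_inverse[OF G \<mu>(1) \<mu>1 m_pos low] by blast
  note k = k[folded r]
  have k1: "cmod (k w) < 1" if "cmod w < r" for w using k(2)[OF that] \<mu>1 by simp
  show thesis
  proof (rule that[of "\<nu> \<circ> k"])
    show "(\<nu> \<circ> k) holomorphic_on ball 0 r"
      by (rule holomorphic_on_compose_gen[OF k(1) \<nu>h]) (use k1 in auto)
    have "k 0 = 0" using k(3)[of 0] \<mu> r_pos by simp
    then show "(\<nu> \<circ> k) 0 = z n" by (simp add: \<nu>_def mob_def)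
    show "cmod ((\<nu> \<circ> k) w) < 1 \<and> blaschke z ((\<nu> \<circ> k) w) = w" if w: "cmod w < r" for w
      using \<nu>1[OF k1[OF w]] B\<nu>[OF k1[OF w]] k(2)[OF w] by simp
    show "(\<nu> \<circ> k) (blaschke z x) = x" if x: "cmod x < 1" "rho x (z n) < \<mu>" "cmod (blaschke z x) < r" for x
    proof -
      define y where "y = blaschke_factor (z n) x"
      have y: "cmod y < \<mu>" "\<nu> y = x" using x(2) \<nu>bf[OF x(1)] by (auto simp: y_def norm_blaschke_factor)
      then have "blaschke z x = y * G y" using B\<nu>[of y] \<mu>1 by simp
      then show ?thesis using k(3)[of y] y x(3) by simp
    qed
  qed
qed

end

section \<open>Beurling functions for finite sequences\<close>

text \<open>On the circle, \<open>x - r\<close> and the reflected factor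
  \<open>1 - cnj r * x\<close> have equal modulus, and for \<open>r\<close> inside the disc the
  latter has no zero in the closed disc. This is the outer function for the boundary modulus of a
  polynomial.\<close>

lemma reflect_inner_roots:
  fixes p :: "complex poly"
  assumes nz: "\<And>x. cmod x = 1 \<Longrightarrow> poly p x \<noteq> 0"
  shows "\<exists>Q. Q holomorphic_on UNIV \<and> (\<forall>x. cmod x \<le> 1 \<longrightarrow> Q x \<noteq> 0) \<and>
    (\<forall>x. cmod x = 1 \<longrightarrow> cmod (Q x) = cmod (poly p x))"
proof -
  define f where "f r x = (if cmod r < 1 then 1 - cnj r * x else x - r)" for r x :: complex
  define Q where "Q x = lead_coeff p * (\<Prod>r | poly p r = 0. f r x ^ order r p)" for x
  have p0: "p \<noteq> 0" using nz[of 1] by auto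
  show ?thesis
  proof (intro exI[of _ Q] conjI allI impI)
    have "f r holomorphic_on UNIV" for r
      by (cases "cmod r < 1") (auto simp: f_def[abs_def] intro!: holomorphic_intros)
    then show "Q holomorphic_on UNIV" unfolding Q_def by (intro holomorphic_intros)
    show "Q x \<noteq> 0" if x: "cmod x \<le> 1" for x
    proof -
      have "f r x \<noteq> 0" if "poly p r = 0" for r
        using nz[of r] that x one_minus_cnj_mult_nz[of r x] by (auto simp: f_def not_less order_le_less)
      then show ?thesis using p0 poly_roots_finite[OF p0] by (simp add: Q_def)
    qed
    show "cmod (Q x) = cmod (poly p x)" if x: "cmod x = 1" for x
    proof -
      have "cmod (f r x) = cmod (x - r)" for r
      proof (cases "cmod r < 1")
        case True
        then show ?thesis using cmod_diff_sq[of r x] x by (simp add: f_def)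
      qed (simp add: f_def)
      then have "cmod (Q x) = cmod (poly (smult (lead_coeff p) (\<Prod>r | poly p r = 0. [:- r, 1:] ^ order r p)) x)"
        by (simp add: Q_def poly_prod norm_mult prod_norm[symmetric] norm_power norm_minus_commute)
      then show ?thesis by (simp only: complex_poly_decompose)
    qed
  qed
qed

text \<open>On the circle \<open>cnj s\<close> is the inverse of \<open>s\<close>, so the product
  has the phase of \<open>s\<close> whatever \<open>a\<close> is.\<close>

lemma circle_factor:
  assumes "cmod s = 1"
  shows "(s - a) * (1 - cnj a * s) = s * of_real ((cmod (s - a))\<^sup>2)"
proof -
  have "s * cnj s = 1" using assms complex_norm_square[of s] by simp
  then have "1 - cnj a * s = s * cnj (s - a)" by (simp add: algebra_simps)
  then show ?thesis using complex_norm_square[of "s - a"] by (simp add: mult_ac)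
qed

text \<open>Cauchy's formula at \<open>a\<close> for the function
  \<open>1 / (1 - cnj a * s)\<close>; \<open>circle_factor\<close> identifies the integrand.\<close>

lemma poisson_integral:
  assumes a: "cmod a < 1"
  shows "integral {0..1} (\<lambda>t. 1 / (cmod (circlepath 0 1 t - a))\<^sup>2) = 1 / (1 - (cmod a)\<^sup>2)"
proof -
  let ?c = "circlepath 0 1"
  let ?I = "integral {0..1} (\<lambda>t. 1 / (cmod (?c t - a))\<^sup>2)"
  have c1: "cmod (?c t) = 1" for t by (simp add: norm_circlepath)
  have ne: "?c t - a \<noteq> 0" for t using c1[of t] a by auto
  have ca: "1 - cnj a * a = of_real (1 - (cmod a)\<^sup>2)" using complex_norm_square[of a] by (simp add: mult.commute)
  have "contour_integral ?c (\<lambda>s. (1 / (1 - cnj a * s)) / (s - a)) = 2 * of_real pi * \<i> * (1 / (1 - cnj a * a))"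
  proof (rule contour_integral_unique, rule Cauchy_integral_circlepath_simple)
    show "(\<lambda>s. 1 / (1 - cnj a * s)) holomorphic_on cball 0 1"
      using one_minus_cnj_mult_nz[OF a] by (intro holomorphic_intros) auto
  qed (use a in simp)
  moreover have "contour_integral ?c (\<lambda>s. (1 / (1 - cnj a * s)) / (s - a)) =
      integral {0..1} (\<lambda>t. 2 * of_real pi * \<i> * of_real (1 / (cmod (?c t - a))\<^sup>2))"
    unfolding contour_integral_integral
  proof (rule integral_cong)
    fix t :: real
    have "?c t \<noteq> 0" using c1[of t] by auto
    have "1 / (1 - cnj a * ?c t) / (?c t - a) * vector_derivative ?c (at t) =
        2 * of_real pi * \<i> * (?c t / ((?c t - a) * (1 - cnj a * ?c t)))"
      by (simp add: deriv_circlepath)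
    also have "?c t / ((?c t - a) * (1 - cnj a * ?c t)) = of_real (1 / (cmod (?c t - a))\<^sup>2)"
      unfolding circle_factor[OF c1] using \<open>?c t \<noteq> 0\<close> by simp
    finally show "1 / (1 - cnj a * ?c t) / (?c t - a) * vector_derivative ?c (at t) =
        2 * of_real pi * \<i> * of_real (1 / (cmod (?c t - a))\<^sup>2)" .
  qed
  moreover have "integral {0..1} (\<lambda>t. 2 * of_real pi * \<i> * complex_of_real (1 / (cmod (?c t - a))\<^sup>2)) =
      2 * of_real pi * \<i> * of_real ?I"
  proof -
    have "(\<lambda>t. 1 / (cmod (?c t - a))\<^sup>2) integrable_on {0..1}"
      using ne by (intro integrable_continuous_real continuous_intros continuous_circlepath) auto
    from integral_linear[OF this bounded_linear_of_real[where 'a=complex]] show ?thesis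
      by (simp only: o_def integral_mult_right)
  qed
  ultimately have "2 * of_real pi * \<i> * of_real ?I = 2 * of_real pi * \<i> * (1 / (1 - cnj a * a))"
    by metis
  then have "complex_of_real ?I = 1 / (1 - cnj a * a)"
    by (simp only: mult_cancel_left) simp
  then have "complex_of_real ?I = of_real (1 / (1 - (cmod a)\<^sup>2))"
    unfolding ca by simp
  then show ?thesis by (simp only: of_real_eq_iff)
qed

text \<open>Interpolants live on a disc beyond the closed unit disc, so that residues can be summed
  along the unit circle; its radius may depend on the data.\<close>

locale finite_interpolation =
  fixes a :: "nat \<Rightarrow> complex" and n :: nat and M :: real
  assumes a: "\<And>j. j < n \<Longrightarrow> cmod (a j) < 1" and inj: "inj_on a {..<n}" and M: "0 < M"
    and interp: "\<And>b :: nat \<Rightarrow> complex. (\<And>j. cmod (b j) \<le> 1) \<Longrightarrow> \<exists>g \<rho>. 1 < \<rho> \<and> g holomorphic_on ball 0 \<rho> \<and>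
      (\<forall>x\<in>ball 0 \<rho>. cmod (g x) \<le> M) \<and> (\<forall>j<n. g (a j) = b j)"
begin

text \<open>Numerators of the Beurling functions. The reflected factors give every
  \<open>q j\<close> the same phase \<open>x ^ (n - 1)\<close> on the circle, so that in positive
  combinations the moduli add without cancellation.\<close>

definition q :: "nat \<Rightarrow> complex poly" where
  "q j = (\<Prod>k\<in>{..<n} - {j}. [:- a k, 1:] * [:1, - cnj (a k):])"

definition P :: "(nat \<Rightarrow> real) \<Rightarrow> complex poly" where
  "P l = (\<Sum>j<n. smult (of_real (l j)) (q j))"

definition D :: "nat \<Rightarrow> complex \<Rightarrow> real" where
  "D j x = (\<Prod>k\<in>{..<n} - {j}. (cmod (x - a k))\<^sup>2)"

lemma poly_q: "poly (q j) x = (\<Prod>k\<in>{..<n} - {j}. (x - a k) * (1 - cnj (a k) * x))"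
  unfolding q_def poly_prod poly_mult by (rule prod.cong) (simp_all add: mult.commute)

lemma D_pos: "cmod x = 1 \<Longrightarrow> 0 < D j x"
  unfolding D_def using a by (intro prod_pos) fastforce

lemma poly_q_circle:
  assumes "cmod x = 1" "j < n"
  shows "poly (q j) x = x ^ (n - 1) * of_real (D j x)"
  using assms by (simp add: poly_q circle_factor prod.distrib D_def)

lemma norm_poly_q: "cmod x = 1 \<Longrightarrow> j < n \<Longrightarrow> cmod (poly (q j) x) = D j x"
  using D_pos[of x j] by (simp add: poly_q_circle norm_mult norm_power)

lemma norm_P:
  assumes l: "\<forall>j<n. 0 < l j" and x: "cmod x = 1"
  shows "cmod (poly (P l) x) = (\<Sum>j<n. l j * D j x)"
proof -
  have "poly (P l) x = (\<Sum>j<n. of_real (l j) * (x ^ (n - 1) * of_real (D j x)))"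
    using x by (simp add: P_def poly_sum poly_q_circle)
  also have "\<dots> = x ^ (n - 1) * of_real (\<Sum>j<n. l j * D j x)"
    by (simp add: sum_distrib_left mult_ac)
  finally have "cmod (poly (P l) x) = \<bar>\<Sum>j<n. l j * D j x\<bar>"
    using x by (simp only: norm_mult norm_power norm_of_real) simp
  moreover have "0 \<le> (\<Sum>j<n. l j * D j x)"
    using l D_pos[OF x] by (intro sum_nonneg mult_nonneg_nonneg) (auto simp: less_imp_le)
  ultimately show ?thesis by simp
qed

lemma poly_q_nz: "j < n \<Longrightarrow> poly (q j) (a j) \<noteq> 0"
  using a inj one_minus_cnj_mult_nz[of "a k" "a j" for k]
  by (auto simp: poly_q inj_on_def less_imp_le)

lemma poly_q_zero: "j < n \<Longrightarrow> k < n \<Longrightarrow> k \<noteq> j \<Longrightarrow> poly (q j) (a k) = 0"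
  by (auto simp: poly_q)

end

locale finite_interpolation_nonempty = finite_interpolation +
  assumes n: "0 < n"
begin

lemma sum_D_pos:
  assumes l: "\<forall>j<n. 0 < l j" and x: "cmod x = 1"
  shows "0 < (\<Sum>j<n. l j * D j x)"
  using l D_pos[OF x] n by (intro sum_pos mult_pos_pos) auto

text \<open>Outer function with the boundary modulus of \<open>P l\<close>. The choice is harmless:
  two candidates have the same modulus on the closed disc.\<close>

definition Q :: "(nat \<Rightarrow> real) \<Rightarrow> complex \<Rightarrow> complex" where
  "Q l = (SOME Q. Q holomorphic_on UNIV \<and> (\<forall>x. cmod x \<le> 1 \<longrightarrow> Q x \<noteq> 0) \<and> (\<forall>x. cmod x = 1 \<longrightarrow> cmod (Q x) = (\<Sum>j<n. l j * D j x)))"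

lemma Q:
  assumes l: "\<forall>j<n. 0 < l j"
  shows "Q l holomorphic_on UNIV" "\<And>x. cmod x \<le> 1 \<Longrightarrow> Q l x \<noteq> 0"
    "\<And>x. cmod x = 1 \<Longrightarrow> cmod (Q l x) = (\<Sum>j<n. l j * D j x)"
proof -
  have nP: "cmod (poly (P l) x) = (\<Sum>j<n. l j * D j x)" "poly (P l) x \<noteq> 0" if "cmod x = 1" for x
    using norm_P[OF l that] sum_D_pos[OF l that] by auto
  obtain Q' where "Q' holomorphic_on UNIV \<and> (\<forall>x. cmod x \<le> 1 \<longrightarrow> Q' x \<noteq> 0) \<and>
    (\<forall>x. cmod x = 1 \<longrightarrow> cmod (Q' x) = cmod (poly (P l) x))"
    using reflect_inner_roots[OF nP(2)] by blast
  then have "\<exists>Q. Q holomorphic_on UNIV \<and> (\<forall>x. cmod x \<le> 1 \<longrightarrow> Q x \<noteq> 0) \<and> (\<forall>x. cmod x = 1 \<longrightarrow> cmod (Q x) = (\<Sum>j<n. l j * D j x))"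
    using nP(1) by (intro exI[of _ Q']) auto
  then have "Q l holomorphic_on UNIV \<and> (\<forall>x. cmod x \<le> 1 \<longrightarrow> Q l x \<noteq> 0) \<and> (\<forall>x. cmod x = 1 \<longrightarrow> cmod (Q l x) = (\<Sum>j<n. l j * D j x))"
    unfolding Q_def by (rule someI_ex)
  then show "Q l holomorphic_on UNIV" "\<And>x. cmod x \<le> 1 \<Longrightarrow> Q l x \<noteq> 0"
    "\<And>x. cmod x = 1 \<Longrightarrow> cmod (Q l x) = (\<Sum>j<n. l j * D j x)" by auto
qed

lemma norm_le_on_disc:
  assumes f: "f holomorphic_on UNIV" and le: "\<And>x. cmod x = 1 \<Longrightarrow> cmod (f x) \<le> B * cmod (g x)"
    and g: "g holomorphic_on UNIV" and nz: "\<And>x. cmod x \<le> 1 \<Longrightarrow> g x \<noteq> 0" and x: "cmod x \<le> 1"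
  shows "cmod (f x) \<le> B * cmod (g x)"
proof -
  have "cmod (f x / g x) \<le> B"
  proof (rule maximum_modulus_frontier[of "\<lambda>x. f x / g x" "cball 0 1"])
    show "(\<lambda>x. f x / g x) holomorphic_on interior (cball 0 1)"
      using nz by (intro holomorphic_intros holomorphic_on_subset[OF f] holomorphic_on_subset[OF g]) auto
    show "continuous_on (closure (cball 0 1)) (\<lambda>x. f x / g x)"
      using nz by (intro continuous_intros holomorphic_on_imp_continuous_on holomorphic_on_subset[OF f] holomorphic_on_subset[OF g]) auto
    show "cmod (f y / g y) \<le> B" if "y \<in> frontier (cball 0 1)" for y
      using le[of y] nz[of y] that by (simp add: norm_divide divide_le_eq)
  qed (use x in auto)
  then show ?thesis using nz[OF x] by (simp add: norm_divide divide_le_eq)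
qed

text \<open>The order is clear on the circle and passes inside because \<open>Q m\<close> has no
  zeros. It makes the nonlinear operator \<open>T\<close> monotone.\<close>

lemma Q_mono:
  assumes l: "\<forall>j<n. 0 < l j" and m: "\<forall>j<n. l j \<le> m j" and x: "cmod x \<le> 1"
  shows "cmod (Q l x) \<le> cmod (Q m x)"
proof -
  have m0: "\<forall>j<n. 0 < m j" using l m less_le_trans by blast
  have "cmod (Q l x) \<le> 1 * cmod (Q m x)"
  proof (rule norm_le_on_disc[OF Q(1) _ Q(1) Q(2) x])
    show "cmod (Q l y) \<le> 1 * cmod (Q m y)" if "cmod y = 1" for y
      unfolding Q(3)[OF l that] Q(3)[OF m0 that] mult_1
      using D_pos[OF that] m by (intro sum_mono mult_right_mono less_imp_le[OF D_pos[OF that]]) auto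
  qed (use l m0 in auto)
  then show ?thesis by simp
qed

text \<open>Modulus of the coefficient that normalises \<open>q j / Q l\<close> to 1 at
  \<open>a j\<close>. If \<open>T l j \<le> M2 * l j\<close> for all \<open>j\<close>, the
  normalised functions have moduli summing to at most \<open>M2\<close> on the circle.\<close>

definition T :: "(nat \<Rightarrow> real) \<Rightarrow> nat \<Rightarrow> real" where
  "T l j = cmod (Q l (a j)) / cmod (poly (q j) (a j))"

text \<open>The mean over the circle of the inverse squared distance to \<open>a j\<close>, by
  \<open>poisson_integral\<close>; also the factor that appears in the residue at
  \<open>a j\<close>.\<close>

definition w :: "nat \<Rightarrow> real" where
  "w j = 1 / (1 - (cmod (a j))\<^sup>2)"

lemma w_ge_1: "j < n \<Longrightarrow> 1 \<le> w j"
  using a[of j] by (simp add: w_def abs_square_less_1)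

text \<open>Interpolate unimodular data \<open>b\<close> that make the residues of \<open>g Q / \<Prod>(s - a\<^sub>k)(1 - cnj a\<^sub>k s)\<close> positive, and
  compare with the integral over the circle, where \<open>|Q| / \<Prod>|s - a\<^sub>k|\<^sup>2 = \<Sum> l\<^sub>j / |s - a\<^sub>j|\<^sup>2\<close>.\<close>
lemma sum_T_le:
  assumes l: "\<forall>j<n. 0 < l j"
  shows "(\<Sum>j<n. T l j * w j) \<le> M * (\<Sum>j<n. l j * w j)"
proof -
  let ?c = "circlepath 0 1"
  have c1: "cmod (?c t) = 1" for t by (simp add: norm_circlepath)
  note Ql = Q[OF l]
  define v where "v j = Q l (a j) / poly (q j) (a j)" for j
  define b where "b j = (if j < n then cnj (v j) / of_real (cmod (v j)) else 0)" for j
  have vb: "b j * v j = of_real (T l j)" if "j < n" for j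
  proof -
    have "v j \<noteq> 0" using Ql(2)[of "a j"] poly_q_nz a that by (auto simp: v_def less_imp_le)
    then have "b j * v j = of_real (cmod (v j))"
      using complex_norm_square[of "v j"] that by (simp add: b_def power2_eq_square divide_eq_eq mult.commute)
    then show ?thesis by (simp add: T_def v_def norm_divide)
  qed
  have "cmod (b j) \<le> 1" for j by (auto simp: b_def norm_divide)
  then obtain g \<rho> where g: "1 < \<rho>" "g holomorphic_on ball 0 \<rho>" "\<And>x. x \<in> ball 0 \<rho> \<Longrightarrow> cmod (g x) \<le> M"
    "\<And>j. j < n \<Longrightarrow> g (a j) = b j" using interp[of b] by blast
  \<comment> \<open>The entry \<open>1/2\<close> keeps \<open>m\<close> positive even if 0 is the
    only node, so that \<open>1 / m\<close> makes sense.\<close>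
  define m where "m = Max (insert (1/2) ((\<lambda>j. cmod (a j)) ` {..<n}))"
  have m: "0 < m" "m < 1" "\<And>j. j < n \<Longrightarrow> cmod (a j) \<le> m"
  proof -
    have "1 / 2 \<le> m" unfolding m_def by (rule Max_ge) auto
    then show "0 < m" by simp
    show "m < 1" unfolding m_def using a by (subst Max_less_iff) auto
    show "cmod (a j) \<le> m" if "j < n" for j unfolding m_def by (rule Max_ge) (use that in auto)
  qed
  \<comment> \<open>A disc larger than the closed unit disc on which \<open>g\<close> is holomorphic
    and no factor \<open>1 - cnj (a j) * s\<close> vanishes, so the nodes are the only possible
    poles.\<close>
  define S where "S = ball (0::complex) (min \<rho> (1 / m))"
  have S: "open S" "connected S" "cball 0 1 \<subseteq> S" "S \<subseteq> ball 0 \<rho>"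
  proof -
    have "1 < min \<rho> (1 / m)" using g(1) m by simp
    then show "cball 0 1 \<subseteq> S" unfolding S_def by (simp only: cball_subset_ball_iff) simp
  qed (auto simp: S_def)
  have nz: "1 - cnj (a j) * s \<noteq> 0" if "j < n" "s \<in> S" for j s
  proof
    assume "1 - cnj (a j) * s = 0"
    then have "cmod (a j) * cmod s = 1" by (metis complex_mod_cnj norm_mult norm_one right_minus_eq)
    moreover have "cmod (a j) * cmod s \<le> m * cmod s" using m(3)[OF that(1)] by (rule mult_right_mono) simp
    moreover have "m * cmod s < 1" using that(2) m by (simp add: S_def field_simps)
    ultimately show False by simp
  qed
  define f where "f s = g s * Q l s / (\<Prod>k<n. (s - a k) * (1 - cnj (a k) * s))" for s
  define F where "F j s = g s * Q l s / ((1 - cnj (a j) * s) * poly (q j) s)" for j s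
  have fF: "f = (\<lambda>s. F j s / (s - a j))" if "j < n" for j
    using that by (auto simp: fun_eq_iff f_def F_def poly_q prod.remove[of "{..<n}" j] mult_ac)
  have gS: "g holomorphic_on S" using g(2) S(4) holomorphic_on_subset by blast
  have QS: "Q l holomorphic_on X" for X using Ql(1) holomorphic_on_subset by blast
  have f_hol: "f holomorphic_on S - a ` {..<n}"
    unfolding f_def using nz
    by (intro holomorphic_intros QS holomorphic_on_subset[OF gS]) (auto simp: prod_zero_iff)
  have aS: "a j \<in> ball 0 1" if "j < n" for j using a that by auto
  have res: "residue f (a j) = of_real (T l j * w j)" if j: "j < n" for j
  proof -
    let ?S = "S - a ` ({..<n} - {j})"
    have "residue (\<lambda>s. F j s / (s - a j)) (a j) = F j (a j)"
    proof (rule residue_simple)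
      show "open ?S" using S(1) by (intro open_Diff finite_imp_closed) auto
      show "a j \<in> ?S" using S(3) aS[OF j] inj j by (auto simp: inj_on_def)
      show "F j holomorphic_on ?S"
        unfolding F_def poly_q using nz j
        by (intro holomorphic_intros QS holomorphic_on_subset[OF gS]) (auto simp: prod_zero_iff)
    qed
    also have "F j (a j) = b j * v j / (1 - cnj (a j) * a j)" using g(4)[OF j] by (simp add: F_def v_def)
    also have "1 - cnj (a j) * a j = of_real (1 - (cmod (a j))\<^sup>2)"
      using complex_norm_square[of "a j"] by (simp add: mult.commute)
    finally show ?thesis using fF[OF j] vb[OF j] by (simp add: w_def)
  qed
  have "contour_integral ?c f = 2 * pi * \<i> * (\<Sum>p\<in>a ` {..<n}. winding_number ?c p * residue f p)"
  proof (rule Residue_theorem[OF S(1,2) _ f_hol])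
    show "path_image ?c \<subseteq> S - a ` {..<n}"
      using S(3) aS by (fastforce simp: path_image_circlepath)
    show "\<forall>x. x \<notin> S \<longrightarrow> winding_number ?c x = 0"
      using S(3) by (intro allI impI winding_number_zero_outside[of _ "cball 0 1"]) auto
  qed auto
  also have "(\<Sum>p\<in>a ` {..<n}. winding_number ?c p * residue f p) = (\<Sum>j<n. residue f (a j))"
    using aS by (subst sum.reindex[OF inj]) (auto intro!: sum.cong simp: winding_number_circlepath)
  also have "\<dots> = of_real (\<Sum>j<n. T l j * w j)" by (simp add: res)
  finally have eq: "contour_integral ?c f = 2 * pi * \<i> * of_real (\<Sum>j<n. T l j * w j)" .
  have T0: "0 \<le> (\<Sum>j<n. T l j * w j)" by (intro sum_nonneg mult_nonneg_nonneg) (auto simp: T_def intro: order_trans[OF zero_le_one w_ge_1])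
  have ne: "?c t - a j \<noteq> 0" if "j < n" for t j using c1[of t] a[OF that] by auto
  have cont: "continuous_on {0..1} (\<lambda>t. f (?c t) * vector_derivative ?c (at t))"
  proof -
    have "continuous_on (sphere 0 1) f"
      by (rule holomorphic_on_imp_continuous_on[OF holomorphic_on_subset[OF f_hol]]) (use S(3) aS in fastforce)
    then have "continuous_on {0..1} (\<lambda>t. f (?c t))"
      by (rule continuous_on_compose2[OF _ continuous_circlepath]) (use c1 in auto)
    then show ?thesis unfolding deriv_circlepath by (intro continuous_intros continuous_circlepath)
  qed
  let ?h = "\<lambda>t. \<Sum>j<n. l j * (1 / (cmod (?c t - a j))\<^sup>2)"
  have ci: "(\<lambda>t. 1 / (cmod (?c t - a j))\<^sup>2) integrable_on {0..1}" if "j < n" for j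
    using ne[OF that] by (intro integrable_continuous_real continuous_intros continuous_circlepath) auto
  have ci': "(\<lambda>t. l j * (1 / (cmod (?c t - a j))\<^sup>2)) integrable_on {0..1}" if "j < n" for j
    using integrable_on_cmult_left[OF ci[OF that], of "l j"] by simp
  have cis: "(\<lambda>t. ?h t) integrable_on {0..1}"
    by (rule integrable_sum) (use ci' in auto)
  have "norm (contour_integral ?c f) \<le> integral {0..1} (\<lambda>t. (2 * pi * M) * (?h t))"
    unfolding contour_integral_integral
  proof (rule integral_norm_bound_integral)
    show "(\<lambda>t. f (?c t) * vector_derivative ?c (at t)) integrable_on {0..1}"
      by (rule integrable_continuous_real[OF cont])
    show "(\<lambda>t. (2 * pi * M) * (?h t)) integrable_on {0..1}"
      using integrable_on_cmult_left[OF cis, of "2 * pi * M"] by simp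
    fix t :: real
    let ?s = "?c t"
    let ?E = "\<Prod>k<n. (cmod (?s - a k))\<^sup>2"
    have E0: "0 < ?E" using ne by (intro prod_pos) auto
    have "cmod (\<Prod>k<n. (?s - a k) * (1 - cnj (a k) * ?s)) = ?E"
      by (simp add: circle_factor[OF c1] prod_norm[symmetric] norm_mult norm_power c1)
    then have "cmod (f ?s) = cmod (g ?s) * (cmod (Q l ?s) / ?E)" by (simp add: f_def norm_mult norm_divide)
    also have "cmod (Q l ?s) / ?E = ?h t"
      unfolding Ql(3)[OF c1] sum_divide_distrib
    proof (rule sum.cong)
      fix j assume "j \<in> {..<n}"
      then have "?E = (cmod (?s - a j))\<^sup>2 * D j ?s" by (simp add: D_def prod.remove[of "{..<n}" j])
      then show "l j * D j ?s / ?E = l j * (1 / (cmod (?s - a j))\<^sup>2)"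
        using D_pos[OF c1, of j t] by simp
    qed simp
    also have "cmod (g ?s) * \<dots> \<le> M * \<dots>"
      using g(3)[of ?s] g(1) c1[of t] l by (intro mult_right_mono sum_nonneg) (auto simp: less_imp_le)
    finally have "cmod (f ?s) \<le> M * ?h t" .
    then have "2 * pi * cmod (f ?s) \<le> 2 * pi * (M * ?h t)"
      by (rule mult_left_mono) simp
    then show "norm (f ?s * vector_derivative ?c (at t)) \<le> (2 * pi * M) * ?h t"
      unfolding deriv_circlepath norm_mult c1 by (simp add: mult_ac)
  qed
  also have "\<dots> = (2 * pi * M) * (\<Sum>j<n. l j * integral {0..1} (\<lambda>t. 1 / (cmod (?c t - a j))\<^sup>2))"
  proof -
    have "integral {0..1} (\<lambda>t. ?h t) =
        (\<Sum>j<n. integral {0..1} (\<lambda>t. l j * (1 / (cmod (?c t - a j))\<^sup>2)))"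
      by (rule integral_sum) (use ci' in auto)
    then show ?thesis by (simp only: integral_mult_right)
  qed
  also have "\<dots> = 2 * pi * (M * (\<Sum>j<n. l j * w j))" using a by (simp add: poisson_integral w_def)
  finally have "2 * pi * (\<Sum>j<n. T l j * w j) \<le> 2 * pi * (M * (\<Sum>j<n. l j * w j))"
    unfolding eq norm_mult norm_of_real using T0 by simp
  then show ?thesis by simp
qed

text \<open>\<open>T\<close> is monotone and multiplies the \<open>w\<close>-weighted sum by at most \<open>M\<close>. Hence for \<open>M1 > M\<close> the increasing
  iterates of \<open>l \<mapsto> T l / M1 + 1\<close> stay bounded, and a late iterate is almost a fixed point.\<close>
lemma subeigenvector:
  assumes M2: "M < M2"
  obtains l where "\<forall>j<n. 0 < l j" and "\<forall>j<n. T l j \<le> M2 * l j"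
proof -
  define M1 where "M1 = (M + M2) / 2"
  have M1: "M < M1" "M1 < M2" "0 < M1" using M M2 by (auto simp: M1_def)
  \<comment> \<open>\<open>M1 > M\<close> keeps the iteration bounded; the rest of the slack, up to
    \<open>M2\<close>, pays for stopping when one step increases the weighted sum by less than
    \<open>e\<close>.\<close>
  define e where "e = M2 / M1 - 1"
  have e: "0 < e" "M1 * (1 + e) = M2" using M1 by (auto simp: e_def field_simps)
  \<comment> \<open>The added 1 keeps all weights at least 1, so an increase by \<open>e\<close> is
    at most a factor \<open>1 + e\<close>.\<close>
  define L where "L i = ((\<lambda>l j. T l j / M1 + 1) ^^ i) (\<lambda>_. 1)" for i
  have L0: "L 0 j = 1" and LS: "L (Suc i) j = T (L i) j / M1 + 1" for i j by (simp_all add: L_def)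
  have L1: "1 \<le> L i j" for i j
    using M1 by (cases i) (auto simp: L0 LS T_def)
  then have Lp: "\<forall>j<n. 0 < L i j" for i using less_le_trans[OF zero_less_one] by blast
  have inc: "L i j \<le> L (Suc i) j" if "j < n" for i j
    using that
  proof (induction i arbitrary: j)
    case (Suc i)
    have "T (L i) j \<le> T (L (Suc i)) j"
      unfolding T_def using Suc a Lp by (intro divide_right_mono Q_mono) (auto simp: less_imp_le)
    then show ?case using M1 by (simp add: LS[of i] LS[of "Suc i"] divide_right_mono)
  qed (use L1 in \<open>simp add: L0\<close>)
  define s where "s i = (\<Sum>j<n. L i j * w j)" for i
  define W where "W = (\<Sum>j<n. w j)"
  have w0: "0 \<le> w j" if "j < n" for j using w_ge_1[OF that] by simp
  have W0: "0 \<le> W" unfolding W_def using w0 by (intro sum_nonneg) auto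
  have step: "s (Suc i) \<le> M / M1 * s i + W" for i
  proof -
    have "s (Suc i) = (\<Sum>j<n. T (L i) j * w j) / M1 + W"
      by (simp add: s_def LS W_def sum.distrib sum_divide_distrib distrib_right)
    also have "\<dots> \<le> M * s i / M1 + W"
      using sum_T_le[OF Lp] M1 by (simp add: s_def divide_right_mono)
    finally show ?thesis by simp
  qed
  have bound: "s i \<le> W * M1 / (M1 - M)" for i
  proof (induction i)
    case 0
    have "W * 1 \<le> W * (M1 / (M1 - M))" using W0 M1 M by (intro mult_left_mono) (auto simp: field_simps)
    then show ?case by (simp add: s_def L0 W_def)
  next
    case (Suc i)
    have "s (Suc i) \<le> M / M1 * (W * M1 / (M1 - M)) + W"
      using step[of i] mult_left_mono[OF Suc, of "M / M1"] M M1 by auto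
    also have "\<dots> = W * M1 / (M1 - M)" using M1 by (simp add: field_simps)
    finally show ?case .
  qed
  have "incseq s"
    unfolding s_def by (intro incseq_SucI sum_mono mult_right_mono) (use inc w0 in auto)
  then obtain S where S: "s \<longlonglongrightarrow> S" using incseq_convergent[of s] bound by blast
  then have "(\<lambda>i. s (Suc i) - s i) \<longlonglongrightarrow> S - S" by (intro tendsto_intros) (simp add: LIMSEQ_Suc)
  then have "\<forall>\<^sub>F i in sequentially. s (Suc i) - s i < e" using e by (intro order_tendstoD) auto
  then obtain i where i: "s (Suc i) - s i < e" by (auto simp: eventually_sequentially)
  have "T (L i) j \<le> M2 * L i j" if j: "j < n" for j
  proof -
    \<comment> \<open>As \<open>w j\<close> is at least 1 and all increments are nonnegative, a
      small increase of the weighted sum bounds every component.\<close>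
    have "L (Suc i) j - L i j \<le> (L (Suc i) j - L i j) * w j"
      using mult_left_mono[OF w_ge_1[OF j], of "L (Suc i) j - L i j"] inc[OF j, of i] by simp
    also have "\<dots> \<le> (\<Sum>j<n. (L (Suc i) j - L i j) * w j)"
      by (rule member_le_sum) (use j inc w0 in auto)
    also have "\<dots> = s (Suc i) - s i" by (simp add: s_def sum_subtractf left_diff_distrib)
    finally have "L (Suc i) j \<le> L i j + e * 1" using i by simp
    also have "\<dots> \<le> L i j + e * L i j" using L1[of i j] e by (intro add_left_mono mult_left_mono) auto
    finally have "M1 * (L (Suc i) j - 1) \<le> M1 * ((1 + e) * L i j)"
      using M1 by (intro mult_left_mono) (auto simp: algebra_simps)
    then show ?thesis using M1 e by (simp add: LS mult.assoc[symmetric])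
  qed
  then show thesis using that[OF Lp] by blast
qed

text \<open>With the weights of \<open>subeigenvector\<close>, the normalised quotients
  \<open>q j / Q l\<close> work; on the circle both sides are combinations of the same positive
  \<open>D j\<close>, compared coefficient by coefficient.\<close>

theorem beurling_functions:
  assumes M2: "M < M2"
  shows "\<exists>f. (\<forall>j<n. f j holomorphic_on ball 0 1) \<and> (\<forall>j<n. \<forall>k<n. f j (a k) = (if j = k then 1 else 0)) \<and>
    (\<forall>x. cmod x < 1 \<longrightarrow> (\<Sum>j<n. cmod (f j x)) \<le> M2)"
proof -
  obtain l where l: "\<forall>j<n. 0 < l j" and T: "\<forall>j<n. T l j \<le> M2 * l j"
    using subeigenvector[OF M2] by blast
  note Ql = Q[OF l]
  define c where "c j = Q l (a j) / poly (q j) (a j)" for j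
  have cT: "cmod (c j) = T l j" for j by (simp add: c_def T_def norm_divide)
  define f where "f j x = c j * poly (q j) x / Q l x" for j x
  have 1: "f j holomorphic_on ball 0 1" for j
    unfolding f_def using Ql(2) by (intro holomorphic_intros holomorphic_on_subset[OF Ql(1)]) auto
  have 2: "f j (a k) = (if j = k then 1 else 0)" if "j < n" "k < n" for j k
    using that poly_q_zero[of j k] poly_q_nz[of k] Ql(2)[of "a k"] a[of k] by (auto simp: f_def c_def)
  have 3: "(\<Sum>j<n. cmod (f j x)) \<le> M2" if x: "cmod x < 1" for x
  proof -
    \<comment> \<open>A sum of moduli is not holomorphic. Phases frozen at \<open>x\<close> give a
      holomorphic combination that equals the sum at \<open>x\<close> and obeys the boundary
      estimate.\<close>
    define \<theta> where "\<theta> j = (if f j x = 0 then 0 else cnj (f j x) / of_real (cmod (f j x)))" for j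
    have \<theta>: "cmod (\<theta> j) \<le> 1" "\<theta> j * f j x = of_real (cmod (f j x))" for j
      using complex_norm_square[of "f j x"]
      by (auto simp: \<theta>_def norm_divide power2_eq_square divide_eq_eq mult.commute)
    define u where "u y = (\<Sum>j<n. \<theta> j * (c j * poly (q j) y))" for y
    have "cmod (u x) \<le> M2 * cmod (Q l x)"
    proof (rule norm_le_on_disc[OF _ _ Ql(1) Ql(2)])
      show "u holomorphic_on UNIV" unfolding u_def by (intro holomorphic_intros)
      fix y :: complex assume y: "cmod y = 1"
      have "cmod (u y) \<le> (\<Sum>j<n. M2 * (l j * D j y))"
        unfolding u_def
      proof (rule sum_norm_le)
        fix j assume "j \<in> {..<n}"
        then have j: "j < n" by simp
        have "cmod (\<theta> j * (c j * poly (q j) y)) \<le> 1 * (T l j * D j y)"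
          unfolding norm_mult cT norm_poly_q[OF y j]
          using \<theta>(1) D_pos[OF y, of j] by (intro mult_right_mono mult_nonneg_nonneg) (auto simp: T_def less_imp_le)
        also have "\<dots> \<le> M2 * (l j * D j y)"
          using mult_right_mono[OF T[rule_format, OF j], of "D j y"] D_pos[OF y, of j] by (simp add: mult_ac)
        finally show "cmod (\<theta> j * (c j * poly (q j) y)) \<le> M2 * (l j * D j y)" .
      qed
      then show "cmod (u y) \<le> M2 * cmod (Q l y)" unfolding Ql(3)[OF y] sum_distrib_left .
    qed (use x in auto)
    then have "cmod (u x / Q l x) \<le> M2" using Ql(2)[of x] x by (simp add: norm_divide divide_le_eq)
    also have "u x / Q l x = (\<Sum>j<n. \<theta> j * f j x)" by (simp add: u_def f_def sum_divide_distrib)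
    also have "\<dots> = of_real (\<Sum>j<n. cmod (f j x))" by (simp add: \<theta>)
    finally show ?thesis by (simp add: abs_of_nonneg sum_nonneg del: of_real_sum)
  qed
  show ?thesis using 1 2 3 by (intro exI[of _ f]) auto
qed

end

section \<open>Beurling functions for interpolating sequences\<close>

definition interpolates_within :: "(nat \<Rightarrow> complex) \<Rightarrow> real \<Rightarrow> (nat \<Rightarrow> complex) \<Rightarrow> bool" where
  "interpolates_within z C a \<longleftrightarrow> (\<exists>g. g holomorphic_on ball 0 1 \<and> (\<forall>x\<in>ball 0 1. cmod (g x) \<le> C) \<and> (\<forall>n. g (z n) = a n))"

text \<open>The library instance of class \<open>complete_space\<close> needs a metric on the domain, which type
  \<open>nat\<close> lacks.\<close>
lemma complete_bounded_sequences: "complete (UNIV :: (nat \<Rightarrow>\<^sub>C 'b::complete_space) set)"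
proof (rule completeI)
  fix f :: "nat \<Rightarrow> nat \<Rightarrow>\<^sub>C 'b"
  assume f: "Cauchy f"
  have "uniformly_Cauchy_on UNIV (\<lambda>n. apply_bcontfun (f n))"
    unfolding uniformly_Cauchy_on_def
  proof (intro allI impI)
    fix e :: real assume "0 < e"
    then obtain N where "\<And>m n. m \<ge> N \<Longrightarrow> n \<ge> N \<Longrightarrow> dist (f m) (f n) < e"
      using f unfolding Cauchy_def by blast
    then show "\<exists>N. \<forall>x\<in>UNIV. \<forall>m\<ge>N. \<forall>n\<ge>N. dist (apply_bcontfun (f m) x) (apply_bcontfun (f n) x) < e"
      using le_less_trans[OF dist_bounded] by blast
  qed
  then obtain g where "uniform_limit UNIV (\<lambda>n. apply_bcontfun (f n)) g sequentially"
    using Cauchy_uniformly_convergent uniformly_convergent_on_def by blast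
  then obtain l where "f \<longlonglongrightarrow> l"
    using uniform_limit_bcontfunE sequentially_bot by blast
  then show "\<exists>l\<in>UNIV. f \<longlonglongrightarrow> l" by blast
qed

text \<open>Interpolants with a common bound form a normal family, so those of a convergent sequence
  of data subconverge to an interpolant of the limit. This prepares the Baire argument.\<close>

lemma closed_interpolates_within:
  assumes z: "\<forall>n. z n \<in> ball 0 1"
  shows "closed {f :: nat \<Rightarrow>\<^sub>C complex. interpolates_within z C (apply_bcontfun f)}"
  unfolding closed_sequential_limits
proof safe
  fix f :: "nat \<Rightarrow> nat \<Rightarrow>\<^sub>C complex" and l
  assume "\<forall>n. f n \<in> {f. interpolates_within z C (apply_bcontfun f)}" and lim: "f \<longlonglongrightarrow> l"
  then have "\<forall>n. \<exists>g. g holomorphic_on ball 0 1 \<and> (\<forall>x\<in>ball 0 1. cmod (g x) \<le> C) \<and> (\<forall>k. g (z k) = apply_bcontfun (f n) k)"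
    by (simp add: interpolates_within_def)
  then obtain g where g: "\<And>n. g n holomorphic_on ball 0 1" "\<And>n x. x \<in> ball 0 1 \<Longrightarrow> cmod (g n x) \<le> C"
    "\<And>n k. g n (z k) = apply_bcontfun (f n) k" by metis
  obtain h r where h: "h holomorphic_on ball 0 1" "strict_mono (r :: nat \<Rightarrow> nat)"
    "\<And>x. x \<in> ball 0 1 \<Longrightarrow> (\<lambda>n. g (r n) x) \<longlonglongrightarrow> h x"
  proof (rule Montel[of "ball 0 1" "range g" g])
    show "\<exists>B. \<forall>h\<in>range g. \<forall>z\<in>K. norm (h z) \<le> B" if "K \<subseteq> ball 0 1" for K
      using g(2) that by (intro exI[of _ C]) auto
  qed (use g(1) in auto)
  have "cmod (h x) \<le> C" if "x \<in> ball 0 1" for x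
    by (rule LIMSEQ_le_const2[OF tendsto_norm[OF h(3)[OF that]]]) (use g(2)[OF that] in auto)
  moreover have "h (z k) = apply_bcontfun l k" for k
  proof (rule LIMSEQ_unique[OF h(3)[OF z[rule_format]]])
    have "(\<lambda>n. apply_bcontfun (f n) k) \<longlonglongrightarrow> apply_bcontfun l k"
    proof (rule tendstoI)
      fix e :: real assume "0 < e"
      with lim have "\<forall>\<^sub>F n in sequentially. dist (f n) l < e" by (rule tendstoD)
      then show "\<forall>\<^sub>F n in sequentially. dist (apply_bcontfun (f n) k) (apply_bcontfun l k) < e"
        by eventually_elim (rule le_less_trans[OF dist_bounded])
    qed
    from LIMSEQ_subseq_LIMSEQ[OF this h(2)] show "(\<lambda>n. g (r n) (z k)) \<longlonglongrightarrow> apply_bcontfun l k"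
      by (simp add: g(3) o_def)
  qed
  ultimately show "interpolates_within z C (apply_bcontfun l)"
    using h(1) unfolding interpolates_within_def by (intro exI[of _ h]) auto
qed

text \<open>Solvability for every bounded datum entails a uniform bound: the data solvable with
  bound \<open>m\<close> are closed sets covering a complete space, so by Baire one of them contains
  a ball. Without this the infimum in \<open>interp_const\<close> might range over the empty
  set.\<close>

lemma interpolating_uniform:
  assumes z: "interpolating z"
  obtains C where "\<And>a. bounded (range a) \<Longrightarrow> interpolates_within z (C * (SUP n. cmod (a n))) a"
proof -
  have zb: "\<forall>n. z n \<in> ball 0 1" using z by (simp add: interpolating_def)
  define E where "E m = {f :: nat \<Rightarrow>\<^sub>C complex. interpolates_within z (real m) (apply_bcontfun f)}" for m :: nat
  have ap: "apply_bcontfun (Bcontfun a) = a" if "bounded (range a)" for a :: "nat \<Rightarrow> complex"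
    using that by (intro Bcontfun_inverse) (auto simp: bcontfun_def continuous_on_discrete)
  have un: "(\<Union>m. E m) = UNIV"
  proof -
    have "\<exists>m. f \<in> E m" for f
    proof -
      have "bounded (range (apply_bcontfun f))" by simp
      then obtain g where g: "bounded_holo_disk g" "\<And>n. g (z n) = apply_bcontfun f n"
        using z unfolding interpolating_def by blast
      then obtain B where B: "\<forall>x\<in>ball 0 1. cmod (g x) \<le> B"
        unfolding bounded_holo_disk_def bounded_iff by blast
      obtain m :: nat where "B \<le> real m" using real_arch_simple by blast
      then have "\<And>x. x \<in> ball 0 1 \<Longrightarrow> cmod (g x) \<le> real m" using B order_trans by blast
      then show ?thesis using g unfolding E_def interpolates_within_def bounded_holo_disk_def by blast
    qed
    then show ?thesis by blast
  qed
  have "\<exists>m. interior (E m) \<noteq> {}"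
  proof (rule ccontr)
    assume "\<not> ?thesis"
    then have "Met_TC.mtopology interior_of \<Union>(range E) = {}"
      using closed_interpolates_within[OF zb]
      by (intro Met_TC.metric_Baire_category_alt) (auto simp: E_def complete_bounded_sequences)
    then show False using un by simp
  qed
  then obtain m f0 where "f0 \<in> interior (E m)" by blast
  then obtain \<epsilon> where e: "\<epsilon> > 0" "cball f0 \<epsilon> \<subseteq> E m"
    by (metis interior_subset open_contains_cball open_interior subset_trans)
  show thesis
  proof (rule that[of "2 * real m / \<epsilon>"])
    fix a :: "nat \<Rightarrow> complex" assume a: "bounded (range a)"
    define s where "s = (SUP n. cmod (a n))"
    have bdd: "bdd_above (range (\<lambda>n. cmod (a n)))"
      using a unfolding bounded_iff bdd_above_def by blast
    have as: "cmod (a n) \<le> s" for n unfolding s_def by (rule cSUP_upper[OF _ bdd]) simp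
    have s0: "0 \<le> s" using as[of 0] norm_ge_zero order_trans by blast
    show "interpolates_within z (2 * real m / \<epsilon> * (SUP n. cmod (a n))) a"
    proof (cases "s = 0")
      case True
      then have "a = (\<lambda>_. 0)" using as by auto
      then show ?thesis using True unfolding interpolates_within_def s_def[symmetric]
        by (intro exI[of _ "\<lambda>_. 0"]) auto
    next
      case False
      then have s: "0 < s" using s0 by simp
      \<comment> \<open>Scaled to stay in the ball: \<open>a\<close> is
        \<open>s / \<epsilon>\<close> times a difference of two data in \<open>E m\<close>, whence
        the constant \<open>2 * real m / \<epsilon>\<close>.\<close>
      define f1 where "f1 = f0 + (\<epsilon> / s) *\<^sub>R Bcontfun a"
      have f1: "apply_bcontfun f1 n = apply_bcontfun f0 n + of_real (\<epsilon> / s) * a n" for n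
        by (simp add: f1_def plus_bcontfun.rep_eq scaleR_bcontfun.rep_eq ap[OF a] scaleR_conv_of_real)
      have "dist f0 f1 \<le> \<epsilon>"
      proof (rule dist_bound)
        fix n
        have "\<epsilon> * cmod (a n) \<le> \<epsilon> * s" using as e by (intro mult_left_mono) auto
        then show "dist (apply_bcontfun f0 n) (apply_bcontfun f1 n) \<le> \<epsilon>"
          using e s by (simp add: dist_norm f1 norm_mult norm_divide divide_le_eq)
      qed
      then have "f1 \<in> E m" "f0 \<in> E m" using e by (auto simp: subset_iff)
      then obtain g0 g1 where g: "g0 holomorphic_on ball 0 1" "g1 holomorphic_on ball 0 1"
        "\<And>x. x \<in> ball 0 1 \<Longrightarrow> cmod (g0 x) \<le> real m" "\<And>x. x \<in> ball 0 1 \<Longrightarrow> cmod (g1 x) \<le> real m"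
        "\<And>n. g0 (z n) = apply_bcontfun f0 n" "\<And>n. g1 (z n) = apply_bcontfun f1 n"
        unfolding E_def interpolates_within_def by blast
      define g where "g x = of_real (s / \<epsilon>) * (g1 x - g0 x)" for x
      have "g holomorphic_on ball 0 1" unfolding g_def by (intro holomorphic_intros g)
      moreover have "cmod (g x) \<le> 2 * real m / \<epsilon> * s" if x: "x \<in> ball 0 1" for x
      proof -
        have "cmod (g1 x - g0 x) \<le> real m + real m"
          by (rule order_trans[OF norm_triangle_ineq4 add_mono[OF g(4)[OF x] g(3)[OF x]]])
        then have "s / \<epsilon> * cmod (g1 x - g0 x) \<le> s / \<epsilon> * (real m + real m)"
          using s e by (intro mult_left_mono) auto
        moreover have "cmod (g x) = s / \<epsilon> * cmod (g1 x - g0 x)"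
          unfolding g_def norm_mult norm_of_real using s e by simp
        ultimately show ?thesis by (simp add: mult_ac)
      qed
      moreover have "g (z n) = a n" for n using s e by (simp add: g_def g f1)
      ultimately show ?thesis unfolding interpolates_within_def s_def[symmetric] by blast
    qed
  qed
qed

section \<open>The constant of interpolation as an infimum\<close>

definition admissible :: "(nat \<Rightarrow> complex) \<Rightarrow> real set" where
  "admissible z = {M. \<forall>a :: nat \<Rightarrow> complex. bounded (range a) \<longrightarrow>
      (\<exists>g. bounded_holo_disk g \<and> (\<forall>n. g (z n) = a n) \<and>
           (\<forall>w\<in>ball 0 1. cmod (g w) \<le> M * (SUP n. cmod (a n))))}"

lemma interp_const_eq: "interp_const z = Inf (admissible z)"
  by (simp add: interp_const_def admissible_def)

lemma admissible_ge_1: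
  assumes "interpolating z" and M: "M \<in> admissible z"
  shows "1 \<le> M"
proof -
  have "bounded (range (\<lambda>_::nat. 1::complex))" by simp
  then obtain g where "g (z 0) = 1" "\<forall>w\<in>ball 0 1. cmod (g w) \<le> M * (SUP n::nat. cmod 1)"
    using M unfolding admissible_def by blast
  moreover have "z 0 \<in> ball 0 1" using assms(1) by (simp add: interpolating_def)
  ultimately show ?thesis by force
qed

lemma admissible_nonempty:
  assumes z: "interpolating z"
  shows "admissible z \<noteq> {}"
proof -
  obtain C where C: "\<And>a. bounded (range a) \<Longrightarrow> interpolates_within z (C * (SUP n. cmod (a n))) a"
    using interpolating_uniform[OF z] by blast
  have "C \<in> admissible z"
    unfolding admissible_def
  proof safe
    fix a :: "nat \<Rightarrow> complex" assume "bounded (range a)"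
    from C[OF this] obtain g where g: "g holomorphic_on ball 0 1"
      "\<forall>x\<in>ball 0 1. cmod (g x) \<le> C * (SUP n. cmod (a n))" "\<forall>n. g (z n) = a n"
      unfolding interpolates_within_def by blast
    then have "bounded_holo_disk g" unfolding bounded_holo_disk_def bounded_iff by blast
    with g show "\<exists>g. bounded_holo_disk g \<and> (\<forall>n. g (z n) = a n) \<and> (\<forall>w\<in>ball 0 1. cmod (g w) \<le> C * (SUP n. cmod (a n)))"
      by blast
  qed
  then show ?thesis by blast
qed

lemma interp_const_ge_1: "interpolating z \<Longrightarrow> 1 \<le> interp_const z"
  unfolding interp_const_eq by (rule cInf_greatest[OF admissible_nonempty admissible_ge_1])

text \<open>Some admissible constant lies strictly below \<open>M\<close>; whether the infimum
  itself is attained is left open.\<close>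

lemma interpolation_above_const:
  assumes z: "interpolating z" and M: "interp_const z < M" and b: "\<forall>j. cmod (b j) \<le> 1"
  shows "interpolates_within z M b"
proof -
  obtain M0 where M0: "M0 \<in> admissible z" "M0 < M"
    using M cInf_lessD[OF admissible_nonempty[OF z]] unfolding interp_const_eq by blast
  have "bounded (range b)" using b by (auto simp: bounded_iff)
  then obtain g where g: "bounded_holo_disk g" "\<forall>n. g (z n) = b n"
    "\<And>w. w \<in> ball 0 1 \<Longrightarrow> cmod (g w) \<le> M0 * (SUP n. cmod (b n))"
    using M0(1) unfolding admissible_def by blast
  have "(SUP n. cmod (b n)) \<le> 1" by (rule cSUP_least) (use b in auto)
  then have "M0 * (SUP n. cmod (b n)) \<le> M0 * 1"
    using admissible_ge_1[OF z M0(1)] by (intro mult_left_mono) auto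
  then have "cmod (g w) \<le> M" if "w \<in> ball 0 1" for w using g(3)[OF that] M0(2) by linarith
  then show ?thesis using g unfolding interpolates_within_def bounded_holo_disk_def by blast
qed

text \<open>Dilation by \<open>R < 1\<close> moves the nodes to \<open>z k / of_real R\<close> and
  makes the interpolants holomorphic on a disc of radius \<open>1 / R\<close>, as
  \<open>finite_interpolation\<close> demands. Setting the functions beyond index \<open>N\<close>
  to 0 bounds sums of any length.\<close>

lemma approximate_beurling_functions:
  assumes z: "interpolating z"
  shows "\<exists>R f. 1 - 1 / real (N + 2) < R \<and> R < 1 \<and> (\<forall>j. f j holomorphic_on ball 0 1) \<and>
    (\<forall>j\<le>N. \<forall>k\<le>N. f j (z k / of_real R) = (if j = k then 1 else 0)) \<and>
    (\<forall>x J. cmod x < 1 \<longrightarrow> (\<Sum>j<J. cmod (f j x)) \<le> interp_const z + 1 / real (N + 1))"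
proof -
  \<comment> \<open>Half of the slack: \<open>M\<close> exceeds \<open>interp_const z\<close>, so
    interpolation within \<open>M\<close> is possible, and stays below the final bound, which leaves
    room for \<open>beurling_functions\<close>.\<close>
  define M where "M = interp_const z + 1 / (2 * real (N + 1))"
  have C: "interp_const z < M" "M < interp_const z + 1 / real (N + 1)" by (auto simp: M_def field_simps)
  have zb: "cmod (z n) < 1" for n using z by (simp add: interpolating_def)
  define m where "m = Max (insert (1 - 1 / real (N + 2)) ((\<lambda>k. cmod (z k)) ` {..N}))"
  have m: "1 - 1 / real (N + 2) \<le> m" "m < 1" "\<And>k. k \<le> N \<Longrightarrow> cmod (z k) \<le> m"
  proof -
    show "1 - 1 / real (N + 2) \<le> m" unfolding m_def by (rule Max_ge) auto
    show "m < 1" unfolding m_def using zb by (subst Max_less_iff) auto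
    show "cmod (z k) \<le> m" if "k \<le> N" for k unfolding m_def by (rule Max_ge) (use that in auto)
  qed
  define R where "R = (1 + m) / 2"
  have R: "1 - 1 / real (N + 2) < R" "R < 1" "\<And>k. k \<le> N \<Longrightarrow> cmod (z k) < R"
    using m by (force simp: R_def)+
  have R0: "0 < R" using R(3)[of 0] by (rule le_less_trans[OF norm_ge_zero]) simp
  interpret finite_interpolation_nonempty "\<lambda>k. z k / of_real R" "Suc N" M
  proof
    show "cmod (z j / of_real R) < 1" if "j < Suc N" for j
      using R(3)[of j] R0 that by (simp add: norm_divide)
    show "inj_on (\<lambda>k. z k / of_real R) {..<Suc N}"
      using z R0 by (auto simp: interpolating_def inj_on_def)
    show "0 < M" using interp_const_ge_1[OF z] C by linarith
    fix b :: "nat \<Rightarrow> complex" assume "\<And>j. cmod (b j) \<le> 1"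
    then have b: "\<forall>j. cmod (b j) \<le> 1" by blast
    obtain g where g: "g holomorphic_on ball 0 1" "\<forall>x\<in>ball 0 1. cmod (g x) \<le> M" "\<forall>n. g (z n) = b n"
      using interpolation_above_const[OF z C(1) b] unfolding interpolates_within_def by blast
    have sc: "of_real R * x \<in> ball (0::complex) 1" if "x \<in> ball 0 (1 / R)" for x
      using that R0 by (simp add: norm_mult field_simps)
    have "(g \<circ> (\<lambda>x. of_real R * x)) holomorphic_on ball 0 (1 / R)"
      by (rule holomorphic_on_compose_gen[OF _ g(1)]) (use sc in \<open>auto intro!: holomorphic_intros\<close>)
    then show "\<exists>g \<rho>. 1 < \<rho> \<and> g holomorphic_on ball 0 \<rho> \<and> (\<forall>x\<in>ball 0 \<rho>. cmod (g x) \<le> M) \<and>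
        (\<forall>j<Suc N. g (z j / of_real R) = b j)"
      using g R R0 sc by (intro exI[of _ "g \<circ> (\<lambda>x. of_real R * x)"] exI[of _ "1 / R"]) (simp add: o_def)
  qed simp
  obtain f where f: "\<And>j. j < Suc N \<Longrightarrow> f j holomorphic_on ball 0 1"
    "\<And>j k. j < Suc N \<Longrightarrow> k < Suc N \<Longrightarrow> f j (z k / of_real R) = (if j = k then 1 else 0)"
    "\<And>x. cmod x < 1 \<Longrightarrow> (\<Sum>j<Suc N. cmod (f j x)) \<le> interp_const z + 1 / real (N + 1)"
    using beurling_functions[OF C(2)] by blast
  define f' where "f' j = (if j < Suc N then f j else (\<lambda>_. 0))" for j
  have "(\<Sum>j<J. cmod (f' j x)) \<le> interp_const z + 1 / real (N + 1)" if "cmod x < 1" for x J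
  proof -
    have "(\<Sum>j<J. cmod (f' j x)) = (\<Sum>j\<in>{..<J} \<inter> {..<Suc N}. cmod (f j x))"
      by (rule sum.mono_neutral_cong_right) (auto simp: f'_def)
    also have "\<dots> \<le> (\<Sum>j<Suc N. cmod (f j x))" by (rule sum_mono2) auto
    finally show ?thesis using f(3)[OF that] by simp
  qed
  moreover have "f' j holomorphic_on ball 0 1" for j using f(1) by (simp add: f'_def)
  moreover have "f' j (z k / of_real R) = (if j = k then 1 else 0)" if "j \<le> N" "k \<le> N" for j k
    using f(2)[of j k] that by (simp add: f'_def less_Suc_eq_le)
  ultimately show ?thesis using R by (intro exI[of _ R] exI[of _ f']) blast
qed

text \<open>A diagonal subsequence of the approximate families converges locally uniformly.
  Uniformity matters because the approximations are normalised at the moving points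
  \<open>z k / of_real (R N)\<close>, not at \<open>z k\<close>.\<close>

theorem beurling:
  assumes z: "interpolating z"
  obtains \<phi> where "\<And>j. \<phi> j holomorphic_on ball 0 1" and "\<And>j k. \<phi> j (z k) = (if j = k then 1 else 0)"
    and "\<And>x J. cmod x < 1 \<Longrightarrow> (\<Sum>j<J. cmod (\<phi> j x)) \<le> interp_const z"
proof -
  let ?M = "interp_const z"
  have zb: "cmod (z n) < 1" for n using z by (simp add: interpolating_def)
  obtain R f where R: "\<And>N. 1 - 1 / real (N + 2) < R N" "\<And>N. R N < 1"
    and f: "\<And>N j. f N j holomorphic_on ball 0 1"
    "\<And>N j k. j \<le> N \<Longrightarrow> k \<le> N \<Longrightarrow> f N j (z k / of_real (R N)) = (if j = k then 1 else 0)"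
    "\<And>N x J. cmod x < 1 \<Longrightarrow> (\<Sum>j<J. cmod (f N j x)) \<le> ?M + 1 / real (N + 1)"
    using approximate_beurling_functions[OF z] by metis
  have fb: "cmod (f N j x) \<le> ?M + 1" if "cmod x < 1" for N j x
  proof -
    have "cmod (f N j x) \<le> (\<Sum>j<Suc j. cmod (f N j x))" by (simp add: sum_nonneg)
    also have "\<dots> \<le> ?M + 1 / real (N + 1)" by (rule f(3)[OF that])
    also have "\<dots> \<le> ?M + 1" by simp
    finally show ?thesis .
  qed
  define P where "P j s \<longleftrightarrow> (\<exists>g. g holomorphic_on ball 0 1 \<and>
    (\<forall>K. compact K \<and> K \<subseteq> ball 0 1 \<longrightarrow> uniform_limit K (\<lambda>i. f (s i) j) g sequentially))" for j and s :: "nat \<Rightarrow> nat"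
  interpret subseqs P
  proof
    fix j and s :: "nat \<Rightarrow> nat"
    obtain g r where "g holomorphic_on ball 0 1" "strict_mono (r :: nat \<Rightarrow> nat)"
      "\<And>K. compact K \<Longrightarrow> K \<subseteq> ball 0 1 \<Longrightarrow> uniform_limit K ((\<lambda>i. f (s i) j) \<circ> r) g sequentially"
    proof (rule Montel[of "ball 0 1" "range (\<lambda>i. f (s i) j)" "\<lambda>i. f (s i) j"])
      show "\<exists>B. \<forall>h\<in>range (\<lambda>i. f (s i) j). \<forall>z\<in>K. norm (h z) \<le> B" if "K \<subseteq> ball 0 1" for K
        using fb that by (intro exI[of _ "?M + 1"]) auto
    qed (use f(1) in auto)
    then show "\<exists>r'. strict_mono r' \<and> P j (s \<circ> r')"
      by (intro exI[of _ r]) (auto simp: P_def o_def)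
  qed
  have "P j (diagseq \<circ> (+) (Suc j))" for j
  proof (rule diagseq_holds)
    fix r s :: "nat \<Rightarrow> nat" and n assume r: "strict_mono r" and "P n s"
    then obtain g where g: "g holomorphic_on ball 0 1"
      "\<And>K. compact K \<Longrightarrow> K \<subseteq> ball 0 1 \<Longrightarrow> uniform_limit K (\<lambda>i. f (s i) n) g sequentially"
      unfolding P_def by blast
    have "uniform_limit K (\<lambda>i. f (s (r i)) n) g sequentially" if "compact K" "K \<subseteq> ball 0 1" for K
      using filterlim_compose[OF g(2)[OF that] filterlim_subseq[OF r]] .
    then show "P n (s \<circ> r)" using g(1) unfolding P_def o_def by blast
  qed
  then have "\<forall>j. \<exists>g. g holomorphic_on ball 0 1 \<and> (\<forall>K. compact K \<and> K \<subseteq> ball 0 1 \<longrightarrow>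
      uniform_limit K (\<lambda>i. f (diagseq (Suc j + i)) j) g sequentially)"
    by (simp only: P_def o_def) blast
  from choice[OF this] obtain \<phi> where \<phi>: "\<forall>j. \<phi> j holomorphic_on ball 0 1 \<and>
      (\<forall>K. compact K \<and> K \<subseteq> ball 0 1 \<longrightarrow> uniform_limit K (\<lambda>i. f (diagseq (Suc j + i)) j) (\<phi> j) sequentially)" ..
  then have hol: "\<And>j. \<phi> j holomorphic_on ball 0 1"
    and ul: "\<And>j K. compact K \<Longrightarrow> K \<subseteq> ball 0 1 \<Longrightarrow> uniform_limit K (\<lambda>i. f (diagseq (Suc j + i)) j) (\<phi> j) sequentially"
    by simp_all
  have lim: "(\<lambda>i. f (diagseq i) j x) \<longlonglongrightarrow> \<phi> j x" if x: "cmod x < 1" for j x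
  proof -
    have "(\<lambda>i. f (diagseq (Suc j + i)) j x) \<longlonglongrightarrow> \<phi> j x"
      using ul[of "{x}" j] x by simp
    then show ?thesis using LIMSEQ_offset[of "\<lambda>i. f (diagseq i) j x" "Suc j"] by (simp add: add.commute)
  qed
  have dg: "i \<le> diagseq i" for i by (rule seq_suble[OF subseq_diagseq])
  have R1: "R \<longlonglongrightarrow> 1"
  proof (rule real_tendsto_sandwich)
    show "(\<lambda>N. 1 - 1 / real (N + 2)) \<longlonglongrightarrow> 1" by real_asymp
  qed (use R in \<open>auto intro!: always_eventually less_imp_le\<close>)
  have val: "\<phi> j (z k) = (if j = k then 1 else 0)" for j k
  proof -
    \<comment> \<open>The shift by \<open>Suc j\<close> is the one at which the diagonal sequence is
      known to converge for index \<open>j\<close>; it also ensures \<open>j \<le> t i\<close>, as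
      the normalisation requires.\<close>
    define t where "t i = diagseq (Suc j + i)" for i
    define x where "x i = z k / of_real (R (t i))" for i
    have tinf: "filterlim t sequentially sequentially"
      by (rule filterlim_subseq) (use subseq_diagseq in \<open>auto simp: t_def strict_mono_def\<close>)
    have xz: "x \<longlonglongrightarrow> z k"
    proof -
      have "(\<lambda>i. R (t i)) \<longlonglongrightarrow> 1" by (rule filterlim_compose[OF R1 tinf])
      then have "(\<lambda>i. z k / of_real (R (t i))) \<longlonglongrightarrow> z k / of_real 1" by (intro tendsto_intros) auto
      then show ?thesis by (simp add: x_def[abs_def])
    qed
    define K where "K = cball (0::complex) ((1 + cmod (z k)) / 2)"
    have K: "compact K" "K \<subseteq> ball 0 1" using zb[of k] by (auto simp: K_def)
    have "\<forall>\<^sub>F i in sequentially. cmod (x i) < (1 + cmod (z k)) / 2"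
      by (rule order_tendstoD(2)[OF tendsto_norm[OF xz]]) (use zb[of k] in auto)
    then have xK: "\<forall>\<^sub>F i in sequentially. x i \<in> K" by eventually_elim (auto simp: K_def)
    have big: "\<forall>\<^sub>F i in sequentially. f (t i) j (x i) = (if j = k then 1 else 0)"
      using eventually_ge_at_top[of k]
    proof eventually_elim
      case (elim i)
      have "j \<le> t i" "k \<le> t i" using dg[of "Suc j + i"] elim by (auto simp: t_def)
      then show ?case using f(2)[of j "t i" k] by (simp add: x_def)
    qed
    have "(\<lambda>i. dist (if j = k then 1 else 0) (\<phi> j (x i))) \<longlonglongrightarrow> 0"
    proof (rule tendstoI)
      fix e :: real assume "0 < e"
      then have "\<forall>\<^sub>F i in sequentially. \<forall>y\<in>K. dist (f (t i) j y) (\<phi> j y) < e"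
        using ul[OF K, of j] unfolding uniform_limit_iff t_def by blast
      with xK big show "\<forall>\<^sub>F i in sequentially. dist (dist (if j = k then 1 else 0) (\<phi> j (x i))) 0 < e"
        by eventually_elim (metis abs_of_nonneg dist_0_norm dist_commute real_norm_def zero_le_dist)
    qed
    moreover have "(\<lambda>i. \<phi> j (x i)) \<longlonglongrightarrow> \<phi> j (z k)"
    proof (rule isCont_tendsto_compose[OF _ xz])
      show "isCont (\<phi> j) (z k)"
        using holomorphic_on_imp_continuous_on[OF hol, of j] zb[of k] continuous_on_eq_continuous_at[of "ball 0 1" "\<phi> j"] by auto
    qed
    then have "(\<lambda>i. dist (if j = k then 1 else 0) (\<phi> j (x i))) \<longlonglongrightarrow> dist (if j = k then 1 else 0) (\<phi> j (z k))"
      by (intro tendsto_intros)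
    ultimately have "dist (if j = k then 1 else 0) (\<phi> j (z k)) = 0" using LIMSEQ_unique by blast
    then show ?thesis by simp
  qed
  have "(\<Sum>j<J. cmod (\<phi> j x)) \<le> ?M" if x: "cmod x < 1" for x J
  proof (rule LIMSEQ_le)
    show "(\<lambda>i. \<Sum>j<J. cmod (f (diagseq i) j x)) \<longlonglongrightarrow> (\<Sum>j<J. cmod (\<phi> j x))"
      by (intro tendsto_intros lim x)
    have "(\<lambda>N. 1 / real (N + 1)) \<longlonglongrightarrow> 0" by real_asymp
    then have "(\<lambda>N. ?M + 1 / real (N + 1)) \<longlonglongrightarrow> ?M" using tendsto_add[OF tendsto_const] by fastforce
    from LIMSEQ_subseq_LIMSEQ[OF this subseq_diagseq] show "(\<lambda>i. ?M + 1 / real (diagseq i + 1)) \<longlonglongrightarrow> ?M"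
      by (simp add: o_def)
  qed (use f(3)[OF x] in auto)
  then show thesis using that hol val by blast
qed

section \<open>Neumann series\<close>

lemma scaleC_series:
  fixes u :: "nat \<Rightarrow> 'x::{complex_normed_vector,banach}"
  assumes c: "\<forall>N. (\<Sum>n<N. cmod (c n)) \<le> B" and u: "\<forall>n. norm (u n) \<le> K"
  shows "summable (\<lambda>n. scaleC (c n) (u n))" and "norm (\<Sum>n. scaleC (c n) (u n)) \<le> B * K"
    and "\<And>N. norm (\<Sum>n<N. scaleC (c n) (u n)) \<le> B * K"
proof -
  have K: "0 \<le> K" using u norm_ge_zero order_trans by blast
  have le: "(\<Sum>n<N. norm (scaleC (c n) (u n))) \<le> B * K" for N
  proof -
    have "(\<Sum>n<N. norm (scaleC (c n) (u n))) \<le> (\<Sum>n<N. cmod (c n) * K)"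
      unfolding norm_scaleC using u by (intro sum_mono mult_left_mono) auto
    also have "\<dots> \<le> B * K" unfolding sum_distrib_right[symmetric] using c by (intro mult_right_mono[OF _ K]) auto
    finally show ?thesis .
  qed
  then have s: "summable (\<lambda>n. norm (scaleC (c n) (u n)))"
    by (intro summableI_nonneg_bounded) auto
  then show "summable (\<lambda>n. scaleC (c n) (u n))" by (rule summable_norm_cancel)
  show "norm (\<Sum>n. scaleC (c n) (u n)) \<le> B * K"
    by (rule order_trans[OF summable_norm[OF s] suminf_le_const[OF s le]])
  show "norm (\<Sum>n<N. scaleC (c n) (u n)) \<le> B * K" for N
    by (rule order_trans[OF norm_sum le])
qed

lemma vholo_on_series:
  fixes u :: "nat \<Rightarrow> complex \<Rightarrow> 'x::{complex_normed_vector,banach}"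
  assumes U: "open U" and hc: "\<And>n. c n holomorphic_on U" and hu: "\<And>n. vholo_on (u n) U"
    and c: "\<And>x. x \<in> U \<Longrightarrow> \<forall>N. (\<Sum>n<N. cmod (c n x)) \<le> B" and u: "\<And>x. x \<in> U \<Longrightarrow> \<forall>n. norm (u n x) \<le> K"
  shows "vholo_on (\<lambda>x. \<Sum>n. scaleC (c n x) (u n x)) U"
proof (rule vholo_on_pointwise_limit[OF U])
  show "vholo_on (\<lambda>x. \<Sum>n<N. scaleC (c n x) (u n x)) U" for N
    by (intro vholo_on_sum vholo_on_scaleC U hc hu)
  show "norm (\<Sum>n<N. scaleC (c n x) (u n x)) \<le> B * K" if "x \<in> U" for N x
    by (rule scaleC_series(3)[OF c[OF that] u[OF that]])
  show "(\<lambda>N. \<Sum>n<N. scaleC (c n x) (u n x)) \<longlonglongrightarrow> (\<Sum>n. scaleC (c n x) (u n x))" if "x \<in> U" for x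
    by (rule summable_LIMSEQ[OF scaleC_series(1)[OF c[OF that] u[OF that]]])
qed

definition mat_op :: "(nat \<Rightarrow> nat \<Rightarrow> complex) \<Rightarrow> (nat \<Rightarrow> 'x::{complex_normed_vector,banach}) \<Rightarrow> nat \<Rightarrow> 'x" where
  "mat_op e y k = (\<Sum>n. scaleC (e k n) (y n))"

text \<open>Partial sums of the Neumann series for the inverse of identity plus \<open>e\<close>, in
  recursive form.\<close>

primrec niter :: "(nat \<Rightarrow> nat \<Rightarrow> complex) \<Rightarrow> (nat \<Rightarrow> 'x::{complex_normed_vector,banach}) \<Rightarrow> nat \<Rightarrow> nat \<Rightarrow> 'x" where
  "niter e a 0 = a"
| "niter e a (Suc m) = (\<lambda>k. a k - mat_op e (niter e a m) k)"

definition neumann :: "(nat \<Rightarrow> nat \<Rightarrow> complex) \<Rightarrow> (nat \<Rightarrow> 'x::{complex_normed_vector,banach}) \<Rightarrow> nat \<Rightarrow> 'x" where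
  "neumann e a k = lim (\<lambda>m. niter e a m k)"

text \<open>Row sums of at most 1/2 make \<open>e\<close> act on bounded sequences with norm at most
  1/2.\<close>

locale contraction_matrix =
  fixes e :: "nat \<Rightarrow> nat \<Rightarrow> complex"
  assumes e: "\<forall>N. (\<Sum>n<N. cmod (e k n)) \<le> 1 / 2"
begin

lemma mat_op_le: "\<forall>n. norm (y n) \<le> K \<Longrightarrow> norm (mat_op e y k) \<le> K / 2"
  using scaleC_series(2)[OF e[of k], of y K] by (simp add: mat_op_def)

lemma mat_op_summable:
  fixes y :: "nat \<Rightarrow> 'x::{complex_normed_vector,banach}"
  shows "\<forall>n. norm (y n) \<le> K \<Longrightarrow> summable (\<lambda>n. scaleC (e k n) (y n))"
  using scaleC_series(1)[OF e[of k], of y K] .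

lemma mat_op_add:
  assumes "\<forall>n. norm (y n) \<le> K" "\<forall>n. norm (y' n) \<le> K'"
  shows "mat_op e (\<lambda>n. y n + y' n) k = mat_op e y k + mat_op e y' k"
  unfolding mat_op_def scaleC_add_right
  by (rule suminf_add[symmetric, OF mat_op_summable[OF assms(1)] mat_op_summable[OF assms(2)]])

lemma mat_op_diff:
  assumes "\<forall>n. norm (y n) \<le> K" "\<forall>n. norm (y' n) \<le> K'"
  shows "mat_op e (\<lambda>n. y n - y' n) k = mat_op e y k - mat_op e y' k"
  unfolding mat_op_def bounded_bilinear.diff_right[OF bounded_bilinear_scaleC]
  by (rule suminf_diff[symmetric, OF mat_op_summable[OF assms(1)] mat_op_summable[OF assms(2)]])

lemma mat_op_scale:
  assumes "\<forall>n. norm (y n) \<le> K"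
  shows "mat_op e (\<lambda>n. scaleC c (y n)) k = scaleC c (mat_op e y k)"
proof -
  have "scaleC (e k n) (scaleC c (y n)) = scaleC c (scaleC (e k n) (y n))" for n
    by (simp add: scaleC_scaleC mult.commute)
  then show ?thesis
    unfolding mat_op_def
    using bounded_linear.suminf[OF bounded_bilinear.bounded_linear_right[OF bounded_bilinear_scaleC] mat_op_summable[OF assms]]
    by simp
qed

context
  fixes a :: "nat \<Rightarrow> 'x::{complex_normed_vector,banach}" and C :: real
  assumes a: "\<forall>k. norm (a k) \<le> C"
begin

lemma C_nonneg: "0 \<le> C" using a norm_ge_zero order_trans by blast

text \<open>The bound reproduces itself: \<open>C + (2 * C) / 2\<close> is
  \<open>2 * C\<close>.\<close>

lemma norm_iter: "\<forall>k. norm (niter e a m k) \<le> 2 * C"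
proof (induction m)
  case 0
  show ?case using a C_nonneg by (auto intro: order_trans)
next
  case (Suc m)
  have "norm (niter e a (Suc m) k) \<le> C + (2 * C) / 2" for k
    unfolding niter.simps
    by (rule order_trans[OF norm_triangle_ineq4 add_mono[OF a[rule_format] mat_op_le[OF Suc]]])
  then show ?case by simp
qed

lemma iter_step: "\<forall>k. norm (niter e a (Suc m) k - niter e a m k) \<le> C * (1 / 2) ^ m"
proof (induction m)
  case 0
  have "norm (mat_op e a k) \<le> C" for k using mat_op_le[OF a, of k] C_nonneg by linarith
  then show ?case by simp
next
  case (Suc m)
  have "niter e a (Suc (Suc m)) k - niter e a (Suc m) k =
      - mat_op e (\<lambda>n. niter e a (Suc m) n - niter e a m n) k" for k
    unfolding mat_op_diff[OF norm_iter norm_iter] by simp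
  then show ?case using mat_op_le[OF Suc] by (simp only: norm_minus_cancel) simp
qed

lemma iter_lim: "(\<lambda>m. niter e a m k) \<longlonglongrightarrow> neumann e a k"
proof -
  have "summable (\<lambda>m. niter e a (Suc m) k - niter e a m k)"
    by (rule summable_comparison_test'[OF summable_mult[OF summable_geometric] iter_step[rule_format]]) simp
  then have "convergent (\<lambda>m. niter e a m k)"
    unfolding summable_iff_convergent sum_lessThan_telescope[of "\<lambda>m. niter e a m k"]
    by (simp only: convergent_diff_const_right_iff)
  then show ?thesis unfolding neumann_def by (simp add: convergent_LIMSEQ_iff)
qed

lemma norm_neumann: "\<forall>k. norm (neumann e a k) \<le> 2 * C"
  by (intro allI LIMSEQ_le_const2[OF tendsto_norm[OF iter_lim]]) (use norm_iter in auto)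

text \<open>The estimate is uniform in \<open>k\<close>, which is what allows
  \<open>neumann_eq\<close> to pass to the limit under \<open>mat_op e\<close>.\<close>

lemma iter_error: "\<forall>k. norm (niter e a m k - neumann e a k) \<le> 2 * C * (1 / 2) ^ m"
proof
  fix k
  \<comment> \<open>Subtracting the geometric tail makes the induction close, since consecutive
    differences telescope.\<close>
  have "norm (niter e a m k - niter e a (m + i) k) \<le> 2 * C * (1 / 2) ^ m - 2 * C * (1 / 2) ^ (m + i)" for i
  proof (induction i)
    case (Suc i)
    have "norm (niter e a m k - niter e a (m + Suc i) k) \<le>
        norm (niter e a m k - niter e a (m + i) k) + norm (niter e a (Suc (m + i)) k - niter e a (m + i) k)"
      using norm_triangle_ineq4[of "niter e a m k - niter e a (m + i) k"
          "niter e a (Suc (m + i)) k - niter e a (m + i) k"] by simp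
    also have "\<dots> \<le> 2 * C * (1 / 2) ^ m - 2 * C * (1 / 2) ^ (m + i) + C * (1 / 2) ^ (m + i)"
      by (rule add_mono[OF Suc iter_step[rule_format]])
    finally show ?case by simp
  qed simp
  then have le: "norm (niter e a m k - niter e a (m + i) k) \<le> 2 * C * (1 / 2) ^ m" for i
    using C_nonneg by (smt (verit) mult_nonneg_nonneg zero_le_power zero_le_divide_1_iff)
  have "(\<lambda>i. niter e a (m + i) k) \<longlonglongrightarrow> neumann e a k"
    using LIMSEQ_ignore_initial_segment[where k = m, OF iter_lim[where k = k]] by (simp add: add.commute)
  then have "(\<lambda>i. norm (niter e a m k - niter e a (m + i) k)) \<longlonglongrightarrow> norm (niter e a m k - neumann e a k)"
    by (intro tendsto_intros)
  from LIMSEQ_le_const2[OF this] show "norm (niter e a m k - neumann e a k) \<le> 2 * C * (1 / 2) ^ m"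
    using le by blast
qed

lemma neumann_eq: "neumann e a k + mat_op e (neumann e a) k = a k"
proof -
  have "(\<lambda>m. niter e a (Suc m) k) \<longlonglongrightarrow> a k - mat_op e (neumann e a) k"
  proof (rule LIM_zero_cancel, rule Lim_null_comparison)
    have "norm (niter e a (Suc m) k - (a k - mat_op e (neumann e a) k)) \<le> 2 * C * (1 / 2) ^ m / 2" for m
    proof -
      have "niter e a (Suc m) k - (a k - mat_op e (neumann e a) k) =
          - mat_op e (\<lambda>n. niter e a m n - neumann e a n) k"
        unfolding mat_op_diff[OF norm_iter norm_neumann] by simp
      then show ?thesis using mat_op_le[OF iter_error, of m k] by simp
    qed
    then show "\<forall>\<^sub>F m in sequentially. norm (niter e a (Suc m) k - (a k - mat_op e (neumann e a) k)) \<le> 2 * C * (1 / 2) ^ m / 2"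
      by simp
    show "(\<lambda>m. 2 * C * (1 / 2) ^ m / 2) \<longlonglongrightarrow> 0" by (intro tendsto_eq_intros LIMSEQ_realpow_zero) auto
  qed
  then have "neumann e a k = a k - mat_op e (neumann e a) k"
    using LIMSEQ_unique LIMSEQ_Suc[OF iter_lim] by blast
  then show ?thesis by (metis diff_add_cancel)
qed

end

lemma neumann_add:
  assumes a: "\<forall>k. norm (a k) \<le> C" and b: "\<forall>k. norm (b k) \<le> C'"
  shows "neumann e (\<lambda>k. a k + b k) k = neumann e a k + neumann e b k"
proof -
  have *: "niter e (\<lambda>k. a k + b k) m k = niter e a m k + niter e b m k" for m k
  proof (induction m arbitrary: k)
    case (Suc m)
    have "niter e (\<lambda>k. a k + b k) m = (\<lambda>k. niter e a m k + niter e b m k)"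
      using Suc by auto
    then show ?case by (simp add: mat_op_add[OF norm_iter[OF a] norm_iter[OF b]])
  qed simp
  have "\<forall>k. norm (a k + b k) \<le> C + C'" using a b by (auto intro: order_trans[OF norm_triangle_ineq add_mono])
  from iter_lim[of "\<lambda>k. a k + b k", OF this] show ?thesis
    unfolding * using LIMSEQ_unique tendsto_add[OF iter_lim[OF a] iter_lim[OF b]] by blast
qed

lemma neumann_scale:
  assumes a: "\<forall>k. norm (a k) \<le> C"
  shows "neumann e (\<lambda>k. scaleC c (a k)) k = scaleC c (neumann e a k)"
proof -
  have *: "niter e (\<lambda>k. scaleC c (a k)) m k = scaleC c (niter e a m k)" for m k
  proof (induction m arbitrary: k)
    case (Suc m)
    have "niter e (\<lambda>k. scaleC c (a k)) m = (\<lambda>k. scaleC c (niter e a m k))"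
      using Suc by auto
    then show ?case
      by (simp add: mat_op_scale[OF norm_iter[OF a]] bounded_bilinear.diff_right[OF bounded_bilinear_scaleC])
  qed simp
  have "\<forall>k. norm (scaleC c (a k)) \<le> cmod c * C" using a by (auto simp: norm_scaleC intro: mult_left_mono)
  from iter_lim[of "\<lambda>k. scaleC c (a k)", OF this] show ?thesis
    unfolding * using LIMSEQ_unique
      bounded_linear.tendsto[OF bounded_bilinear.bounded_linear_right[OF bounded_bilinear_scaleC] iter_lim[OF a]] by blast
qed

end

text \<open>Each iterate is a series of holomorphic functions, and all are bounded by
  \<open>2 * C\<close>, so the pointwise limit is holomorphic.\<close>

lemma vholo_on_neumann:
  fixes a :: "nat \<Rightarrow> complex \<Rightarrow> 'x::{complex_normed_vector,banach}"
  assumes U: "open U" and e: "\<And>w. w \<in> U \<Longrightarrow> contraction_matrix (e w)"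
    and he: "\<And>k n. (\<lambda>w. e w k n) holomorphic_on U" and ha: "\<And>k. vholo_on (a k) U"
    and a: "\<And>w. w \<in> U \<Longrightarrow> \<forall>k. norm (a k w) \<le> C"
  shows "vholo_on (\<lambda>w. neumann (e w) (\<lambda>k. a k w) n) U"
proof (rule vholo_on_pointwise_limit[OF U])
  show "norm (niter (e w) (\<lambda>k. a k w) m n) \<le> 2 * C" if "w \<in> U" for m w
    by (rule contraction_matrix.norm_iter[OF e[OF that] a[OF that], rule_format])
  show "(\<lambda>m. niter (e w) (\<lambda>k. a k w) m n) \<longlonglongrightarrow> neumann (e w) (\<lambda>k. a k w) n" if "w \<in> U" for w
    by (rule contraction_matrix.iter_lim[OF e[OF that] a[OF that]])
  show "vholo_on (\<lambda>w. niter (e w) (\<lambda>k. a k w) m n) U" for m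
  proof (induction m arbitrary: n)
    case (Suc m)
    have "vholo_on (\<lambda>w. mat_op (e w) (niter (e w) (\<lambda>k. a k w) m) n) U"
      unfolding mat_op_def
    proof (rule vholo_on_series[OF U he Suc])
      show "\<forall>N. (\<Sum>k<N. cmod (e w n k)) \<le> 1 / 2" if "w \<in> U" for w
        by (rule contraction_matrix.e[OF e[OF that]])
      show "\<forall>k. norm (niter (e w) (\<lambda>k. a k w) m k) \<le> 2 * C" if "w \<in> U" for w
        by (rule contraction_matrix.norm_iter[OF e[OF that] a[OF that]])
    qed
    then have "vholo_on (\<lambda>w. a n w + scaleC (-1) (mat_op (e w) (niter (e w) (\<lambda>k. a k w) m) n)) U"
      by (intro vholo_on_add ha vholo_on_scaleC U holomorphic_intros)
    moreover have "scaleC (-1) x = - x" for x :: 'x using scaleC_of_real[of "-1" x] by simp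
    ultimately show ?case by simp
  qed (use ha in simp)
qed

section \<open>Linearity of the Cauchy integral in its density\<close>

lemma Cint_cong:
  assumes "0 \<le> \<rho>" "\<And>s. cmod s = \<rho> \<Longrightarrow> u s = v s"
  shows "Cint \<rho> u w = Cint \<rho> v w"
  unfolding Cint_def using assms norm_circlepath by (intro integral_cong) auto

lemma Cint_add:
  fixes u v :: "complex \<Rightarrow> 'x::{complex_normed_vector,banach}"
  assumes "0 \<le> \<rho>" "cmod w \<noteq> \<rho>" "continuous_on (sphere 0 \<rho>) u" "continuous_on (sphere 0 \<rho>) v"
  shows "Cint \<rho> (\<lambda>s. u s + v s) w = Cint \<rho> u w + Cint \<rho> v w"
  unfolding Cint_def scaleC_add_right
  by (rule integral_add; rule integrable_continuous_real, rule continuous_Cint_integrand) (use assms in auto)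

lemma Cint_scale:
  fixes u :: "complex \<Rightarrow> 'x::{complex_normed_vector,banach}"
  assumes "0 \<le> \<rho>" "cmod w \<noteq> \<rho>" "continuous_on (sphere 0 \<rho>) u"
  shows "Cint \<rho> (\<lambda>s. scaleC c (u s)) w = scaleC c (Cint \<rho> u w)"
proof -
  have "scaleC (x / y) (scaleC c v) = scaleC c (scaleC (x / y) v)" for x y and v :: 'x
    by (simp add: scaleC_scaleC mult.commute)
  then show ?thesis
    unfolding Cint_def
    using integral_linear[OF integrable_continuous_real[OF continuous_Cint_integrand[OF assms]]
      bounded_bilinear.bounded_linear_right[OF bounded_bilinear_scaleC, of c]]
    by (simp add: o_def)
qed

section \<open>The splitting operators\<close>

text \<open>The row vanishes at \<open>w = 0\<close>. For \<open>t\<close> of modulus below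
  \<open>1 / (3 * M)\<close>, Schwarz-Pick bounds the increment \<open>D\<close> of a normalised
  function by \<open>cmod t * (1 + D)\<close>, hence by \<open>3 / 2 * cmod t\<close>; undoing the
  division by \<open>M\<close> gives at most 1/2. This fixes the factor 3 in the radius.\<close>

lemma branch_row_sum:
  fixes k N :: nat
  assumes \<phi>: "\<And>j. \<phi> j holomorphic_on ball 0 1" "\<And>j k. \<phi> j (z k) = (if j = k then 1 else 0)"
    "\<And>x J. cmod x < 1 \<Longrightarrow> (\<Sum>j<J. cmod (\<phi> j x)) \<le> M"
    and h: "h holomorphic_on ball 0 r" "h 0 = z k" "\<And>w. cmod w < r \<Longrightarrow> cmod (h w) < 1"
    and M: "1 \<le> M" and r: "0 < r" and w: "cmod w < r / (3 * M)"
  shows "(\<Sum>n<N. cmod (\<phi> n (h w) - (if k = n then 1 else 0))) \<le> 1 / 2"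
proof -
  \<comment> \<open>Index \<open>k\<close> must be included so that
    \<open>g (z k) = \<theta> k\<close>.\<close>
  define N' where "N' = max N (Suc k)"
  define d where "d n = \<phi> n (h w) - (if k = n then 1 else 0)" for n
  \<comment> \<open>These phases turn the row sum into the increment between \<open>z k\<close> and
    \<open>h w\<close> of one holomorphic function \<open>g\<close>, which is bounded by
    \<open>M\<close>.\<close>
  define \<theta> where "\<theta> n = (if d n = 0 then 0 else cnj (d n) / of_real (cmod (d n)))" for n
  have \<theta>: "cmod (\<theta> n) \<le> 1" "\<theta> n * d n = of_real (cmod (d n))" for n
    using complex_norm_square[of "d n"]
    by (auto simp: \<theta>_def norm_divide power2_eq_square divide_eq_eq mult.commute)
  define s where "s = (\<Sum>n<N'. cmod (d n))"
  define g where "g x = (\<Sum>n<N'. \<theta> n * \<phi> n x)" for x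
  have g: "g holomorphic_on ball 0 1" unfolding g_def by (intro holomorphic_intros \<phi>(1))
  have gM: "cmod (g x) \<le> M" if "cmod x < 1" for x
  proof -
    have "cmod (g x) \<le> (\<Sum>n<N'. 1 * cmod (\<phi> n x))"
      unfolding g_def by (rule sum_norm_le) (auto simp: norm_mult intro!: mult_right_mono[OF \<theta>(1), simplified])
    also have "\<dots> \<le> M" using \<phi>(3)[OF that, of N'] by simp
    finally show ?thesis .
  qed
  have gz: "g (z k) = \<theta> k"
    unfolding g_def \<phi>(2) by (simp add: N'_def sum.delta if_distrib cong: if_cong)
  have "g (h w) - g (z k) = (\<Sum>n<N'. \<theta> n * d n)"
    unfolding g_def \<phi>(2) d_def by (simp add: sum_subtractf[symmetric] right_diff_distrib eq_commute)
  also have "\<dots> = of_real s" by (simp add: \<theta> s_def)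
  finally have gs: "g (h w) - g (z k) = of_real s" .
  have s0: "0 \<le> s" by (simp add: s_def sum_nonneg)
  have w3: "cmod w < r"
  proof -
    have "r / (3 * M) \<le> r / 1" using M r by (intro divide_left_mono) auto
    then show ?thesis using w by simp
  qed
  define G where "G t = g (h (of_real r * t)) / of_real M" for t
  have rt: "cmod (of_real r * t) < r" if "cmod t < 1" for t using that r by (simp add: norm_mult)
  have G: "G holomorphic_on ball 0 1"
  proof -
    have 1: "(h \<circ> (\<lambda>t. of_real r * t)) holomorphic_on ball 0 1"
      by (rule holomorphic_on_compose_gen[OF _ h(1)]) (use rt in \<open>auto intro!: holomorphic_intros\<close>)
    have "(g \<circ> (h \<circ> (\<lambda>t. of_real r * t))) holomorphic_on ball 0 1"
      by (rule holomorphic_on_compose_gen[OF 1 g]) (use rt h(3) in auto)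
    then show ?thesis unfolding G_def o_def by (intro holomorphic_intros) (use M in auto)
  qed
  have G1: "cmod (G t) \<le> 1" if "cmod t < 1" for t
    using gM[OF h(3)[OF rt[OF that]]] M by (simp add: G_def norm_divide divide_le_eq)
  define t where "t = w / of_real r"
  have ct: "cmod t = cmod w / r" using r by (simp add: t_def norm_divide)
  have t1: "cmod t < 1" using ct w3 r by simp
  have Gt: "G t = g (h w) / of_real M" "G 0 = g (z k) / of_real M"
    using r h(2) by (simp_all add: G_def t_def)
  define D where "D = cmod (G t - G 0)"
  have Ds: "D = s / M"
    using gs s0 M unfolding D_def Gt diff_divide_distrib[symmetric] by (simp add: norm_divide)
  have "D \<le> cmod t * cmod (1 - cnj (G 0) * G t)"
    using schwarz_pick[OF G G1 t1, of 0] by (simp add: D_def rho_def)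
  also have "\<dots> \<le> cmod t * (1 + D)"
  proof (rule mult_left_mono)
    \<comment> \<open>Expanding about \<open>G 0\<close> leaves a term in the unit interval and one
      of modulus at most \<open>D\<close>.\<close>
    have "1 - cnj (G 0) * G t = of_real (1 - (cmod (G 0))\<^sup>2) - cnj (G 0) * (G t - G 0)"
      using complex_norm_square[of "G 0"] by (simp add: algebra_simps)
    also have "cmod \<dots> \<le> \<bar>1 - (cmod (G 0))\<^sup>2\<bar> + cmod (G 0) * D"
      unfolding D_def by (rule order_trans[OF norm_triangle_ineq4]) (simp only: norm_of_real norm_mult complex_mod_cnj)
    also have "\<dots> \<le> 1 + 1 * D"
      using G1[of 0] by (intro add_mono mult_right_mono) (auto simp: D_def abs_square_le_1 abs_le_iff)
    finally show "cmod (1 - cnj (G 0) * G t) \<le> 1 + D" by simp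
  qed simp
  finally have D: "D \<le> cmod t * (1 + D)" .
  have "cmod t * (3 * M) < 1" using w M r unfolding ct by (simp add: field_simps)
  then have tM: "cmod t * M < 1 / 3" by simp
  have "cmod t * 1 \<le> cmod t * M" by (rule mult_left_mono[OF M]) simp
  then have t3: "cmod t \<le> 1 / 3" using tM by simp
  have D0: "0 \<le> D" by (simp add: D_def)
  have "cmod t * D \<le> 1 / 3 * D" by (rule mult_right_mono[OF t3 D0])
  then have "D \<le> 3 / 2 * cmod t" using D by (simp add: algebra_simps)
  then have "M * D \<le> M * (3 / 2 * cmod t)" using M by (intro mult_left_mono) auto
  then have "s \<le> 1 / 2" using tM Ds M by (simp add: mult.commute)
  moreover have "(\<Sum>n<N. cmod (d n)) \<le> s" unfolding s_def by (rule sum_mono2) (auto simp: N'_def)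
  ultimately show ?thesis by (simp add: d_def)
qed

locale branches =
  fixes z :: "nat \<Rightarrow> complex" and B :: "complex \<Rightarrow> complex" and \<phi> h :: "nat \<Rightarrow> complex \<Rightarrow> complex" and R M :: real
  assumes M: "0 \<le> M" and R: "0 < R" and B: "B holomorphic_on ball 0 1"
    and \<phi>: "\<And>j. \<phi> j holomorphic_on ball 0 1"
    and \<phi>_sum: "\<And>x. cmod x < 1 \<Longrightarrow> \<forall>J. (\<Sum>j<J. cmod (\<phi> j x)) \<le> M"
    and h: "\<And>k. h k holomorphic_on annulus R"
    and h_ball: "\<And>k w. w \<in> annulus R \<Longrightarrow> cmod (h k w) < 1"
    and Bh: "\<And>k w. w \<in> annulus R \<Longrightarrow> B (h k w) = w"
    and hB: "\<And>x. cmod x < 1 \<Longrightarrow> B x \<in> annulus R \<Longrightarrow> \<exists>k. h k (B x) = x"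
    and row: "\<And>k w. w \<in> annulus R \<Longrightarrow> \<forall>N. (\<Sum>n<N. cmod (\<phi> n (h k w) - (if k = n then 1 else 0))) \<le> 1 / 2"
begin

definition e :: "complex \<Rightarrow> nat \<Rightarrow> nat \<Rightarrow> complex" where
  "e w k n = \<phi> n (h k w) - (if k = n then 1 else 0)"

lemma contraction: "w \<in> annulus R \<Longrightarrow> contraction_matrix (e w)"
  by standard (use row in \<open>simp add: e_def\<close>)

lemma \<phi>h: "(\<lambda>w. \<phi> n (h k w)) holomorphic_on annulus R"
  using holomorphic_on_compose_gen[OF h \<phi>, of k n] h_ball by (force simp: o_def)

definition Az :: "complex set" where "Az = {x \<in> ball 0 1. B x \<in> annulus R}"

lemma h_Az: "w \<in> annulus R \<Longrightarrow> h k w \<in> Az"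
  using h_ball Bh by (simp add: Az_def)

text \<open>Solution of the infinite system with matrix \<open>\<phi> n (h k w)\<close> and data
  \<open>f (h k w)\<close>: the values to prescribe at the nodes so that the interpolant takes the
  values of \<open>f\<close> on the whole fibre over \<open>w\<close>.\<close>

definition coeff :: "(complex \<Rightarrow> 'x::{complex_normed_vector,banach}) \<Rightarrow> complex \<Rightarrow> nat \<Rightarrow> 'x" where
  "coeff f w = neumann (e w) (\<lambda>k. f (h k w))"

definition F :: "(complex \<Rightarrow> 'x::{complex_normed_vector,banach}) \<Rightarrow> complex \<Rightarrow> complex \<Rightarrow> 'x" where
  "F f x w = (\<Sum>n. scaleC (\<phi> n x) (coeff f w n))"

lemma Hinf_bound: "f \<in> Hinf Az \<Longrightarrow> x \<in> Az \<Longrightarrow> norm (f x) \<le> supnorm Az f"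
  unfolding Hinf_def supnorm_def
  by (auto intro!: cSUP_upper simp: bounded_iff bdd_above_def)

context
  fixes f :: "complex \<Rightarrow> 'x::{complex_normed_vector,banach}"
  assumes f: "f \<in> Hinf Az"
begin

lemma data_bound: "w \<in> annulus R \<Longrightarrow> \<forall>k. norm (f (h k w)) \<le> supnorm Az f"
  using Hinf_bound[OF f h_Az] by blast

lemma coeff_bound: "w \<in> annulus R \<Longrightarrow> \<forall>n. norm (coeff f w n) \<le> 2 * supnorm Az f"
  unfolding coeff_def by (rule contraction_matrix.norm_neumann[OF contraction data_bound])

lemma vholo_coeff: "vholo_on (\<lambda>w. coeff f w n) (annulus R)"
  unfolding coeff_def
proof (rule vholo_on_neumann[OF open_annulus contraction _ _ data_bound])
  show "(\<lambda>w. e w k n) holomorphic_on annulus R" for k n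
    unfolding e_def by (intro holomorphic_intros \<phi>h)
  have fh: "vholo_on f Az" using f by (simp add: Hinf_def)
  show "vholo_on (\<lambda>w. f (h k w)) (annulus R)" for k
    by (rule vholo_on_compose[OF open_annulus h _ fh]) (use h_Az in auto)
qed

lemma F_bound: "cmod x < 1 \<Longrightarrow> w \<in> annulus R \<Longrightarrow> norm (F f x w) \<le> M * (2 * supnorm Az f)"
  unfolding F_def by (rule scaleC_series(2)[OF \<phi>_sum coeff_bound])

lemma summable_F: "cmod x < 1 \<Longrightarrow> w \<in> annulus R \<Longrightarrow> summable (\<lambda>n. scaleC (\<phi> n x) (coeff f w n))"
  by (rule scaleC_series(1)[OF \<phi>_sum coeff_bound])

lemma vholo_F1: "w \<in> annulus R \<Longrightarrow> vholo_on (\<lambda>x. F f x w) (ball 0 1)"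
  unfolding F_def
  by (rule vholo_on_series[OF open_ball \<phi> vholo_on_const _ coeff_bound]) (auto intro: \<phi>_sum[rule_format])

lemma vholo_F2: "cmod x < 1 \<Longrightarrow> vholo_on (F f x) (annulus R)"
  unfolding F_def[abs_def]
  by (rule vholo_on_series[OF open_annulus holomorphic_on_const vholo_coeff _ coeff_bound]) (auto intro: \<phi>_sum[rule_format])

text \<open>On the fibre, \<open>x = h k (B x)\<close>, and \<open>\<phi> n x\<close> is the
  \<open>k\<close>-th row of \<open>e\<close> plus the identity, so the series is the left-hand side
  of \<open>neumann_eq\<close>.\<close>

lemma F_interpolates:
  assumes x: "x \<in> Az"
  shows "F f x (B x) = f x"
proof -
  have w: "B x \<in> annulus R" and x1: "cmod x < 1" using x by (auto simp: Az_def)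
  obtain k where k: "h k (B x) = x" using hB[OF x1 w] by blast
  let ?w = "B x" and ?y = "coeff f (B x)"
  have zero: "scaleC 0 v = 0" for v :: 'x using norm_scaleC[of 0 v] by simp
  have "(\<lambda>n. scaleC (if k = n then 1 else 0) (?y n)) sums ?y k"
    using sums_If_finite_set[of "{k}" ?y] by (simp add: zero scaleC_one if_distrib[of "\<lambda>c. scaleC c _"] eq_commute cong: if_cong)
  then have "(\<lambda>n. scaleC (e ?w k n) (?y n) + scaleC (if k = n then 1 else 0) (?y n)) sums (mat_op (e ?w) ?y k + ?y k)"
    unfolding mat_op_def
    by (intro sums_add summable_sums contraction_matrix.mat_op_summable[OF contraction[OF w] coeff_bound[OF w]])
  then have "(\<lambda>n. scaleC (\<phi> n x) (?y n)) sums (mat_op (e ?w) ?y k + ?y k)"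
    unfolding scaleC_add_left[symmetric] by (simp add: e_def k)
  then have "F f x ?w = mat_op (e ?w) ?y k + ?y k"
    unfolding F_def by (rule sums_unique[symmetric])
  also have "\<dots> = f x"
    using contraction_matrix.neumann_eq[OF contraction[OF w] data_bound[OF w], of k] k by (simp add: coeff_def add.commute)
  finally show ?thesis .
qed

lemma annulus_family: "annulus_family (F f) R (M * (2 * supnorm Az f)) (ball 0 1) B"
  by standard (use R B vholo_F1 vholo_F2 F_bound in auto)

lemma annulus_function: "cmod x < 1 \<Longrightarrow> annulus_function (F f x) R (M * (2 * supnorm Az f))"
  by standard (use R vholo_F2 F_bound in auto)

lemma continuous_F: "cmod x < 1 \<Longrightarrow> R < t \<Longrightarrow> t < 2 * R \<Longrightarrow> continuous_on (sphere 0 t) (F f x)"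
  by (rule annulus_function.cont[OF annulus_function])

end

lemma F_add:
  assumes "f \<in> Hinf Az" "g \<in> Hinf Az" "cmod x < 1" "w \<in> annulus R"
  shows "F (\<lambda>x. f x + g x) x w = F f x w + F g x w"
proof -
  have "coeff (\<lambda>x. f x + g x) w n = coeff f w n + coeff g w n" for n
    unfolding coeff_def
    by (rule contraction_matrix.neumann_add[OF contraction data_bound data_bound]) (use assms in auto)
  then show ?thesis
    using suminf_add[OF summable_F[OF assms(1,3,4)] summable_F[OF assms(2-4)]]
    by (simp add: F_def scaleC_add_right)
qed

lemma F_scale:
  fixes f :: "complex \<Rightarrow> 'x::{complex_normed_vector,banach}"
  assumes "f \<in> Hinf Az" "cmod x < 1" "w \<in> annulus R"
  shows "F (\<lambda>x. scaleC c (f x)) x w = scaleC c (F f x w)"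
proof -
  have c: "coeff (\<lambda>x. scaleC c (f x)) w n = scaleC c (coeff f w n)" for n
    unfolding coeff_def
    by (rule contraction_matrix.neumann_scale[OF contraction data_bound]) (use assms in auto)
  have "scaleC (\<phi> n x) (scaleC c v) = scaleC c (scaleC (\<phi> n x) v)" for n and v :: 'x
    by (simp add: scaleC_scaleC mult.commute)
  then show ?thesis
    unfolding F_def c
    using bounded_linear.suminf[OF bounded_bilinear.bounded_linear_right[OF bounded_bilinear_scaleC] summable_F[OF assms]]
    by simp
qed

definition S1 :: "complex set" where "S1 = {x \<in> ball 0 1. R < cmod (B x)}"
definition S2 :: "complex set" where "S2 = {x \<in> ball 0 1. cmod (B x) < 2 * R}"

definition T1 :: "(complex \<Rightarrow> 'x::{complex_normed_vector,banach}) \<Rightarrow> complex \<Rightarrow> 'x" where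
  "T1 f x = principal_part R (F f x) (B x)"

definition T2 :: "(complex \<Rightarrow> 'x::{complex_normed_vector,banach}) \<Rightarrow> complex \<Rightarrow> 'x" where
  "T2 f x = regular_part R (F f x) (B x)"

lemma T_sum:
  assumes "f \<in> Hinf Az" "x \<in> Az"
  shows "T1 f x + T2 f x = f x"
  using annulus_function.split[OF annulus_function[OF assms(1)], of x "B x"] F_interpolates[OF assms] assms(2)
  by (simp add: T1_def T2_def Az_def add.commute)

text \<open>\<open>F_add\<close> holds for second arguments in the annulus only, and the circle lies
  there. The radii chosen in \<open>T1\<close> and \<open>T2\<close> depend on the point alone, not
  on the function, so additivity passes to the operators.\<close>

lemma Cint_F_add:
  assumes f: "f \<in> Hinf Az" and g: "g \<in> Hinf Az" and x: "cmod x < 1" and t: "R < t" "t < 2 * R" "cmod w \<noteq> t"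
  shows "Cint t (F (\<lambda>x. f x + g x) x) w = Cint t (F f x) w + Cint t (F g x) w"
proof -
  have "Cint t (F (\<lambda>x. f x + g x) x) w = Cint t (\<lambda>s. F f x s + F g x s) w"
    by (rule Cint_cong) (use R t F_add[OF f g x] in \<open>auto simp: annulus_def\<close>)
  also have "\<dots> = Cint t (F f x) w + Cint t (F g x) w"
    by (rule Cint_add[OF _ t(3) continuous_F[OF f x t(1,2)] continuous_F[OF g x t(1,2)]]) (use R t in simp)
  finally show ?thesis .
qed

lemma Cint_F_scale:
  assumes f: "f \<in> Hinf Az" and x: "cmod x < 1" and t: "R < t" "t < 2 * R" "cmod w \<noteq> t"
  shows "Cint t (F (\<lambda>x. scaleC c (f x)) x) w = scaleC c (Cint t (F f x) w)"
proof -
  have "Cint t (F (\<lambda>x. scaleC c (f x)) x) w = Cint t (\<lambda>s. scaleC c (F f x s)) w"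
    by (rule Cint_cong) (use R t F_scale[OF f x] in \<open>auto simp: annulus_def\<close>)
  also have "\<dots> = scaleC c (Cint t (F f x) w)"
    by (rule Cint_scale[OF _ t(3) continuous_F[OF f x t(1,2)]]) (use R t in simp)
  finally show ?thesis .
qed

text \<open>\<open>V\<close> has to be nonempty because \<open>supnorm V\<close> is a real supremum,
  which is bounded by its elements' bounds only over a nonempty set.\<close>

lemma bounded_opI:
  fixes T :: "(complex \<Rightarrow> 'x::{complex_normed_vector,banach}) \<Rightarrow> complex \<Rightarrow> 'x"
  assumes V: "V \<noteq> {}" and hol: "\<And>f. f \<in> Hinf Az \<Longrightarrow> vholo_on (T f) V"
    and le: "\<And>f x. f \<in> Hinf Az \<Longrightarrow> x \<in> V \<Longrightarrow> norm (T f x) \<le> K * supnorm Az f"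
    and add: "\<And>f g x. f \<in> Hinf Az \<Longrightarrow> g \<in> Hinf Az \<Longrightarrow> x \<in> V \<Longrightarrow> T (\<lambda>x. f x + g x) x = T f x + T g x"
    and scale: "\<And>f c x. f \<in> Hinf Az \<Longrightarrow> x \<in> V \<Longrightarrow> T (\<lambda>x. scaleC c (f x)) x = scaleC c (T f x)"
  shows "bounded_op Az V K T"
  unfolding bounded_op_def
proof (intro conjI ballI allI)
  fix f :: "complex \<Rightarrow> 'x" assume f: "f \<in> Hinf Az"
  show "T f \<in> Hinf V" unfolding Hinf_def bounded_iff using hol[OF f] le[OF f] by auto
  show "supnorm V (T f) \<le> K * supnorm Az f"
    unfolding supnorm_def[of V] by (rule cSUP_least[OF V le[OF f]])
qed (use add scale in auto)

lemma ex_Az: "\<exists>x. x \<in> Az"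
proof -
  have "complex_of_real (3/2 * R) \<in> annulus R" using R by (simp add: annulus_def norm_mult)
  then show ?thesis using h_Az by blast
qed

text \<open>The 6 is the factor 3 of \<open>principal_le\<close> times the 2 in the bound of
  \<open>F\<close>; in the same way \<open>regular_le\<close> leads to 4 for
  \<open>T2\<close>.\<close>

lemma bounded_op_T1: "bounded_op Az S1 (6 * M) (T1 :: (complex \<Rightarrow> 'x::{complex_normed_vector,banach}) \<Rightarrow> complex \<Rightarrow> 'x)"
proof (rule bounded_opI)
  show "S1 \<noteq> {}" using ex_Az by (auto simp: Az_def S1_def annulus_def)
  have i: "R < inner_radius R (B x)" "inner_radius R (B x) < 2 * R" "cmod (B x) \<noteq> inner_radius R (B x)" if "x \<in> S1" for x
    using inner_radius[OF R, of "B x"] that by (auto simp: S1_def)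
  fix f :: "complex \<Rightarrow> 'x" assume f: "f \<in> Hinf Az"
  show "vholo_on (T1 f) S1"
    unfolding T1_def[abs_def] S1_def by (rule annulus_family.vholo_principal[OF annulus_family[OF f]])
  fix x assume x: "x \<in> S1"
  then have x1: "cmod x < 1" by (simp add: S1_def)
  show "norm (T1 f x) \<le> 6 * M * supnorm Az f"
    using annulus_function.principal_le[OF annulus_function[OF f x1], of "B x"] x by (simp add: T1_def S1_def)
  show "T1 (\<lambda>x. scaleC c (f x)) x = scaleC c (T1 f x)" for c
    by (simp add: T1_def principal_part_def Cint_F_scale[OF f x1 i[OF x]]
        bounded_bilinear.minus_right[OF bounded_bilinear_scaleC])
  show "T1 (\<lambda>x. f x + g x) x = T1 f x + T1 g x" if "g \<in> Hinf Az" for g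
    by (simp add: T1_def principal_part_def Cint_F_add[OF f that x1 i[OF x]])
qed

lemma bounded_op_T2: "bounded_op Az S2 (4 * M) (T2 :: (complex \<Rightarrow> 'x::{complex_normed_vector,banach}) \<Rightarrow> complex \<Rightarrow> 'x)"
proof (rule bounded_opI)
  show "S2 \<noteq> {}" using ex_Az by (auto simp: Az_def S2_def annulus_def)
  have i: "R < outer_radius R (B x)" "outer_radius R (B x) < 2 * R" "cmod (B x) \<noteq> outer_radius R (B x)" if "x \<in> S2" for x
    using outer_radius[OF R, of "B x"] that by (auto simp: S2_def)
  fix f :: "complex \<Rightarrow> 'x" assume f: "f \<in> Hinf Az"
  show "vholo_on (T2 f) S2"
    unfolding T2_def[abs_def] S2_def by (rule annulus_family.vholo_regular[OF annulus_family[OF f]])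
  fix x assume x: "x \<in> S2"
  then have x1: "cmod x < 1" by (simp add: S2_def)
  show "norm (T2 f x) \<le> 4 * M * supnorm Az f"
    using annulus_function.regular_le[OF annulus_function[OF f x1], of "B x"] x by (simp add: T2_def S2_def)
  show "T2 (\<lambda>x. scaleC c (f x)) x = scaleC c (T2 f x)" for c
    by (simp add: T2_def regular_part_def Cint_F_scale[OF f x1 i[OF x]])
  show "T2 (\<lambda>x. f x + g x) x = T2 f x + T2 g x" if "g \<in> Hinf Az" for g
    by (simp add: T2_def regular_part_def Cint_F_add[OF f that x1 i[OF x]])
qed

end

lemma separated_of_sep_const:
  assumes z: "\<And>n. cmod (z n) < 1" and \<delta>: "0 < \<delta>" "\<delta> \<le> sep_const z"
  shows "separated z \<delta>"
proof
  fix k N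
  let ?p = "\<lambda>k n. \<Prod>j\<in>{..<n} - {k}. rho (z j) (z k)"
  have p0: "0 \<le> ?p k n" for k n by (intro prod_nonneg) (simp add: rho_nonneg)
  have i0: "0 \<le> (INF n. ?p k n)" for k by (rule cINF_greatest) (use p0 in auto)
  have "sep_const z \<le> (INF n. ?p k n)"
    unfolding sep_const_def by (rule cINF_lower) (use i0 in \<open>auto intro!: bdd_belowI2[where m = 0]\<close>)
  also have "\<dots> \<le> ?p k N"
    by (rule cINF_lower) (use p0 in \<open>auto intro!: bdd_belowI2[where m = 0]\<close>)
  finally show "\<delta> \<le> ?p k N" using \<delta> by simp
qed (use assms in auto)

theorem theorem2p5:
  fixes z :: "nat \<Rightarrow> complex" and del lam :: real
    and Xty :: "'x::{complex_normed_vector, banach} itself"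
  assumes "interpolating z"
    and "0 < del" and "del \<le> sep_const z"
    and "0 < lam" and "lam < 1" and "2 * lam / (1 + lam\<^sup>2) < del"
  shows "let r = (del - lam) / (1 - lam * del) * lam;
             M = interp_const z;
             B = blaschke z;
             A = udisk (r / (3 * M)) - cudisk (r / (6 * M));
             Az = ball 0 1 \<inter> B -` A;
             S1 = ball 0 1 \<inter> B -` (ball 0 1 - cudisk (r / (6 * M)));
             S2 = ball 0 1 \<inter> B -` udisk (r / (3 * M))
         in \<exists>T1 T2 :: (complex \<Rightarrow> 'x) \<Rightarrow> (complex \<Rightarrow> 'x).
              bounded_op Az S1 (6 * M) T1 \<and> bounded_op Az S2 (4 * M) T2 \<and>
              (\<forall>f\<in>Hinf Az. \<forall>w\<in>Az. T1 f w + T2 f w = f w)"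
proof -
  define r where "r = (del - lam) / (1 - lam * del) * lam"
  define M where "M = interp_const z"
  define B where "B = blaschke z"
  \<comment> \<open>The annulus with radii \<open>R\<close> and \<open>2 * R\<close> is the set
    \<open>A\<close> of the statement, and \<open>2 * R\<close> is the radius allowed by
    \<open>branch_row_sum\<close>.\<close>
  define R where "R = r / (6 * M)"
  have z: "cmod (z n) < 1" for n using assms(1) by (simp add: interpolating_def)
  have lam: "lam < del"
  proof -
    have "lam\<^sup>2 \<le> 1" using assms(4,5) by (simp add: power_le_one)
    then have "lam * (1 + lam\<^sup>2) \<le> lam * 2" using assms(4) by (intro mult_left_mono) auto
    then have "lam \<le> 2 * lam / (1 + lam\<^sup>2)" by (simp add: le_divide_eq mult.commute add_pos_nonneg)
    then show ?thesis using assms(6) by simp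
  qed
  interpret separated_radius z del lam r
    by (intro separated_radius.intro separated_of_sep_const separated_radius_axioms.intro)
       (use z assms lam r_def in auto)
  have M1: "1 \<le> M" unfolding M_def by (rule interp_const_ge_1[OF assms(1)])
  have R: "0 < R" "2 * R = r / (3 * M)" using r_pos M1 by (auto simp: R_def)
  have R2: "2 * R < r" using r_pos M1 unfolding R(2) by (simp add: divide_less_eq)
  obtain \<phi> where \<phi>: "\<And>j. \<phi> j holomorphic_on ball 0 1" "\<And>j k. \<phi> j (z k) = (if j = k then 1 else 0)"
    "\<And>x J. cmod x < 1 \<Longrightarrow> (\<Sum>j<J. cmod (\<phi> j x)) \<le> M"
    using beurling[OF assms(1)] unfolding M_def by blast
  have "\<exists>h. h holomorphic_on ball 0 r \<and> h 0 = z n \<and> (\<forall>w. cmod w < r \<longrightarrow> cmod (h w) < 1 \<and> B (h w) = w) \<and>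
    (\<forall>x. cmod x < 1 \<longrightarrow> rho x (z n) < lam \<longrightarrow> cmod (B x) < r \<longrightarrow> h (B x) = x)" for n
    using inverse_branch[of n] unfolding B_def by metis
  then obtain h where h: "\<And>n. h n holomorphic_on ball 0 r" "\<And>n. h n 0 = z n"
    "\<And>n w. cmod w < r \<Longrightarrow> cmod (h n w) < 1" "\<And>n w. cmod w < r \<Longrightarrow> B (h n w) = w"
    "\<And>n x. cmod x < 1 \<Longrightarrow> rho x (z n) < lam \<Longrightarrow> cmod (B x) < r \<Longrightarrow> h n (B x) = x"
    by metis
  have ar: "cmod w < r" if "w \<in> annulus R" for w using that R2 by (simp add: annulus_def)
  interpret br: branches z B \<phi> h R M
  proof
    show "B holomorphic_on ball 0 1" unfolding B_def blaschke_eq_omit by (rule holomorphic_omit)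
    show "h k holomorphic_on annulus R" for k by (rule holomorphic_on_subset[OF h(1)]) (use ar in auto)
    show "\<exists>k. h k (B x) = x" if x: "cmod x < 1" "B x \<in> annulus R" for x
    proof -
      obtain n where "rho x (z n) < lam"
        using blaschke_small_near_zero[OF x(1)] ar[OF x(2)] unfolding B_def by blast
      then show ?thesis using h(5)[OF x(1) _ ar[OF x(2)]] by blast
    qed
    show "\<forall>N. (\<Sum>n<N. cmod (\<phi> n (h k w) - (if k = n then 1 else 0))) \<le> 1 / 2" if "w \<in> annulus R" for k w
      using branch_row_sum[OF \<phi> h(1,2,3) M1 r_pos, of w] that R(2) by (simp add: annulus_def)
  qed (use M1 R \<phi> h ar in auto)
  have A: "udisk (r / (3 * M)) - cudisk (r / (6 * M)) = annulus R"
    by (auto simp: udisk_def cudisk_def annulus_def R(2) R_def)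
  have Az: "ball 0 1 \<inter> B -` annulus R = br.Az" by (auto simp: br.Az_def)
  \<comment> \<open>One factor of modulus below 1 makes the product strictly smaller than 1, so the
    restriction to \<open>ball 0 1\<close> in the description of \<open>S1\<close> holds
    automatically.\<close>
  have B1: "cmod (B x) < 1" if x: "cmod x < 1" for x
  proof -
    have "cmod (B x) = rho x (z 0) * cmod (omit {0} x)"
      unfolding B_def blaschke_split[OF x, of 0] by (simp add: norm_mult norm_blaschke_factor)
    also have "\<dots> \<le> rho x (z 0) * 1" by (intro mult_left_mono norm_omit_le x rho_nonneg)
    also have "\<dots> < 1" using rho_less_1[OF z x] by simp
    finally show ?thesis .
  qed
  have S1: "ball 0 1 \<inter> B -` (ball 0 1 - cudisk (r / (6 * M))) = br.S1"
    using B1 unfolding R_def[symmetric] by (auto simp: br.S1_def cudisk_def)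
  have S2: "ball 0 1 \<inter> B -` udisk (r / (3 * M)) = br.S2"
    by (auto simp: br.S2_def udisk_def R(2))
  show ?thesis
    unfolding Let_def r_def[symmetric] M_def[symmetric] B_def[symmetric] A Az S1 S2
    using br.bounded_op_T1 br.bounded_op_T2 br.T_sum by blast
qed

end
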